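(* Let $K_0$ be an infinite field, $K \supseteq K_0$ a field, $\mathcal{C}$ a $K_0$-linear abelian category, and $F : K\mathrm{Vect}^f \to \mathcal{C}$ a $K_0$-linear functor such that $F(K)$ is non-trivial (i.e. non-zero) but cube-bounded. Let $d = \operatorname{rk}_0(F(K))$, let $A \in \operatorname{Sub}_{\mathcal{C}}(F(K))$ be a pedestal, and let $\varsigma$ be the $d$-inflator on $K$ associated to $A$. For $x \in K$, let $xA \subseteq F(K)$ denote the image of $A$ under $F(x) : F(K) \to F(K)$, where $x$ is viewed as the multiplication map $K \to K$. Then the fundamental ring of $\varsigma$ is the "stabilizer" $$R = \{x \in K : xA \subseteq A\}$$ and the fundamental ideal of $\varsigma$ is $$I = \{x \in R : \operatorname{rk}_0(A/xA) = d\}.$$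
   Context: Fix an infinite field $K_0$. For an object $A$ of a $K_0$-linear abelian category $\mathcal{C}$, $\operatorname{Sub}_{\mathcal{C}}(A^n)$ is the modular lattice of subobjects of $A^n$. The directory $\operatorname{Dir}_{\mathcal{C}}(A)$ is the multi-sorted structure $(\operatorname{Sub}_{\mathcal{C}}(A^n))_{n\ge1}$ with the lattice structure on each sort, the maps $\oplus: \operatorname{Sub}(A^n)\times\operatorname{Sub}(A^m)\to\operatorname{Sub}(A^{n+m})$, and the action of $GL_n(K_0)$ on $\operatorname{Sub}(A^n)$. A directory is any structure isomorphic to one of this form. If $\mathcal{C}$ is the category of left modules over a $K_0$-algebra $S$, one writes $\operatorname{Sub}_S$, $\operatorname{Dir}_S$. A morphism of directories $f:D_\bullet\to D'_\bullet$ is a family of maps $f_n:D_n\to D'_n$, each order-preserving and $GL_n(K_0)$-equivariant, with $f_{n+m}(x\oplus y)=f_n(x)\oplus f_m(y)$ (the lattice operations need not be preserved). "Semisimple" means semisimple of finite length. A directory $\operatorname{Dir}_{\mathcal{C}}(B)$ is semisimple of length $d$ if $B$ is semisimple of length $d$. For a field $K\supseteq K_0$, a $d$-inflator on $K$ is a morphism of directories $\varsigma:\operatorname{Dir}_K(K)\to D_\bullet$, where $D_\bullet$ is semisimple of length $d$, such that $\ell(\varsigma_n(V))=d\cdot\dim_K(V)$ for all $n$ and all $V\in\operatorname{Sub}_K(K^n)$; here $\ell$ denotes length. Fundamental ring and ideal. Let $\varsigma:\operatorname{Dir}_K(K)\to\operatorname{Dir}_{\mathcal{D}}(B)$ be a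 $d$-inflator. For $\alpha\in K$ let $\Theta_\alpha=\{(x,\alpha x):x\in K\}$, and for $\varphi\in\operatorname{End}_{\mathcal{D}}(B)$ let $\Theta_\varphi\subseteq B^2$ be its graph; $\alpha$ specializes to $\varphi$ if $\varsigma_2(\Theta_\alpha)=\Theta_\varphi$. The fundamental ring is the set of $\alpha\in K$ specializing to some endomorphism of $B$; the fundamental ideal is the set of $\alpha\in K$ specializing to $0$. They are unchanged if $\varsigma$ is composed with an isomorphism of directories. $K\mathrm{Vect}^f$ is the category of finite-dimensional $K$-vector spaces. Cubes and ranks. In a modular lattice $M$, a strict $n$-cube is an injective map from the power set of $\{1,\dots,n\}$ to $M$ preserving binary joins and meets; its base is the image of $\emptyset$. $\operatorname{rk}_0(M)\in\mathbb{N}\cup\{\infty\}$ (reduced rank) is the supremum of $n$ such that $M$ has a strict $n$-cube; if $M$ has a least element $\bot$, $\operatorname{rk}_\bot(M)$ is the supremum of $n$ such that $M$ has a strict $n$-cube with base $\bot$. For an object $X$ of an abelian category, $\operatorname{rk}_0(X)=\operatorname{rk}_0(\operatorname{Sub}(X))$ and $\operatorname{rk}_\bot(X)=\operatorname{rk}_\bot(\operatorname{Sub}(X))$; $X$ is cube-bounded if $\operatorname{rk}_0(X)<\infty$. With $d=\operatorname{rk}_0(F(K))$, a pedestal is a $\mathcal{C}$-subobject $A\subseteq F(K)$ with $\operatorname{rk}_\bot(F(K)/A)=d$. Flattening. Let $M$ be a bounded modular lattice with $\operatorname{rk}_\bot(M)<\infty$. A quasi-atom is an element $q>\bot$ such that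 $(\bot,q]$ is closed under $\wedge$. There is a modular pregeometry on the set of quasi-atoms in which a finite set $\{q_1,\dots,q_n\}$ (distinct) is independent iff $(q_1\vee\dots\vee q_{i-1})\wedge q_i=\bot$ for $2\le i\le n$. $M^\flat$ is the lattice of closed sets of this pregeometry, and $V:M\to M^\flat$ sends $x$ to the closed set $V(x)=\{q \text{ quasi-atom}: q\wedge x>\bot\}$. A map $f:M\to P$ to a poset is a flattening map if $f=g\circ V$ for some poset isomorphism $g:M^\flat\to P$. For a directory $D_\bullet$ with $D_1$ cube-bounded, there is a directory $D^\flat_\bullet$ with a directory morphism $D_\bullet\to D_\bullet^\flat$ such that each $D_n\to D_n^\flat$ is a flattening map; it is unique up to isomorphism, and is called the flattening map. The $d$-inflator associated to a pedestal $A$ is the composition $\operatorname{Dir}_K(K)\to\operatorname{Dir}_{\mathcal{C}}(F(K))\to\operatorname{Dir}_{\mathcal{C}}(F(K)/A)\to\operatorname{Dir}_{\mathcal{C}}(F(K)/A)^\flat$, where the first map sends $V\subseteq K^n$ to $F(V)\subseteq F(K)^n$ ($F$ is automatically exact), the second sends $X\subseteq F(K)^n$ to $(X+A^n)/A^n$, and the third is the flattening map.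
   Formalization: The fundamental ideal is stated as {0} ∪ {x ∈ R : rk_0(A/xA) = d}: 0 always lies in it, but the original formula omits 0 when rk_0(A) < d (e.g. F the identity on KVect^f, A = 0, d = 1). *)

theory Defs
  imports
    "HOL-Algebra.Lattice"
    "HOL-Library.Extended_Nat"
    "Jordan_Normal_Form.VS_Connect"
begin

section \<open>Linear and abelian categories\<close>

text \<open>
  Each hom-set carries its vector space structure, as a module record over \<^term>\<open>class_ring\<close>;
  the ring-multiplication fields \<open>mult\<close> and \<open>one\<close> of that record are junk, as usual for modules.
  \<open>Hom C X Y\<close> is only constrained when \<open>X\<close> and \<open>Y\<close> belong to \<open>Ob C\<close>.
\<close>

record ('k, 'o, 'a) lincat =
  Ob :: "'o set"
  Hom :: "'o \<Rightarrow> 'o \<Rightarrow> ('k, 'a) module"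
  Dom :: "'a \<Rightarrow> 'o"
  Cod :: "'a \<Rightarrow> 'o"
  Idn :: "'o \<Rightarrow> 'a"
  cmp :: "'a \<Rightarrow> 'a \<Rightarrow> 'a" (infixr \<open>\<cdot>\<index>\<close> 75)

locale linear_category =
  fixes C :: "('k::field, 'o, 'a) lincat" (structure)
  assumes Hom_vectorspace:
      "\<lbrakk>X \<in> Ob C; Y \<in> Ob C\<rbrakk> \<Longrightarrow> vectorspace class_ring (Hom C X Y)"
    and Hom_Dom_Cod:
      "\<lbrakk>X \<in> Ob C; Y \<in> Ob C; f \<in> carrier (Hom C X Y)\<rbrakk> \<Longrightarrow> Dom C f = X \<and> Cod C f = Y"
    and Idn_closed: "X \<in> Ob C \<Longrightarrow> Idn C X \<in> carrier (Hom C X X)"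
    and cmp_Idn:
      "\<lbrakk>X \<in> Ob C; Y \<in> Ob C; f \<in> carrier (Hom C X Y)\<rbrakk> \<Longrightarrow> f \<cdot> Idn C X = f \<and> Idn C Y \<cdot> f = f"
    and cmp_assoc:
      "\<lbrakk>W \<in> Ob C; X \<in> Ob C; Y \<in> Ob C; Z \<in> Ob C;
        f \<in> carrier (Hom C W X); g \<in> carrier (Hom C X Y); h \<in> carrier (Hom C Y Z)\<rbrakk>
       \<Longrightarrow> (h \<cdot> g) \<cdot> f = h \<cdot> (g \<cdot> f)"
    and cmp_linear_right:
      "\<lbrakk>X \<in> Ob C; Y \<in> Ob C; Z \<in> Ob C; g \<in> carrier (Hom C Y Z)\<rbrakk>
       \<Longrightarrow> (\<lambda>f. g \<cdot> f) \<in> module_hom class_ring (Hom C X Y) (Hom C X Z)"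
    and cmp_linear_left:
      "\<lbrakk>X \<in> Ob C; Y \<in> Ob C; Z \<in> Ob C; f \<in> carrier (Hom C X Y)\<rbrakk>
       \<Longrightarrow> (\<lambda>g. g \<cdot> f) \<in> module_hom class_ring (Hom C Y Z) (Hom C X Z)"

definition arrow :: "('k, 'o, 'a) lincat \<Rightarrow> 'a \<Rightarrow> bool" where
  "arrow C f \<longleftrightarrow> Dom C f \<in> Ob C \<and> Cod C f \<in> Ob C \<and> f \<in> carrier (Hom C (Dom C f) (Cod C f))"

definition monic :: "('k, 'o, 'a) lincat \<Rightarrow> 'a \<Rightarrow> bool" where
  "monic C m \<longleftrightarrow> arrow C m \<and>
     (\<forall>X\<in>Ob C. \<forall>g\<in>carrier (Hom C X (Dom C m)). \<forall>h\<in>carrier (Hom C X (Dom C m)).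
        m \<cdot>\<^bsub>C\<^esub> g = m \<cdot>\<^bsub>C\<^esub> h \<longrightarrow> g = h)"

definition epic :: "('k, 'o, 'a) lincat \<Rightarrow> 'a \<Rightarrow> bool" where
  "epic C e \<longleftrightarrow> arrow C e \<and>
     (\<forall>X\<in>Ob C. \<forall>g\<in>carrier (Hom C (Cod C e) X). \<forall>h\<in>carrier (Hom C (Cod C e) X).
        g \<cdot>\<^bsub>C\<^esub> e = h \<cdot>\<^bsub>C\<^esub> e \<longrightarrow> g = h)"

definition is_kernel :: "('k, 'o, 'a) lincat \<Rightarrow> 'a \<Rightarrow> 'a \<Rightarrow> bool" where
  "is_kernel C k f \<longleftrightarrow> arrow C f \<and> arrow C k \<and> Cod C k = Dom C f \<and>
     f \<cdot>\<^bsub>C\<^esub> k = \<zero>\<^bsub>Hom C (Dom C k) (Cod C f)\<^esub> \<and>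
     (\<forall>Z\<in>Ob C. \<forall>g\<in>carrier (Hom C Z (Dom C f)). f \<cdot>\<^bsub>C\<^esub> g = \<zero>\<^bsub>Hom C Z (Cod C f)\<^esub> \<longrightarrow>
        (\<exists>!u. u \<in> carrier (Hom C Z (Dom C k)) \<and> k \<cdot>\<^bsub>C\<^esub> u = g))"

definition is_cokernel :: "('k, 'o, 'a) lincat \<Rightarrow> 'a \<Rightarrow> 'a \<Rightarrow> bool" where
  "is_cokernel C q f \<longleftrightarrow> arrow C f \<and> arrow C q \<and> Dom C q = Cod C f \<and>
     q \<cdot>\<^bsub>C\<^esub> f = \<zero>\<^bsub>Hom C (Dom C f) (Cod C q)\<^esub> \<and>
     (\<forall>Z\<in>Ob C. \<forall>g\<in>carrier (Hom C (Cod C f) Z). g \<cdot>\<^bsub>C\<^esub> f = \<zero>\<^bsub>Hom C (Dom C f) Z\<^esub> \<longrightarrow>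
        (\<exists>!u. u \<in> carrier (Hom C (Cod C q) Z) \<and> u \<cdot>\<^bsub>C\<^esub> q = g))"

definition zero_object :: "('k, 'o, 'a) lincat \<Rightarrow> 'o \<Rightarrow> bool" where
  "zero_object C Z \<longleftrightarrow> Z \<in> Ob C \<and>
     (\<forall>X\<in>Ob C. carrier (Hom C X Z) = {\<zero>\<^bsub>Hom C X Z\<^esub>} \<and> carrier (Hom C Z X) = {\<zero>\<^bsub>Hom C Z X\<^esub>})"

definition is_biproduct ::
    "('k, 'o, 'a) lincat \<Rightarrow> nat \<Rightarrow> (nat \<Rightarrow> 'o) \<Rightarrow> 'o \<Rightarrow> (nat \<Rightarrow> 'a) \<Rightarrow> (nat \<Rightarrow> 'a) \<Rightarrow> bool" where
  "is_biproduct C n X P inc prj \<longleftrightarrow> P \<in> Ob C \<and>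
     (\<forall>i<n. X i \<in> Ob C \<and> inc i \<in> carrier (Hom C (X i) P) \<and> prj i \<in> carrier (Hom C P (X i))) \<and>
     (\<forall>i<n. \<forall>j<n. prj i \<cdot>\<^bsub>C\<^esub> inc j = (if i = j then Idn C (X i) else \<zero>\<^bsub>Hom C (X j) (X i)\<^esub>)) \<and>
     (\<Oplus>\<^bsub>Hom C P P\<^esub>i\<in>{..<n}. inc i \<cdot>\<^bsub>C\<^esub> prj i) = Idn C P"

abbreviation pair_fun :: "'b \<Rightarrow> 'b \<Rightarrow> nat \<Rightarrow> 'b" where
  "pair_fun x y \<equiv> (\<lambda>i. if i = 0 then x else y)"

locale abelian_category = linear_category +
  assumes zero_object_exists: "\<exists>Z. zero_object C Z"
    and biproduct_exists:
      "\<lbrakk>X \<in> Ob C; Y \<in> Ob C\<rbrakk> \<Longrightarrow> \<exists>P inc prj. is_biproduct C 2 (pair_fun X Y) P inc prj"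
    and kernel_exists: "arrow C f \<Longrightarrow> \<exists>k. is_kernel C k f"
    and cokernel_exists: "arrow C f \<Longrightarrow> \<exists>q. is_cokernel C q f"
    and monic_is_kernel: "monic C m \<Longrightarrow> \<exists>f. is_kernel C m f"
    and epic_is_cokernel: "epic C e \<Longrightarrow> \<exists>f. is_cokernel C e f"

record ('o, 'a, 'p, 'b) cfunctor =
  fob :: "'o \<Rightarrow> 'p"
  farr :: "'a \<Rightarrow> 'b"

definition linear_functor ::
    "('k::field, 'o, 'a) lincat \<Rightarrow> ('k, 'p, 'b) lincat \<Rightarrow> ('o, 'a, 'p, 'b) cfunctor \<Rightarrow> bool" where
  "linear_functor C D F \<longleftrightarrow>
     (\<forall>X\<in>Ob C. fob F X \<in> Ob D \<and> farr F (Idn C X) = Idn D (fob F X)) \<and>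
     (\<forall>X\<in>Ob C. \<forall>Y\<in>Ob C. farr F \<in> module_hom class_ring (Hom C X Y) (Hom D (fob F X) (fob F Y))) \<and>
     (\<forall>X\<in>Ob C. \<forall>Y\<in>Ob C. \<forall>Z\<in>Ob C. \<forall>f\<in>carrier (Hom C X Y). \<forall>g\<in>carrier (Hom C Y Z).
        farr F (g \<cdot>\<^bsub>C\<^esub> f) = farr F g \<cdot>\<^bsub>D\<^esub> farr F f)"


section \<open>Subobjects\<close>

definition factors :: "('k, 'o, 'a) lincat \<Rightarrow> 'a \<Rightarrow> 'a \<Rightarrow> bool" where
  "factors C m n \<longleftrightarrow> (\<exists>u\<in>carrier (Hom C (Dom C m) (Dom C n)). m = n \<cdot>\<^bsub>C\<^esub> u)"

definition sub_of :: "('k, 'o, 'a) lincat \<Rightarrow> 'a \<Rightarrow> 'a set" where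
  "sub_of C m = {n. monic C n \<and> Cod C n = Cod C m \<and> factors C m n \<and> factors C n m}"

text \<open>A subobject is an equivalence class of monomorphisms.\<close>

definition Sub :: "('k, 'o, 'a) lincat \<Rightarrow> 'o \<Rightarrow> 'a set gorder" where
  "Sub C X = \<lparr>carrier = {sub_of C m | m. monic C m \<and> Cod C m = X}, eq = (=),
              le = (\<lambda>S T. \<exists>m\<in>S. \<exists>n\<in>T. factors C m n)\<rparr>"

text \<open>The monic parts of all the epi-mono factorizations of \<open>f\<close>; in an abelian category these
  form a single equivalence class, the image of \<open>f\<close>.\<close>

definition im_sub :: "('k, 'o, 'a) lincat \<Rightarrow> 'a \<Rightarrow> 'a set" where
  "im_sub C f = {m. monic C m \<and> Cod C m = Cod C f \<and>
     (\<exists>e. epic C e \<and> Dom C e = Dom C f \<and> Cod C e = Dom C m \<and> f = m \<cdot>\<^bsub>C\<^esub> e)}"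

text \<open>The union over all representatives \<open>m\<close> avoids a choice: the sets \<open>im_sub C (f \<cdot> m)\<close> are
  all equal. The same device is used for direct sums and powers of subobjects below.\<close>

definition direct_im :: "('k, 'o, 'a) lincat \<Rightarrow> 'a \<Rightarrow> 'a set \<Rightarrow> 'a set" where
  "direct_im C f S = (\<Union>m\<in>S. im_sub C (f \<cdot>\<^bsub>C\<^esub> m))"

definition quot_map :: "('k, 'o, 'a) lincat \<Rightarrow> 'a set \<Rightarrow> 'a" where
  "quot_map C S = (SOME q. \<exists>m\<in>S. is_cokernel C q m)"

text \<open>For \<open>S\<close> a subobject of \<open>X\<close>, the quotient object \<open>X / S\<close>.\<close>

definition quot_ob :: "('k, 'o, 'a) lincat \<Rightarrow> 'a set \<Rightarrow> 'o" where
  "quot_ob C S = Cod C (quot_map C S)"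

text \<open>For subobjects \<open>T \<le> S\<close> of the same object, the object \<open>S / T\<close>.\<close>

definition subquot_ob :: "('k, 'o, 'a) lincat \<Rightarrow> 'a set \<Rightarrow> 'a set \<Rightarrow> 'o" where
  "subquot_ob C S T = (SOME Q. \<exists>m\<in>S. \<exists>n\<in>T. \<exists>j\<in>carrier (Hom C (Dom C n) (Dom C m)). \<exists>q.
     n = m \<cdot>\<^bsub>C\<^esub> j \<and> is_cokernel C q j \<and> Q = Cod C q)"


section \<open>Directories\<close>

definition pow_data :: "('k, 'o, 'a) lincat \<Rightarrow> 'o \<Rightarrow> nat \<Rightarrow> 'o \<times> (nat \<Rightarrow> 'a) \<times> (nat \<Rightarrow> 'a)" where
  "pow_data C X n = (SOME (P, inc, prj). is_biproduct C n (\<lambda>_. X) P inc prj)"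

definition pow_ob :: "('k, 'o, 'a) lincat \<Rightarrow> 'o \<Rightarrow> nat \<Rightarrow> 'o" where
  "pow_ob C X n = fst (pow_data C X n)"

definition pow_inj :: "('k, 'o, 'a) lincat \<Rightarrow> 'o \<Rightarrow> nat \<Rightarrow> nat \<Rightarrow> 'a" where
  "pow_inj C X n = fst (snd (pow_data C X n))"

definition pow_prj :: "('k, 'o, 'a) lincat \<Rightarrow> 'o \<Rightarrow> nat \<Rightarrow> nat \<Rightarrow> 'a" where
  "pow_prj C X n = snd (snd (pow_data C X n))"

text \<open>\<open>f\<^sup>n : X\<^sup>n \<rightarrow> Y\<^sup>n\<close> for \<open>f : X \<rightarrow> Y\<close>.\<close>

definition pow_arr :: "('k, 'o, 'a) lincat \<Rightarrow> nat \<Rightarrow> 'a \<Rightarrow> 'a" where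
  "pow_arr C n f = (\<Oplus>\<^bsub>Hom C (pow_ob C (Dom C f) n) (pow_ob C (Cod C f) n)\<^esub>i\<in>{..<n}.
     pow_inj C (Cod C f) n i \<cdot>\<^bsub>C\<^esub> f \<cdot>\<^bsub>C\<^esub> pow_prj C (Dom C f) n i)"

definition pow_sub :: "('k, 'o, 'a) lincat \<Rightarrow> nat \<Rightarrow> 'a set \<Rightarrow> 'a set" where
  "pow_sub C n S = (\<Union>m\<in>S. im_sub C (pow_arr C n m))"

definition mat_arr :: "('k::field, 'o, 'a) lincat \<Rightarrow> 'o \<Rightarrow> nat \<Rightarrow> 'k mat \<Rightarrow> 'a" where
  "mat_arr C X n M = (let H = Hom C (pow_ob C X n) (pow_ob C X n) in
     \<Oplus>\<^bsub>H\<^esub>i\<in>{..<n}. \<Oplus>\<^bsub>H\<^esub>j\<in>{..<n}.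
       M $$ (i, j) \<odot>\<^bsub>H\<^esub> (pow_inj C X n i \<cdot>\<^bsub>C\<^esub> pow_prj C X n j))"

text \<open>The inclusions \<open>X\<^sup>n \<rightarrow> X\<^sup>n\<^sup>+\<^sup>m\<close> and \<open>X\<^sup>m \<rightarrow> X\<^sup>n\<^sup>+\<^sup>m\<close> of the first \<open>n\<close> and the last \<open>m\<close> summands.\<close>

definition pow_left :: "('k, 'o, 'a) lincat \<Rightarrow> 'o \<Rightarrow> nat \<Rightarrow> nat \<Rightarrow> 'a" where
  "pow_left C X n m = (\<Oplus>\<^bsub>Hom C (pow_ob C X n) (pow_ob C X (n + m))\<^esub>i\<in>{..<n}.
     pow_inj C X (n + m) i \<cdot>\<^bsub>C\<^esub> pow_prj C X n i)"

definition pow_right :: "('k, 'o, 'a) lincat \<Rightarrow> 'o \<Rightarrow> nat \<Rightarrow> nat \<Rightarrow> 'a" where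
  "pow_right C X n m = (\<Oplus>\<^bsub>Hom C (pow_ob C X m) (pow_ob C X (n + m))\<^esub>i\<in>{..<m}.
     pow_inj C X (n + m) (n + i) \<cdot>\<^bsub>C\<^esub> pow_prj C X m i)"

text \<open>\<open>S \<oplus> T \<subseteq> X\<^sup>n \<oplus> X\<^sup>m = X\<^sup>n\<^sup>+\<^sup>m\<close>: the direct sum of representatives of \<open>S\<close> and \<open>T\<close>.\<close>

definition sub_oplus :: "('k, 'o, 'a) lincat \<Rightarrow> 'o \<Rightarrow> nat \<Rightarrow> nat \<Rightarrow> 'a set \<Rightarrow> 'a set \<Rightarrow> 'a set" where
  "sub_oplus C X n m S T =
     \<Union> {im_sub C ((pow_left C X n m \<cdot>\<^bsub>C\<^esub> s \<cdot>\<^bsub>C\<^esub> prj 0)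
            \<oplus>\<^bsub>Hom C P (pow_ob C X (n + m))\<^esub> (pow_right C X n m \<cdot>\<^bsub>C\<^esub> t \<cdot>\<^bsub>C\<^esub> prj 1)) | s t P inc prj.
         s \<in> S \<and> t \<in> T \<and> is_biproduct C 2 (pair_fun (Dom C s) (Dom C t)) P inc prj}"

text \<open>Only the sorts with index at least 1 are meaningful.\<close>

record ('k, 'e) directory =
  sort :: "nat \<Rightarrow> 'e gorder"
  oplus :: "nat \<Rightarrow> nat \<Rightarrow> 'e \<Rightarrow> 'e \<Rightarrow> 'e"
  GLact :: "nat \<Rightarrow> 'k mat \<Rightarrow> 'e \<Rightarrow> 'e"

definition Dir :: "('k::field, 'o, 'a) lincat \<Rightarrow> 'o \<Rightarrow> ('k, 'a set) directory" where
  "Dir C X = \<lparr>sort = (\<lambda>n. Sub C (pow_ob C X n)),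
              oplus = sub_oplus C X,
              GLact = (\<lambda>n M. direct_im C (mat_arr C X n M))\<rparr>"

definition dir_morphism ::
    "('k::field, 'e) directory \<Rightarrow> ('k, 'f) directory \<Rightarrow> (nat \<Rightarrow> 'e \<Rightarrow> 'f) \<Rightarrow> bool" where
  "dir_morphism D E f \<longleftrightarrow>
     (\<forall>n\<ge>1. f n \<in> carrier (sort D n) \<rightarrow> carrier (sort E n) \<and> isotone (sort D n) (sort E n) (f n) \<and>
        (\<forall>M\<in>carrier_mat n n. invertible_mat M \<longrightarrow>
           (\<forall>x\<in>carrier (sort D n). f n (GLact D n M x) = GLact E n M (f n x)))) \<and>
     (\<forall>n\<ge>1. \<forall>m\<ge>1. \<forall>x\<in>carrier (sort D n). \<forall>y\<in>carrier (sort D m).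
        f (n + m) (oplus D n m x y) = oplus E n m (f n x) (f m y))"


section \<open>Cubes and ranks\<close>

definition strict_cube :: "'e gorder \<Rightarrow> nat \<Rightarrow> (nat set \<Rightarrow> 'e) \<Rightarrow> bool" where
  "strict_cube L n c \<longleftrightarrow> c \<in> Pow {1..n} \<rightarrow> carrier L \<and> inj_on c (Pow {1..n}) \<and>
     (\<forall>S\<in>Pow {1..n}. \<forall>T\<in>Pow {1..n}.
        c (S \<union> T) = c S \<squnion>\<^bsub>L\<^esub> c T \<and> c (S \<inter> T) = c S \<sqinter>\<^bsub>L\<^esub> c T)"

definition rk0 :: "'e gorder \<Rightarrow> enat" where
  "rk0 L = Sup {enat n | n. \<exists>c. strict_cube L n c}"

definition rk_bot :: "'e gorder \<Rightarrow> enat" where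
  "rk_bot L = Sup {enat n | n. \<exists>c. strict_cube L n c \<and> c {} = \<bottom>\<^bsub>L\<^esub>}"

definition cube_bounded :: "('k, 'o, 'a) lincat \<Rightarrow> 'o \<Rightarrow> bool" where
  "cube_bounded C X \<longleftrightarrow> rk0 (Sub C X) < \<infinity>"

text \<open>Used with \<open>X = F(K)\<close>.\<close>

definition pedestal :: "('k, 'o, 'a) lincat \<Rightarrow> 'o \<Rightarrow> 'a set \<Rightarrow> bool" where
  "pedestal C X A \<longleftrightarrow> A \<in> carrier (Sub C X) \<and> rk_bot (Sub C (quot_ob C A)) = rk0 (Sub C X)"


section \<open>Flattening\<close>

definition quasi_atoms :: "'e gorder \<Rightarrow> 'e set" where
  "quasi_atoms L = {q \<in> carrier L. q \<noteq> \<bottom>\<^bsub>L\<^esub> \<and>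
     (\<forall>x\<in>carrier L. \<forall>y\<in>carrier L. x \<noteq> \<bottom>\<^bsub>L\<^esub> \<and> x \<sqsubseteq>\<^bsub>L\<^esub> q \<and> y \<noteq> \<bottom>\<^bsub>L\<^esub> \<and> y \<sqsubseteq>\<^bsub>L\<^esub> q \<longrightarrow>
        x \<sqinter>\<^bsub>L\<^esub> y \<noteq> \<bottom>\<^bsub>L\<^esub>)}"

text \<open>In a modular lattice the condition does not depend on the enumeration of the set.\<close>

definition qa_indep :: "'e gorder \<Rightarrow> 'e set \<Rightarrow> bool" where
  "qa_indep L Q \<longleftrightarrow> finite Q \<and> Q \<subseteq> quasi_atoms L \<and>
     (\<forall>qs. distinct qs \<and> set qs = Q \<longrightarrow>
        (\<forall>i. 1 \<le> i \<and> i < length qs \<longrightarrow> \<Squnion>\<^bsub>L\<^esub>(set (take i qs)) \<sqinter>\<^bsub>L\<^esub> (qs ! i) = \<bottom>\<^bsub>L\<^esub>))"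

text \<open>The closure operator of the pregeometry whose finite independent sets are given by
  \<^const>\<open>qa_indep\<close>.\<close>

definition qa_closure :: "'e gorder \<Rightarrow> 'e set \<Rightarrow> 'e set" where
  "qa_closure L S = {q \<in> quasi_atoms L. q \<in> S \<or>
     (\<exists>Q. Q \<subseteq> S \<and> qa_indep L Q \<and> \<not> qa_indep L (insert q Q))}"

definition flat_lattice :: "'e gorder \<Rightarrow> 'e set gorder" where
  "flat_lattice L = \<lparr>carrier = {S. S \<subseteq> quasi_atoms L \<and> qa_closure L S = S}, eq = (=), le = (\<subseteq>)\<rparr>"

definition flat_of :: "'e gorder \<Rightarrow> 'e \<Rightarrow> 'e set" where
  "flat_of L x = {q \<in> quasi_atoms L. q \<sqinter>\<^bsub>L\<^esub> x \<noteq> \<bottom>\<^bsub>L\<^esub>}"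

definition flattening_map :: "'e gorder \<Rightarrow> 'f gorder \<Rightarrow> ('e \<Rightarrow> 'f) \<Rightarrow> bool" where
  "flattening_map L P f \<longleftrightarrow>
     (\<exists>g. bij_betw g (carrier (flat_lattice L)) (carrier P) \<and> order_emb (flat_lattice L) P g \<and>
        (\<forall>x\<in>carrier L. f x = g (flat_of L x)))"

definition dir_flattening ::
    "('k::field, 'e) directory \<Rightarrow> ('k, 'f) directory \<Rightarrow> (nat \<Rightarrow> 'e \<Rightarrow> 'f) \<Rightarrow> bool" where
  "dir_flattening D E f \<longleftrightarrow>
     dir_morphism D E f \<and> (\<forall>n\<ge>1. flattening_map (sort D n) (sort E n) (f n))"


section \<open>Finite-dimensional vector spaces\<close>

text \<open>
  The objects are all finite-dimensional vector spaces over \<open>'k\<close> whose underlying set consists of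
  elements of the universe \<open>'k vec\<close>, with arbitrary operations; in particular the coordinate spaces
  \<open>module_vec TYPE('k) n\<close> and all their subspaces. An arrow is a triple of source, target and an
  extensional linear map. The field \<open>'k0\<close> acts through the embedding \<open>h\<close>.
\<close>

type_synonym 'k vsp = "('k, 'k vec) module"
type_synonym 'k vsp_arr = "'k vsp \<times> 'k vsp \<times> ('k vec \<Rightarrow> 'k vec)"

definition lin_arr :: "'k vsp \<Rightarrow> 'k vsp \<Rightarrow> ('k vec \<Rightarrow> 'k vec) \<Rightarrow> 'k vsp_arr" where
  "lin_arr V W f = (V, W, restrict f (carrier V))"

abbreviation fun_of :: "'k vsp_arr \<Rightarrow> 'k vec \<Rightarrow> 'k vec" where
  "fun_of f \<equiv> snd (snd f)"

definition KVect :: "('k0::field \<Rightarrow> 'k::field) \<Rightarrow> ('k0, 'k vsp, 'k vsp_arr) lincat" where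
  "KVect h = \<lparr>
     Ob = {V. vectorspace class_ring V \<and> vectorspace.fin_dim class_ring V},
     Hom = (\<lambda>V W. \<lparr>
       carrier = {lin_arr V W f | f. f \<in> module_hom class_ring V W},
       mult = undefined, one = undefined,
       zero = lin_arr V W (\<lambda>_. \<zero>\<^bsub>W\<^esub>),
       add = (\<lambda>f g. lin_arr V W (\<lambda>v. fun_of f v \<oplus>\<^bsub>W\<^esub> fun_of g v)),
       smult = (\<lambda>c f. lin_arr V W (\<lambda>v. h c \<odot>\<^bsub>W\<^esub> fun_of f v))\<rparr>),
     Dom = fst,
     Cod = fst \<circ> snd,
     Idn = (\<lambda>V. lin_arr V V (\<lambda>v. v)),
     cmp = (\<lambda>g f. lin_arr (fst f) (fst (snd g)) (fun_of g \<circ> fun_of f))\<rparr>"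

abbreviation Kn :: "nat \<Rightarrow> 'k::field vsp" where
  "Kn n \<equiv> module_vec TYPE('k) n"

text \<open>The one-dimensional space \<open>K\<close> is \<open>K\<^sup>1\<close>.\<close>

definition FK :: "('k::field vsp, 'k vsp_arr, 'o, 'a) cfunctor \<Rightarrow> 'o" where
  "FK F = fob F (Kn 1)"

definition F_scalar :: "('k::field vsp, 'k vsp_arr, 'o, 'a) cfunctor \<Rightarrow> 'k \<Rightarrow> 'a" where
  "F_scalar F x = farr F (lin_arr (Kn 1) (Kn 1) (\<lambda>v. x \<cdot>\<^sub>v v))"

text \<open>The canonical isomorphism \<open>F(K\<^sup>n) \<rightarrow> F(K)\<^sup>n\<close> whose components are \<open>F\<close> of the coordinate maps.\<close>

definition F_pow ::
    "('k0, 'o, 'a) lincat \<Rightarrow> ('k::field vsp, 'k vsp_arr, 'o, 'a) cfunctor \<Rightarrow> nat \<Rightarrow> 'a" where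
  "F_pow C F n = (\<Oplus>\<^bsub>Hom C (fob F (Kn n)) (pow_ob C (FK F) n)\<^esub>i\<in>{..<n}.
     pow_inj C (FK F) n i \<cdot>\<^bsub>C\<^esub> farr F (lin_arr (Kn n) (Kn 1) (\<lambda>v. vec 1 (\<lambda>_. v $ i))))"


section \<open>The inflator of a pedestal, its fundamental ring and ideal\<close>

text \<open>For \<open>V \<subseteq> K\<^sup>n\<close>, the subobject \<open>F(V) \<subseteq> F(K)\<^sup>n\<close>.\<close>

definition F_sub ::
    "('k0, 'o, 'a) lincat \<Rightarrow> ('k::field vsp, 'k vsp_arr, 'o, 'a) cfunctor \<Rightarrow> nat \<Rightarrow> 'k vec set \<Rightarrow> 'a set"
  where "F_sub C F n V =
    im_sub C (F_pow C F n \<cdot>\<^bsub>C\<^esub> farr F (lin_arr ((Kn n)\<lparr>carrier := V\<rparr>) (Kn n) (\<lambda>v. v)))"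

text \<open>For \<open>A \<subseteq> X\<close> and \<open>S \<subseteq> X\<^sup>n\<close>, the subobject \<open>(S + A\<^sup>n) / A\<^sup>n\<close> of \<open>(X / A)\<^sup>n\<close>.\<close>

definition quot_sub :: "('k, 'o, 'a) lincat \<Rightarrow> 'o \<Rightarrow> 'a set \<Rightarrow> nat \<Rightarrow> 'a set \<Rightarrow> 'a set" where
  "quot_sub C X A n S =
     direct_im C (pow_arr C n (quot_map C A)) (S \<squnion>\<^bsub>Sub C (pow_ob C X n)\<^esub> pow_sub C n A)"

text \<open>The composition \<open>Dir\<^sub>K(K) \<rightarrow> Dir\<^sub>C(F(K)) \<rightarrow> Dir\<^sub>C(F(K)/A) \<rightarrow> Dir\<^sub>C(F(K)/A)\<^sup>\<flat>\<close>, where \<open>\<phi>\<close> is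
  the flattening map of \<open>Dir\<^sub>C(F(K)/A)\<close>; the argument is a subspace \<open>V\<close> of \<open>K\<^sup>n\<close>.\<close>

definition pedestal_inflator ::
    "('k0, 'o, 'a) lincat \<Rightarrow> ('k::field vsp, 'k vsp_arr, 'o, 'a) cfunctor \<Rightarrow> 'a set \<Rightarrow>
     (nat \<Rightarrow> 'a set \<Rightarrow> 'e) \<Rightarrow> nat \<Rightarrow> 'k vec set \<Rightarrow> 'e"
  where "pedestal_inflator C F A \<phi> n V = \<phi> n (quot_sub C (FK F) A n (F_sub C F n V))"

definition scalar_graph :: "'k::field \<Rightarrow> 'k vec set" where
  "scalar_graph \<alpha> = {vec_of_list [x, \<alpha> * x] | x. True}"

text \<open>The graph of \<open>\<phi> : B \<rightarrow> B\<close>, as the image of \<open>(id, \<phi>) : B \<rightarrow> B\<^sup>2\<close>.\<close>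

definition endo_graph :: "('k, 'o, 'a) lincat \<Rightarrow> 'o \<Rightarrow> 'a \<Rightarrow> 'a set" where
  "endo_graph D B \<phi> = im_sub D
     (pow_inj D B 2 0 \<oplus>\<^bsub>Hom D B (pow_ob D B 2)\<^esub> (pow_inj D B 2 1 \<cdot>\<^bsub>D\<^esub> \<phi>))"

definition specializes ::
    "('k0, 'p, 'b) lincat \<Rightarrow> 'p \<Rightarrow> (nat \<Rightarrow> 'k::field vec set \<Rightarrow> 'b set) \<Rightarrow> 'k \<Rightarrow> 'b \<Rightarrow> bool" where
  "specializes D B \<sigma> \<alpha> \<phi> \<longleftrightarrow> \<sigma> 2 (scalar_graph \<alpha>) = endo_graph D B \<phi>"

definition fundamental_ring ::
    "('k0, 'p, 'b) lincat \<Rightarrow> 'p \<Rightarrow> (nat \<Rightarrow> 'k::field vec set \<Rightarrow> 'b set) \<Rightarrow> 'k set" where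
  "fundamental_ring D B \<sigma> = {\<alpha>. \<exists>\<phi>\<in>carrier (Hom D B B). specializes D B \<sigma> \<alpha> \<phi>}"

definition fundamental_ideal ::
    "('k0, 'p, 'b) lincat \<Rightarrow> 'p \<Rightarrow> (nat \<Rightarrow> 'k::field vec set \<Rightarrow> 'b set) \<Rightarrow> 'k set" where
  "fundamental_ideal D B \<sigma> = {\<alpha>. specializes D B \<sigma> \<alpha> \<zero>\<^bsub>Hom D B B\<^esub>}"

text \<open>\<open>xA\<close> and the set of all \<open>x\<close> with \<open>xA \<subseteq> A\<close>.\<close>

definition scale_sub ::
    "('k0, 'o, 'a) lincat \<Rightarrow> ('k::field vsp, 'k vsp_arr, 'o, 'a) cfunctor \<Rightarrow> 'k \<Rightarrow> 'a set \<Rightarrow> 'a set"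
  where "scale_sub C F x A = direct_im C (F_scalar F x) A"

definition stabilizer ::
    "('k0, 'o, 'a) lincat \<Rightarrow> ('k::field vsp, 'k vsp_arr, 'o, 'a) cfunctor \<Rightarrow> 'a set \<Rightarrow> 'k set"
  where "stabilizer C F A = {x. scale_sub C F x A \<sqsubseteq>\<^bsub>Sub C (FK F)\<^esub> A}"

end

theory Submission
  imports Defs
begin

text \<open>
  Let \<open>Q = F(K)/A\<close>, let \<open>G \<subseteq> Q\<^sup>2\<close> be the image of the graph of \<open>x\<close> on \<open>F(K)\<close>, and let \<open>\<phi>\<close> be the
  flattening. Always \<open>G + (0 \<oplus> Q) = Q\<^sup>2\<close>, while \<open>G \<inter> (0 \<oplus> Q) = 0 \<oplus> (x A + A)/A\<close>, so \<open>x\<close>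
  stabilizes \<open>A\<close> if and only if \<open>G\<close> and \<open>0 \<oplus> Q\<close> are complements. Flattening maps preserve
  complements, and the complements of \<open>0 \<oplus> B\<close> in \<open>B\<^sup>2\<close> are the graphs of endomorphisms of \<open>B\<close>.
  Conversely, if \<open>\<phi>(G)\<close> is a graph, then \<open>G \<inter> (0 \<oplus> Q)\<close> is flattened to \<open>0\<close>; it then contains no
  quasi-atom, hence vanishes, since a non-zero element without quasi-atoms below it would bound
  arbitrarily large cubes.

  For \<open>x\<close> in the stabilizer, \<open>\<phi>(G) = B \<oplus> 0\<close> if and only if \<open>N = G \<inter> (Q \<oplus> 0)\<close> is essential in
  \<open>Q \<oplus> 0\<close>. If \<open>x \<noteq> 0\<close> then \<open>N \<cong> A / x A\<close>. An essential \<open>N\<close> contains cubes as large as those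
  based at the bottom of \<open>Q\<close>; and if \<open>N\<close> contains a cube of the largest dimension possible in
  \<open>F(K)\<close>, it is essential, as otherwise the cube could be enlarged inside \<open>Q \<oplus> 0\<close>. The scalar \<open>0\<close>
  always specializes to \<open>0\<close>, although \<open>A / 0 A = A\<close> may have smaller rank.
\<close>

section \<open>Modular lattices\<close>

text \<open>The equality of ranks that defines a pedestal is used from both sides. As the reduced
  rank of \<open>F(K)\<close>, the number \<open>d\<close> bounds every cube below
  \<open>Q \<oplus> 0\<close> or \<open>0 \<oplus> Q\<close>, whatever its base, because such a cube
  pulls back along an arrow from \<open>F(K)\<close> onto that summand. As the rank of
  \<open>Q\<close> at the bottom, \<open>d\<close> supplies the cubes that an essential
  \<open>N\<close> must contain copies of. Since \<open>rk0\<close> of a subquotient allows any base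
  while essentiality speaks of the bottom, both kinds of cube occur. The flattening is accessible
  only through flats and its compatibility with \<open>oplus\<close>. The two summands of the square
  are therefore written with the top and bottom of sort 1, so that their values under it can be
  computed. Joins of values are taken among flats, and only for complements is such a join
  determined. A scalar \<open>x \<noteq> 0\<close> acts invertibly on \<open>F(K)\<close>; the
  inverse is what carries \<open>A / x A\<close> to \<open>N\<close>, which lives over
  \<open>F(K)/A\<close>.\<close>

locale bounded_modular_lattice = bounded_lattice L for L :: "'a gorder" (structure) +
  assumes modular:
    "\<lbrakk>x \<in> carrier L; y \<in> carrier L; z \<in> carrier L; x \<sqsubseteq> z\<rbrakk> \<Longrightarrow> x \<squnion> (y \<sqinter> z) = (x \<squnion> y) \<sqinter> z"
begin

lemma le_meet_iff:
  "\<lbrakk>x \<in> carrier L; y \<in> carrier L; z \<in> carrier L\<rbrakk> \<Longrightarrow> z \<sqsubseteq> x \<sqinter> y \<longleftrightarrow> z \<sqsubseteq> x \<and> z \<sqsubseteq> y"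
  by (meson le_trans meet_closed meet_le meet_left meet_right)

lemma join_le_iff:
  "\<lbrakk>x \<in> carrier L; y \<in> carrier L; z \<in> carrier L\<rbrakk> \<Longrightarrow> x \<squnion> y \<sqsubseteq> z \<longleftrightarrow> x \<sqsubseteq> z \<and> y \<sqsubseteq> z"
  by (meson join_closed join_le join_left join_right le_trans)

lemma le_meetI:
  "\<lbrakk>x \<in> carrier L; y \<in> carrier L; z \<in> carrier L; z \<sqsubseteq> x; z \<sqsubseteq> y\<rbrakk> \<Longrightarrow> z \<sqsubseteq> x \<sqinter> y"
  by (simp add: le_meet_iff)

lemma meet_le1: "\<lbrakk>x \<in> carrier L; y \<in> carrier L; z \<in> carrier L; x \<sqsubseteq> z\<rbrakk> \<Longrightarrow> x \<sqinter> y \<sqsubseteq> z"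
  using le_trans[OF meet_left] by simp

lemma meet_le2: "\<lbrakk>x \<in> carrier L; y \<in> carrier L; z \<in> carrier L; y \<sqsubseteq> z\<rbrakk> \<Longrightarrow> x \<sqinter> y \<sqsubseteq> z"
  using le_trans[OF meet_right] by simp

lemma le_join1: "\<lbrakk>x \<in> carrier L; y \<in> carrier L; z \<in> carrier L; z \<sqsubseteq> x\<rbrakk> \<Longrightarrow> z \<sqsubseteq> x \<squnion> y"
  using le_trans[OF _ join_left] by simp

lemma le_join2: "\<lbrakk>x \<in> carrier L; y \<in> carrier L; z \<in> carrier L; z \<sqsubseteq> y\<rbrakk> \<Longrightarrow> z \<sqsubseteq> x \<squnion> y"
  using le_trans[OF _ join_right] by simp

lemma le_bottom_iff: "x \<in> carrier L \<Longrightarrow> x \<sqsubseteq> \<bottom> \<longleftrightarrow> x = \<bottom>"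
  using le_antisym by auto

lemma meet_absorb: "\<lbrakk>x \<in> carrier L; y \<in> carrier L; x \<sqsubseteq> y\<rbrakk> \<Longrightarrow> x \<sqinter> y = x"
  by (simp add: le_antisym le_meet_iff meet_left)

lemma join_absorb: "\<lbrakk>x \<in> carrier L; y \<in> carrier L; y \<sqsubseteq> x\<rbrakk> \<Longrightarrow> x \<squnion> y = x"
  by (simp add: le_antisym join_le_iff join_left)

lemma disjoint_mono:
  "\<lbrakk>x \<in> carrier L; y \<in> carrier L; x' \<in> carrier L; y' \<in> carrier L; x' \<sqsubseteq> x; y' \<sqsubseteq> y; x \<sqinter> y = \<bottom>\<rbrakk>
    \<Longrightarrow> x' \<sqinter> y' = \<bottom>"
  using le_meetI[of x y "x' \<sqinter> y'"] by (simp add: le_bottom_iff meet_le1 meet_le2)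

text \<open>By the modular law \<open>(x \<squnion> z) \<sqinter> (x \<squnion> y)\<close> collapses
  to \<open>x\<close>, so what lies in \<open>x \<squnion> z\<close> and in \<open>y\<close> lies in
  \<open>x \<sqinter> y\<close>. This exchanges the last two members of an independent sequence,
  which is how independence survives reordering.\<close>

lemma disjoint_rotate:
  assumes "x \<in> carrier L" "y \<in> carrier L" "z \<in> carrier L" "x \<sqinter> y = \<bottom>" "(x \<squnion> y) \<sqinter> z = \<bottom>"
  shows "(x \<squnion> z) \<sqinter> y = \<bottom>"
proof -
  have "(x \<squnion> z) \<sqinter> (x \<squnion> y) = x \<squnion> (z \<sqinter> (x \<squnion> y))"
    using modular[of x z "x \<squnion> y"] assms by (simp add: join_left)
  also have "\<dots> = x"
    using assms by (simp add: meet_comm[of _ z] join_absorb)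
  finally have eq: "(x \<squnion> z) \<sqinter> (x \<squnion> y) = x" .
  have "(x \<squnion> z) \<sqinter> y \<sqsubseteq> (x \<squnion> z) \<sqinter> (x \<squnion> y)"
    using assms(1-3) by (simp add: le_meet_iff meet_left meet_le2 join_right)
  then have "(x \<squnion> z) \<sqinter> y \<sqsubseteq> x"
    by (simp only: eq)
  then have "(x \<squnion> z) \<sqinter> y \<sqsubseteq> x \<sqinter> y"
    using assms(1-3) by (simp add: le_meet_iff meet_right)
  then show ?thesis
    using assms by (simp add: le_bottom_iff)
qed

text \<open>The empty set is included: the whole carrier bounds it above, so its join is the bottom.
  Empty prefixes of a list of quasi-atoms are then covered as well.\<close>

lemma finite_Sup_least: "\<lbrakk>finite A; A \<subseteq> carrier L\<rbrakk> \<Longrightarrow> least L (\<Squnion>A) (Upper L A)"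
proof (cases "A = {}")
  case True
  have "least L (\<Squnion>{}) (Upper L {})"
    unfolding sup_def Upper_empty using bottom_least by (rule someI)
  then show ?thesis using True by simp
qed (rule finite_sup_least)

lemma finite_Sup_closed [simp]: "\<lbrakk>finite A; A \<subseteq> carrier L\<rbrakk> \<Longrightarrow> \<Squnion>A \<in> carrier L"
  using finite_Sup_least by blast

lemma finite_Sup_le_iff:
  assumes "finite A" "A \<subseteq> carrier L" "z \<in> carrier L"
  shows "\<Squnion>A \<sqsubseteq> z \<longleftrightarrow> (\<forall>a\<in>A. a \<sqsubseteq> z)"
proof
  assume "\<Squnion>A \<sqsubseteq> z"
  then show "\<forall>a\<in>A. a \<sqsubseteq> z"
    using least_Upper_above[OF finite_Sup_least[OF assms(1,2)]] assms
    by (meson finite_Sup_closed le_trans subsetD)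
next
  assume "\<forall>a\<in>A. a \<sqsubseteq> z"
  then show "\<Squnion>A \<sqsubseteq> z"
    using least_le[OF finite_Sup_least[OF assms(1,2)]] assms by (simp add: Upper_memI)
qed

lemma Sup_insert:
  assumes "finite A" "A \<subseteq> carrier L" "x \<in> carrier L"
  shows "\<Squnion>(insert x A) = x \<squnion> \<Squnion>A"
proof (rule le_antisym)
  show "\<Squnion>(insert x A) \<sqsubseteq> x \<squnion> \<Squnion>A"
    using assms finite_Sup_le_iff[of A "\<Squnion>A"]
    by (subst finite_Sup_le_iff) (auto intro: join_left le_trans[OF _ join_right])
  show "x \<squnion> \<Squnion>A \<sqsubseteq> \<Squnion>(insert x A)"
    using assms finite_Sup_le_iff[of "insert x A" "\<Squnion>(insert x A)"]
    by (subst join_le_iff) (auto simp: finite_Sup_le_iff)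
qed (use assms in auto)

lemma Sup_empty: "\<Squnion>{} = \<bottom>"
  by (metis bottom_least finite.emptyI finite_Sup_least empty_subsetI least_unique Upper_empty)

text \<open>The lattice form of an essential subobject. Flattening cannot separate \<open>a\<close>
  from \<open>b\<close> in this situation, and when cubes below \<open>b\<close> are bounded it
  separates all other nested pairs.\<close>

definition essential :: "'a \<Rightarrow> 'a \<Rightarrow> bool" where
  "essential a b \<longleftrightarrow> a \<sqsubseteq> b \<and> (\<forall>z\<in>carrier L. z \<sqsubseteq> b \<and> z \<sqinter> a = \<bottom> \<longrightarrow> z = \<bottom>)"

lemma essentialD:
  "\<lbrakk>essential a b; z \<in> carrier L; z \<sqsubseteq> b; z \<sqinter> a = \<bottom>\<rbrakk> \<Longrightarrow> z = \<bottom>"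
  by (simp add: essential_def)

lemma essential_le: "essential a b \<Longrightarrow> a \<sqsubseteq> b"
  by (simp add: essential_def)

text \<open>A test element \<open>z\<close> below \<open>a' \<squnion> b\<close> is replaced by its
  projection to \<open>a'\<close> along \<open>b\<close>, the element
  \<open>(b \<squnion> z) \<sqinter> a'\<close>, to which the essentiality of \<open>a\<close>
  applies.\<close>

lemma essential_join_right:
  assumes c: "a \<in> carrier L" "a' \<in> carrier L" "b \<in> carrier L"
    and ess: "essential a a'" and disj: "a' \<sqinter> b = \<bottom>"
  shows "essential (a \<squnion> b) (a' \<squnion> b)"
  unfolding essential_def
proof (intro conjI ballI impI)
  have aa': "a \<sqsubseteq> a'" using ess by (simp add: essential_def)
  then show "a \<squnion> b \<sqsubseteq> a' \<squnion> b"
    using c by (simp add: join_le_iff join_right) (meson join_closed join_left le_trans)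
  fix z assume z: "z \<in> carrier L" and "z \<sqsubseteq> a' \<squnion> b \<and> z \<sqinter> (a \<squnion> b) = \<bottom>"
  then have zle: "z \<sqsubseteq> a' \<squnion> b" and zd: "z \<sqinter> (a \<squnion> b) = \<bottom>" by auto
  have "(b \<squnion> z) \<sqinter> (a \<squnion> b) = b"
    using modular[of b z "a \<squnion> b"] c z zd by (simp add: join_right join_absorb)
  moreover have "((b \<squnion> z) \<sqinter> a') \<sqinter> a \<sqsubseteq> (b \<squnion> z) \<sqinter> (a \<squnion> b)"
    by (rule le_meetI) (use c z in \<open>simp_all add: meet_le1 meet_le2 meet_left join_left\<close>)
  ultimately have "((b \<squnion> z) \<sqinter> a') \<sqinter> a \<sqsubseteq> b"
    by simp
  moreover have "((b \<squnion> z) \<sqinter> a') \<sqinter> a \<sqsubseteq> a'"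
    by (rule meet_le1) (use c z in \<open>simp_all add: meet_right\<close>)
  ultimately have "((b \<squnion> z) \<sqinter> a') \<sqinter> a \<sqsubseteq> a' \<sqinter> b"
    by (subst le_meet_iff) (use c z in simp_all)
  then have "((b \<squnion> z) \<sqinter> a') \<sqinter> a = \<bottom>"
    using c z disj by (simp add: le_bottom_iff)
  then have "(b \<squnion> z) \<sqinter> a' = \<bottom>"
    by (rule essentialD[OF ess, rotated 2]) (use c z in \<open>simp_all add: meet_right\<close>)
  \<comment> \<open>An element with zero projection to \<open>a'\<close> lies in \<open>b\<close>:
    the modular law writes \<open>b \<squnion> z\<close> as \<open>b\<close> joined with that
    projection.\<close>
  then have "b \<squnion> z = b"
  proof -
    have "b \<squnion> z \<sqsubseteq> b \<squnion> a'"
      using c z zle by (simp add: join_le_iff join_left join_right join_comm[of _ b a'])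
    then have "(b \<squnion> a') \<sqinter> (b \<squnion> z) = b \<squnion> z"
      using c z by (simp add: meet_comm[of _ "b \<squnion> a'"] meet_absorb)
    then show ?thesis
      using modular[of b a' "b \<squnion> z"] c z \<open>(b \<squnion> z) \<sqinter> a' = \<bottom>\<close>
      by (simp add: join_left meet_comm[of _ a'] join_absorb)
  qed
  then have "z \<sqsubseteq> a \<squnion> b"
    using c z by (metis join_closed join_right le_trans)
  then show "z = \<bottom>"
    using c z zd by (simp add: meet_absorb)
qed

lemma essential_trans:
  assumes "a \<in> carrier L" "b \<in> carrier L" "c \<in> carrier L" "essential a b" "essential b c"
  shows "essential a c"
  unfolding essential_def
proof (intro conjI ballI impI)
  show "a \<sqsubseteq> c" using assms le_trans unfolding essential_def by blast
  fix z assume z: "z \<in> carrier L" "z \<sqsubseteq> c \<and> z \<sqinter> a = \<bottom>"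
  have "(z \<sqinter> b) \<sqinter> a = \<bottom>"
    by (rule disjoint_mono[of z a "z \<sqinter> b" a]) (use assms(1-3) z in \<open>simp_all add: meet_left\<close>)
  then have "z \<sqinter> b = \<bottom>"
    by (rule essentialD[OF assms(4), rotated 2]) (use assms(1-3) z in \<open>simp_all add: meet_right\<close>)
  then show "z = \<bottom>"
    using essentialD[OF assms(5)] z by blast
qed

text \<open>One summand is enlarged at a time; the intermediate element
  \<open>a \<squnion> b'\<close> is still a join of disjoint elements.\<close>

lemma essential_join:
  assumes c: "a \<in> carrier L" "a' \<in> carrier L" "b \<in> carrier L" "b' \<in> carrier L"
    and ess: "essential a a'" "essential b b'" and disj: "a' \<sqinter> b' = \<bottom>"
  shows "essential (a \<squnion> b) (a' \<squnion> b')"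
proof (rule essential_trans)
  have "a \<sqinter> b' = \<bottom>"
    by (rule disjoint_mono[of a' b' a b']) (use c essential_le[OF ess(1)] disj in simp_all)
  then show "essential (a \<squnion> b) (a \<squnion> b')"
    using essential_join_right[of b b' a] c ess by (simp add: meet_comm[of _ b'] join_comm[of _ _ a])
  show "essential (a \<squnion> b') (a' \<squnion> b')"
    by (rule essential_join_right) (use assms in auto)
qed (use c in auto)

section \<open>Quasi-atoms, independence and closed sets\<close>

lemma qa_closed: "q \<in> quasi_atoms L \<Longrightarrow> q \<in> carrier L"
  by (simp add: quasi_atoms_def)

lemma quasi_atom_essential:
  "\<lbrakk>q \<in> quasi_atoms L; x \<in> carrier L; q \<sqinter> x \<noteq> \<bottom>\<rbrakk> \<Longrightarrow> essential (q \<sqinter> x) q"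
  unfolding essential_def quasi_atoms_def by (auto simp: meet_left)

text \<open>Below a quasi-atom every non-zero element is essential, and essentiality passes to
  independent joins. So \<open>x\<close> contains an essential part of the join of any independent
  quasi-atoms that meet it. The list grows at its end because independence tests each entry against
  its prefix.\<close>

lemma essential_Sup_quasi_atoms:
  assumes "x \<in> carrier L"
  shows "\<lbrakk>set qs \<subseteq> quasi_atoms L; \<forall>q\<in>set qs. q \<sqinter> x \<noteq> \<bottom>;
      \<forall>i. 1 \<le> i \<and> i < length qs \<longrightarrow> \<Squnion>(set (take i qs)) \<sqinter> (qs ! i) = \<bottom>\<rbrakk>
    \<Longrightarrow> essential (\<Squnion>((\<lambda>q. q \<sqinter> x) ` set qs)) (\<Squnion>(set qs))"
proof (induction qs rule: rev_induct)
  case Nil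
  show ?case
    by (auto simp: Sup_empty essential_def meet_absorb)
next
  case (snoc p qs)
  have car: "p \<in> carrier L" "set qs \<subseteq> carrier L" "(\<lambda>q. q \<sqinter> x) ` set qs \<subseteq> carrier L"
    using snoc.prems assms qa_closed by (auto intro!: meet_closed)
  \<comment> \<open>Independence speaks only of indices from 1 on; the first entry is disjoint from
    the empty join anyway.\<close>
  have disj: "\<Squnion>(set qs) \<sqinter> p = \<bottom>"
  proof (cases "qs = []")
    case True
    then show ?thesis using car by (simp add: Sup_empty meet_absorb)
  next
    case False
    then show ?thesis
      using snoc.prems(3)[rule_format, of "length qs"] by (simp add: Suc_le_eq)
  qed
  have "essential (\<Squnion>((\<lambda>q. q \<sqinter> x) ` set qs)) (\<Squnion>(set qs))"
  proof (rule snoc.IH)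
    show "\<forall>i. 1 \<le> i \<and> i < length qs \<longrightarrow> \<Squnion>(set (take i qs)) \<sqinter> (qs ! i) = \<bottom>"
    proof (intro allI impI)
      fix i assume "1 \<le> i \<and> i < length qs"
      then show "\<Squnion>(set (take i qs)) \<sqinter> (qs ! i) = \<bottom>"
        using snoc.prems(3)[rule_format, of i] by (simp add: nth_append)
    qed
  qed (use snoc.prems in auto)
  then have "essential (\<Squnion>((\<lambda>q. q \<sqinter> x) ` set qs) \<squnion> (p \<sqinter> x)) (\<Squnion>(set qs) \<squnion> p)"
    using snoc.prems car assms disj
    by (intro essential_join quasi_atom_essential) auto
  then show ?case
    using car assms by (simp add: Sup_insert join_comm)
qed

text \<open>Let \<open>q\<close> be disjoint from \<open>x\<close> while the independent set
  \<open>Q\<close> lies in \<open>flat_of L x\<close>. Then \<open>x\<close> contains an essential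
  part of the join of \<open>Q\<close>, so \<open>q\<close> is disjoint from that join and
  \<open>insert q Q\<close> is independent. Hence \<open>q\<close> cannot enter the closure.\<close>

lemma flat_of_closed:
  assumes x: "x \<in> carrier L"
  shows "flat_of L x \<in> carrier (flat_lattice L)"
proof -
  have "q \<in> flat_of L x"
    if q: "q \<in> quasi_atoms L" and Q: "Q \<subseteq> flat_of L x" "qa_indep L Q" "\<not> qa_indep L (insert q Q)"
    for q Q
  proof (rule ccontr)
    assume nq: "q \<notin> flat_of L x"
    then have qx: "q \<sqinter> x = \<bottom>" using q by (simp add: flat_of_def)
    have finQ: "finite Q" and Qqa: "Q \<subseteq> quasi_atoms L" using Q(2) by (auto simp: qa_indep_def)
    obtain ps where ps: "set ps = Q" "distinct ps" using finQ finite_distinct_list by blast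
    have qc: "q \<in> carrier L" and Qc: "Q \<subseteq> carrier L" using q Qqa qa_closed by auto
    have "essential (\<Squnion>((\<lambda>q. q \<sqinter> x) ` Q)) (\<Squnion>Q)"
      using essential_Sup_quasi_atoms[OF x, of ps] ps Q Qqa
      by (auto simp: qa_indep_def flat_of_def)
    moreover have imc: "(\<lambda>q. q \<sqinter> x) ` Q \<subseteq> carrier L" using Qc x by (auto intro!: meet_closed)
    moreover have "\<Squnion>((\<lambda>q. q \<sqinter> x) ` Q) \<sqsubseteq> x"
      using finQ imc Qc x by (subst finite_Sup_le_iff) (auto simp: meet_right)
    then have "(\<Squnion>Q \<sqinter> q) \<sqinter> \<Squnion>((\<lambda>q. q \<sqinter> x) ` Q) = \<bottom>"
      by (rule disjoint_mono[of q x, rotated 5]) (use finQ imc Qc qc x qx in \<open>auto simp: meet_right\<close>)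
    ultimately have disj: "\<Squnion>Q \<sqinter> q = \<bottom>"
      using essentialD[of _ "\<Squnion>Q" "\<Squnion>Q \<sqinter> q"] finQ Qc qc by (simp add: meet_left)
    \<comment> \<open>\<open>qa_indep\<close> quantifies over all enumerations, so \<open>q\<close>
      may stand anywhere. Entries before it, \<open>q\<close> itself and entries after it are tested
      separately.\<close>
    have "qa_indep L (insert q Q)"
      unfolding qa_indep_def
    proof (intro conjI allI impI)
      fix qs i assume qs: "distinct qs \<and> set qs = insert q Q" and i: "1 \<le> i \<and> i < length qs"
      obtain us vs where uv: "qs = us @ q # vs"
        using qs by (metis insertI1 split_list)
      have "q \<notin> Q" using Q nq by auto
      then have uvQ: "distinct (us @ vs)" "set (us @ vs) = Q" using qs uv by auto
      \<comment> \<open>The index 0 is included because it occurs when \<open>q\<close> heads the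
        enumeration and the entry right after it is tested.\<close>
      have *: "\<Squnion>(set (take j (us @ vs))) \<sqinter> (us @ vs) ! j = \<bottom>" if "j < length (us @ vs)" for j
      proof (cases "j = 0")
        case True
        moreover have "(us @ vs) ! 0 \<in> carrier L"
          using that True uvQ Qc by (metis nth_mem subsetD)
        ultimately show ?thesis by (simp add: Sup_empty meet_absorb)
      next
        case False
        then show ?thesis using Q(2) uvQ that unfolding qa_indep_def
          by (metis Suc_leI One_nat_def not_gr_zero)
      qed
      consider "i < length us" | "i = length us" | "length us < i" by linarith
      then show "\<Squnion>(set (take i qs)) \<sqinter> qs ! i = \<bottom>"
      proof cases
        case 1
        then show ?thesis using *[of i] uv by (simp add: nth_append)
      next
        case 2
        have "\<Squnion>(set us) \<sqsubseteq> \<Squnion>Q"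
          using finite_Sup_le_iff[of Q "\<Squnion>Q"] uvQ Qc by (subst finite_Sup_le_iff) auto
        then have "\<Squnion>(set us) \<sqinter> q = \<bottom>"
          by (rule disjoint_mono[of "\<Squnion>Q" q, rotated 4]) (use uvQ Qc qc disj finQ in auto)
        then show ?thesis using 2 uv by simp
      next
        case 3
        \<comment> \<open>The index \<open>i\<close> points behind \<open>q\<close>;
          \<open>k\<close> is the position within \<open>vs\<close>, once \<open>us\<close> and
          \<open>q\<close> are skipped.\<close>
        define k where "k = i - Suc (length us)"
        have ik: "i = Suc (length us) + k" and k: "k < length vs"
          using 3 i uv by (auto simp: k_def)
        define W where "W = \<Squnion>(set (us @ take k vs))"
        have sub: "set (us @ take k vs) \<subseteq> Q" using uvQ by (auto dest: in_set_takeD)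
        have v: "vs ! k \<in> Q" using k uvQ by auto
        have Wc: "W \<in> carrier L" unfolding W_def using sub Qc by (intro finite_Sup_closed) auto
        have Wv: "W \<sqinter> vs ! k = \<bottom>"
          using *[of "length us + k"] k by (simp add: W_def)
        have "W \<sqsubseteq> \<Squnion>Q"
          using finite_Sup_le_iff[of Q "\<Squnion>Q"] finQ sub Qc
          unfolding W_def by (subst finite_Sup_le_iff) auto
        then have "W \<squnion> vs ! k \<sqsubseteq> \<Squnion>Q"
          using finite_Sup_le_iff[of Q "\<Squnion>Q"] finQ v Qc Wc by (subst join_le_iff) auto
        then have "(W \<squnion> vs ! k) \<sqinter> q = \<bottom>"
          by (rule disjoint_mono[of "\<Squnion>Q" q, rotated 4]) (use v Qc qc Wc disj finQ in auto)
        \<comment> \<open>Here the prefix contains \<open>q\<close>, so \<open>q\<close> and the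
          tested entry trade places.\<close>
        then have "(W \<squnion> q) \<sqinter> vs ! k = \<bottom>"
          using disjoint_rotate[OF Wc _ qc Wv] v Qc by blast
        moreover have "set (take i qs) = insert q (set (us @ take k vs))"
          using uv ik by (simp add: take_Cons')
        then have "\<Squnion>(set (take i qs)) = W \<squnion> q"
          using Sup_insert[of "set (us @ take k vs)" q] subset_trans[OF sub Qc] qc unfolding W_def
          by (simp only: join_comm finite_set)
        moreover have "qs ! i = vs ! k" using uv ik by (simp add: nth_append)
        ultimately show ?thesis by simp
      qed
    qed (use finQ q Qqa in auto)
    then show False using Q by blast
  qed
  then show ?thesis
    by (auto simp: flat_lattice_def qa_closure_def flat_of_def)
qed

text \<open>Both \<open>a\<close> and \<open>q\<close> are complements of \<open>h\<close> in the
  interval up to \<open>q \<squnion> h\<close>. Modularity makes the intervals below them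
  isomorphic, by \<open>(x \<squnion> h) \<sqinter> q\<close> for \<open>x\<close> below
  \<open>a\<close>, and being a quasi-atom is a property of that interval.\<close>

lemma quasi_atom_perspective:
  assumes q: "q \<in> quasi_atoms L" and c: "a \<in> carrier L" "h \<in> carrier L"
    and qh: "q \<sqinter> h = \<bottom>" and ah: "a \<sqinter> h = \<bottom>" and eq: "a \<squnion> h = q \<squnion> h"
  shows "a \<in> quasi_atoms L"
proof -
  have qc: "q \<in> carrier L" using q by (rule qa_closed)
  \<comment> \<open>Otherwise modularity gives \<open>x \<squnion> h = h\<close>, and
    \<open>x\<close> lies in \<open>a \<sqinter> h\<close>.\<close>
  have nz: "(x \<squnion> h) \<sqinter> q \<noteq> \<bottom>" if x: "x \<in> carrier L" "x \<noteq> \<bottom>" "x \<sqsubseteq> a" for x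
  proof
    assume 0: "(x \<squnion> h) \<sqinter> q = \<bottom>"
    have "x \<sqsubseteq> a \<squnion> h" using x c by (simp add: le_join1)
    then have "x \<squnion> h \<sqsubseteq> h \<squnion> q"
      using x c qc by (simp add: eq join_le_iff join_left join_comm[of _ q])
    then have "x \<squnion> h = h \<squnion> (q \<sqinter> (x \<squnion> h))"
      using modular[of h q "x \<squnion> h"] x c qc
        meet_absorb[of "x \<squnion> h" "h \<squnion> q"]
      by (simp add: join_right meet_comm)
    then have "x \<sqsubseteq> h"
      using 0 x c by (metis bottom_closed bottom_lower join_absorb join_left meet_comm)
    then show False
      using x c ah by (metis le_bottom_iff le_meet_iff)
  qed
  have "x \<sqinter> y \<noteq> \<bottom>"
    if x: "x \<in> carrier L" "x \<noteq> \<bottom>" "x \<sqsubseteq> a" and y: "y \<in> carrier L" "y \<noteq> \<bottom>" "y \<sqsubseteq> a" for x y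
  proof
    \<comment> \<open>Disjoint \<open>x\<close> and \<open>y\<close> would transfer to disjoint
      non-zero elements below \<open>q\<close>, because \<open>x \<squnion> h\<close> and
      \<open>y \<squnion> h\<close> meet only in \<open>h\<close>.\<close>
    assume xy: "x \<sqinter> y = \<bottom>"
    have "a \<sqinter> (y \<squnion> h) = y"
      using modular[of y h a] y c ah
      by (metis bottom_closed bottom_lower join_absorb meet_comm)
    moreover have "x \<sqinter> (y \<squnion> h) \<sqsubseteq> a \<sqinter> (y \<squnion> h)"
      using x y c by (simp add: le_meet_iff meet_le1 meet_right)
    ultimately have "x \<sqinter> (y \<squnion> h) \<sqsubseteq> x \<sqinter> y"
      using x y c by (simp add: le_meet_iff meet_left)
    then have "x \<sqinter> (y \<squnion> h) = \<bottom>"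
      using xy x y c by (simp add: le_bottom_iff)
    then have "(h \<squnion> x) \<sqinter> (y \<squnion> h) = h"
      using modular[of h x "y \<squnion> h"] x y c by (simp add: join_right join_absorb)
    moreover have "((x \<squnion> h) \<sqinter> q) \<sqinter> ((y \<squnion> h) \<sqinter> q) \<sqsubseteq> (h \<squnion> x) \<sqinter> (y \<squnion> h)"
      by (rule le_meetI) (use x y c qc in \<open>simp_all add: join_comm[of _ h] meet_le1 meet_le2 meet_left\<close>)
    ultimately have "((x \<squnion> h) \<sqinter> q) \<sqinter> ((y \<squnion> h) \<sqinter> q) \<sqsubseteq> q \<sqinter> h"
      using x y c qc by (simp add: le_meet_iff meet_le1 meet_right)
    then have "((x \<squnion> h) \<sqinter> q) \<sqinter> ((y \<squnion> h) \<sqinter> q) = \<bottom>"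
      using qh x y c qc by (simp add: le_bottom_iff)
    then show False
      using q nz[OF x] nz[OF y] x y c qc unfolding quasi_atoms_def by (auto simp: meet_right)
  qed
  moreover have "a \<noteq> \<bottom>"
  proof
    assume "a = \<bottom>"
    then have "q \<sqsubseteq> h"
      using eq c qc by (metis bottom_closed bottom_lower join_absorb join_comm join_left)
    then show False
      using qh q qc c unfolding quasi_atoms_def by (simp add: meet_absorb)
  qed
  ultimately show ?thesis using c unfolding quasi_atoms_def by auto
qed

text \<open>A quasi-atom \<open>q\<close> disjoint from two complements \<open>g\<close>, \<open>h\<close> lies in the closure of its
  perspective images \<open>g \<sqinter> (q \<squnion> h)\<close> and \<open>h \<sqinter> (q \<squnion> g)\<close>.\<close>

lemma flat_complement_spans:
  assumes c: "g \<in> carrier L" "h \<in> carrier L" and gh: "g \<sqinter> h = \<bottom>" "g \<squnion> h = \<top>"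
    and S: "S \<in> carrier (flat_lattice L)" "flat_of L g \<subseteq> S" "flat_of L h \<subseteq> S"
  shows "S = quasi_atoms L"
proof -
  have persp: "g \<sqinter> (q \<squnion> h) \<in> quasi_atoms L \<and> (g \<sqinter> (q \<squnion> h)) \<squnion> h = q \<squnion> h"
    if q: "q \<in> quasi_atoms L" and qh: "q \<sqinter> h = \<bottom>"
      and c: "g \<in> carrier L" "h \<in> carrier L" and gh: "g \<sqinter> h = \<bottom>" "g \<squnion> h = \<top>" for q g h
  proof -
    have qc: "q \<in> carrier L" using q by (rule qa_closed)
    have "h \<squnion> (g \<sqinter> (q \<squnion> h)) = (h \<squnion> g) \<sqinter> (q \<squnion> h)"
      using modular[of h g "q \<squnion> h"] c qc by (simp add: join_right)
    then have *: "(g \<sqinter> (q \<squnion> h)) \<squnion> h = q \<squnion> h"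
      using gh c qc meet_absorb[of "q \<squnion> h" \<top>] by (simp add: join_comm meet_comm)
    moreover have "(g \<sqinter> (q \<squnion> h)) \<sqinter> h = \<bottom>"
      by (rule disjoint_mono[of g h]) (use c qc gh in \<open>auto simp: meet_left\<close>)
    ultimately show ?thesis
      using quasi_atom_perspective[OF q _ c(2) qh] c qc by simp
  qed
  have "q \<in> S" if q: "q \<in> quasi_atoms L" for q
  proof (cases "q \<sqinter> g = \<bottom> \<and> q \<sqinter> h = \<bottom>")
    case False
    then show ?thesis using q S by (auto simp: flat_of_def)
  next
    case True
    define a where "a = g \<sqinter> (q \<squnion> h)"
    define b where "b = h \<sqinter> (q \<squnion> g)"
    have qc: "q \<in> carrier L" using q by (rule qa_closed)
    have a: "a \<in> quasi_atoms L" "a \<squnion> h = q \<squnion> h"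
      using persp[OF q _ c gh] True by (auto simp: a_def)
    have b: "b \<in> quasi_atoms L"
      using persp[OF q _ c(2,1)] gh True by (auto simp: b_def meet_comm join_comm)
    have ac: "a \<in> carrier L" and bc: "b \<in> carrier L" using a b qa_closed by auto
    have ag: "a \<sqsubseteq> g" and bh: "b \<sqsubseteq> h"
      using c qc by (auto simp: a_def b_def meet_left)
    have ab: "a \<sqinter> b = \<bottom>"
      by (rule disjoint_mono[of g h]) (use c ac bc ag bh gh in auto)
    have "a \<sqsubseteq> q \<squnion> g" using ag ac c qc by (meson join_closed join_right le_trans)
    \<comment> \<open>As \<open>a\<close> lies below \<open>q \<squnion> g\<close>, the modular law
      applies to \<open>a\<close>, \<open>h\<close> and \<open>q \<squnion> g\<close>; the element
      \<open>q\<close> lies below both factors of the result.\<close>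
    then have "a \<squnion> b = (q \<squnion> h) \<sqinter> (q \<squnion> g)"
      using modular[of a h "q \<squnion> g"] ac c qc a by (simp add: b_def)
    then have qab: "q \<sqsubseteq> a \<squnion> b"
      using qc c by (simp add: le_meet_iff join_left)
    have indep: "qa_indep L {a, b}"
      unfolding qa_indep_def
    proof (intro conjI allI impI)
      fix qs i assume qs: "distinct qs \<and> set qs = {a, b}" and i: "1 \<le> i \<and> i < length qs"
      have nab: "a \<noteq> b" using ab a ac unfolding quasi_atoms_def by (auto simp: meet_absorb)
      then have "length qs = 2" using qs by (metis card_2_iff distinct_card)
      then obtain u v where uv: "qs = [u, v]"
        by (metis (no_types, lifting) One_nat_def Suc_1 length_0_conv length_Suc_conv)
      then have "i = 1" and "{u, v} = {a, b}" using i qs by auto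
      then show "\<Squnion>(set (take i qs)) \<sqinter> qs ! i = \<bottom>"
        using uv ab ac bc nab by (auto simp: doubleton_eq_iff Sup_insert Sup_empty join_absorb meet_comm)
    qed (use a b in auto)
    have aS: "a \<in> S" "b \<in> S"
      using S a b meet_absorb[OF ac c(1) ag] meet_absorb[OF bc c(2) bh]
      by (auto simp: flat_of_def quasi_atoms_def)
    have "q \<noteq> a" using True ag ac c qc q by (auto simp: meet_absorb quasi_atoms_def)
    moreover have "q \<noteq> b" using True bh bc c qc q by (auto simp: meet_absorb quasi_atoms_def)
    ultimately have "\<not> qa_indep L (insert q {a, b})"
    proof -
      have nab: "a \<noteq> b" using ab a ac unfolding quasi_atoms_def by (auto simp: meet_absorb)
      have "\<Squnion>{a, b} = a \<squnion> b" using ac bc by (simp add: Sup_insert Sup_empty join_absorb)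
      then have "\<Squnion>{a, b} \<sqinter> q \<noteq> \<bottom>"
        using qab qc ac bc q by (simp add: meet_comm meet_absorb quasi_atoms_def)
      \<comment> \<open>The enumeration \<open>[a, b, q]\<close> fails at index 2, because
        \<open>q\<close> lies below \<open>a \<squnion> b\<close>.\<close>
      moreover have "distinct [a, b, q] \<and> set [a, b, q] = insert q {a, b}"
        using nab \<open>q \<noteq> a\<close> \<open>q \<noteq> b\<close> by auto
      then have "\<Squnion>{a, b} \<sqinter> q = \<bottom>" if "qa_indep L (insert q {a, b})"
        using that[unfolded qa_indep_def, THEN conjunct2, THEN conjunct2, rule_format, of "[a, b, q]" 2]
        by simp
      ultimately show ?thesis by blast
    qed
    then have "q \<in> qa_closure L S"
      using q indep aS by (simp add: qa_closure_def) (metis empty_subsetI insert_subset)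
    then show ?thesis using S by (simp add: flat_lattice_def)
  qed
  then show ?thesis using S by (auto simp: flat_lattice_def)
qed

subsection \<open>Cubes\<close>

lemma strict_cube_closed: "\<lbrakk>strict_cube L n c; S \<subseteq> {1..n}\<rbrakk> \<Longrightarrow> c S \<in> carrier L"
  by (auto simp: strict_cube_def)

lemma strict_cube_mono:
  assumes "strict_cube L n c" "S \<subseteq> T" "T \<subseteq> {1..n}"
  shows "c S \<sqsubseteq> c T"
proof -
  have "c S = c (S \<inter> T)" using assms(2) by (simp add: Int_absorb2)
  also have "\<dots> = c S \<sqinter> c T" using assms by (auto simp: strict_cube_def)
  finally show ?thesis
    using assms meet_right[of "c S" "c T"] strict_cube_closed[OF assms(1)] by simp
qed

lemma strict_cube_0: "x \<in> carrier L \<Longrightarrow> strict_cube L 0 (\<lambda>_. x)"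
  by (simp add: strict_cube_def join_absorb meet_absorb)

text \<open>The new direction joins \<open>y\<close> to every vertex. Since \<open>y\<close> meets
  \<open>x\<close> only in the base, cutting back with \<open>x\<close> recovers the old vertex, so
  the two faces together form a strict cube. Larger cubes are always produced in this way.\<close>

lemma strict_cube_extend:
  assumes cube: "strict_cube L n c" and xy: "x \<in> carrier L" "y \<in> carrier L"
    and below: "\<And>S. S \<subseteq> {1..n} \<Longrightarrow> c S \<sqsubseteq> x" and base: "y \<sqinter> x = c {}" "y \<noteq> c {}"
  shows "\<exists>c'. strict_cube L (Suc n) c' \<and> c' {} = c {} \<and> (\<forall>S\<subseteq>{1..Suc n}. c' S \<sqsubseteq> x \<squnion> y)"
proof -
  define r where "r S = S - {Suc n}" for S :: "nat set"
  define c' where "c' S = (if Suc n \<in> S then c (r S) \<squnion> y else c (r S))" for S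
  have r: "r S \<subseteq> {1..n}" if "S \<subseteq> {1..Suc n}" for S
    using that by (auto simp: r_def le_Suc_eq)
  have cl: "c S \<in> carrier L" if "S \<subseteq> {1..n}" for S
    using strict_cube_closed[OF cube that] .
  have cj: "c (S \<union> T) = c S \<squnion> c T" and cm: "c (S \<inter> T) = c S \<sqinter> c T"
    if "S \<subseteq> {1..n}" "T \<subseteq> {1..n}" for S T
    using cube that by (auto simp: strict_cube_def)
  have base_le: "c {} \<sqsubseteq> c S" if "S \<subseteq> {1..n}" for S
    using strict_cube_mono[OF cube _ that] by simp
  \<comment> \<open>The modular law takes \<open>c S\<close> out of the meet with \<open>x\<close>;
    what remains of \<open>y\<close> is the base, which every vertex contains.\<close>
  have cut: "x \<sqinter> (c S \<squnion> y) = c S" if S: "S \<subseteq> {1..n}" for S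
    using modular[OF cl[OF S] xy(2,1) below[OF S]] base xy cl base_le S
    by (simp add: meet_comm[of _ x] join_absorb)
  have j1: "(c S \<squnion> y) \<squnion> (c T \<squnion> y) = c (S \<union> T) \<squnion> y"
    and j2: "(c S \<squnion> y) \<squnion> c T = c (S \<union> T) \<squnion> y" "c S \<squnion> (c T \<squnion> y) = c (S \<union> T) \<squnion> y"
    if "S \<subseteq> {1..n}" "T \<subseteq> {1..n}" for S T
    using cl[OF that(1)] cl[OF that(2)] xy unfolding cj[OF that]
    by (auto intro!: le_antisym simp: join_le_iff le_join1 le_join2 join_left join_right simp del: weak_refl)
  have m2: "(c S \<squnion> y) \<sqinter> c T = c (S \<inter> T)"
    if S: "S \<subseteq> {1..n}" and T: "T \<subseteq> {1..n}" for S T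
  proof -
    have "(c S \<squnion> y) \<sqinter> c T = (x \<sqinter> (c S \<squnion> y)) \<sqinter> c T"
    proof (rule le_antisym)
      show "(c S \<squnion> y) \<sqinter> c T \<sqsubseteq> (x \<sqinter> (c S \<squnion> y)) \<sqinter> c T"
        using cl[OF S] cl[OF T] xy below[OF T] by (simp add: le_meet_iff meet_left meet_right meet_le2)
      show "(x \<sqinter> (c S \<squnion> y)) \<sqinter> c T \<sqsubseteq> (c S \<squnion> y) \<sqinter> c T"
        using cl[OF S] cl[OF T] xy by (simp add: le_meet_iff meet_le1 meet_right)
    qed (use cl S T xy in auto)
    then show ?thesis using cut[OF S] cm[OF S T] by simp
  qed
  have m1: "(c S \<squnion> y) \<sqinter> (c T \<squnion> y) = c (S \<inter> T) \<squnion> y"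
    if S: "S \<subseteq> {1..n}" and T: "T \<subseteq> {1..n}" for S T
  proof -
    have "y \<squnion> (c T \<sqinter> (c S \<squnion> y)) = (y \<squnion> c T) \<sqinter> (c S \<squnion> y)"
      using modular[of y "c T" "c S \<squnion> y"] cl[OF S] cl[OF T] xy by (simp add: join_right)
    then show ?thesis
      using m2[OF S T] by (simp add: meet_comm join_comm)
  qed
  have ny: "\<not> y \<sqsubseteq> x"
    using base xy by (metis meet_absorb)
  have "strict_cube L (Suc n) c'"
    unfolding strict_cube_def
  proof (intro conjI ballI)
    show "c' \<in> Pow {1..Suc n} \<rightarrow> carrier L"
      using r cl xy by (auto simp: c'_def)
    show "inj_on c' (Pow {1..Suc n})"
    proof (rule inj_onI)
      fix S T assume ST: "S \<in> Pow {1..Suc n}" "T \<in> Pow {1..Suc n}" and eq: "c' S = c' T"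
      have rS: "r S \<subseteq> {1..n}" and rT: "r T \<subseteq> {1..n}" using ST r by auto
      \<comment> \<open>If just one of two equal vertices used the new direction, \<open>y\<close>
        would lie below \<open>x\<close>.\<close>
      have top: "Suc n \<in> U" if "Suc n \<in> V" "c' U = c' V" "r U \<subseteq> {1..n}" "r V \<subseteq> {1..n}" for U V
      proof (rule ccontr)
        assume "Suc n \<notin> U"
        then have "c (r V) \<squnion> y \<sqsubseteq> x"
          using that below[of "r U"] by (simp add: c'_def)
        then show False using ny xy cl[OF that(4)] by (simp add: join_le_iff)
      qed
      have iff: "Suc n \<in> S \<longleftrightarrow> Suc n \<in> T"
        using top[of S T] top[of T S] eq rS rT by auto
      have "c (r S) = c (r T)"
        using eq iff cut[OF rS] cut[OF rT] unfolding c'_def by metis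
      then have "r S = r T"
        using cube rS rT by (auto simp: strict_cube_def inj_on_def)
      then show "S = T" using iff by (auto simp: r_def)
    qed
    fix S T assume ST: "S \<in> Pow {1..Suc n}" "T \<in> Pow {1..Suc n}"
    have rS: "r S \<subseteq> {1..n}" and rT: "r T \<subseteq> {1..n}" using ST r by auto
    have ru: "r (S \<union> T) = r S \<union> r T" "r (S \<inter> T) = r S \<inter> r T" by (auto simp: r_def)
    show "c' (S \<union> T) = c' S \<squnion> c' T"
      using j1[OF rS rT] j2[OF rS rT] cj[OF rS rT] by (simp add: c'_def ru)
    show "c' (S \<inter> T) = c' S \<sqinter> c' T"
      using m1[OF rS rT] m2[OF rS rT] m2[OF rT rS] cm[OF rS rT]
      by (simp add: c'_def ru meet_comm[of _ "c (r S)"] Int_commute)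
  qed
  moreover have "c' {} = c {}" by (simp add: c'_def r_def)
  moreover have "c' S \<sqsubseteq> x \<squnion> y" if "S \<subseteq> {1..Suc n}" for S
  proof -
    have "c (r S) \<sqsubseteq> x \<squnion> y"
      by (rule le_join1) (use xy cl[OF r[OF that]] below[OF r[OF that]] in simp_all)
    then show ?thesis
      using cl[OF r[OF that]] xy by (simp add: c'_def join_le_iff join_right)
  qed
  ultimately show ?thesis by blast
qed

text \<open>An element that is no quasi-atom contains two disjoint non-zero elements. One of them
  again has no quasi-atom below it and carries a cube by induction; the other adds a
  direction.\<close>

lemma cubes_below_without_quasi_atoms:
  "\<lbrakk>w \<in> carrier L; w \<noteq> \<bottom>; \<And>q. q \<in> quasi_atoms L \<Longrightarrow> \<not> q \<sqsubseteq> w\<rbrakk>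
    \<Longrightarrow> \<exists>c. strict_cube L n c \<and> c {} = \<bottom> \<and> (\<forall>S\<subseteq>{1..n}. c S \<sqsubseteq> w)"
proof (induction n arbitrary: w)
  case 0
  then show ?case
    using strict_cube_0[of \<bottom>] by (intro exI[of _ "\<lambda>_. \<bottom>"]) simp
next
  case (Suc n)
  have "w \<notin> quasi_atoms L" using Suc.prems by auto
  then obtain x y where xy: "x \<in> carrier L" "y \<in> carrier L" "x \<noteq> \<bottom>" "y \<noteq> \<bottom>" "x \<sqsubseteq> w" "y \<sqsubseteq> w"
      "x \<sqinter> y = \<bottom>"
    using Suc.prems(1,2) unfolding quasi_atoms_def by blast
  have "\<not> q \<sqsubseteq> x" if "q \<in> quasi_atoms L" for q
    using Suc.prems(3)[OF that] le_trans[OF _ xy(5)] qa_closed[OF that] xy(1) Suc.prems(1) by blast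
  then obtain c where c: "strict_cube L n c" "c {} = \<bottom>" "\<forall>S\<subseteq>{1..n}. c S \<sqsubseteq> x"
    using Suc.IH[OF xy(1,3)] by blast
  then obtain c' where c': "strict_cube L (Suc n) c'" "c' {} = \<bottom>" "\<forall>S\<subseteq>{1..Suc n}. c' S \<sqsubseteq> x \<squnion> y"
    using strict_cube_extend[OF c(1) xy(1,2)] xy by (auto simp: meet_comm)
  have "x \<squnion> y \<sqsubseteq> w" using xy Suc.prems(1) by (simp add: join_le_iff)
  then have "c' S \<sqsubseteq> w" if "S \<subseteq> {1..Suc n}" for S
    using c'(3) that strict_cube_closed[OF c'(1) that] xy Suc.prems(1) by (meson join_closed le_trans)
  then show ?case using c' by blast
qed

text \<open>The cube is rebuilt from the vertices over singletons: \<open>c {i} \<sqinter> a\<close>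
  is non-zero because \<open>a\<close> is essential, and these elements are independent because the
  \<open>c {i}\<close> are. Both facts rely on the base being \<open>\<bottom>\<close>.\<close>

lemma essential_cube:
  assumes ess: "essential a b" and ab: "a \<in> carrier L" "b \<in> carrier L"
    and cube: "strict_cube L n c" "c {} = \<bottom>" "\<And>S. S \<subseteq> {1..n} \<Longrightarrow> c S \<sqsubseteq> b"
  shows "\<exists>c'. strict_cube L n c' \<and> (\<forall>S\<subseteq>{1..n}. c' S \<sqsubseteq> a)"
proof -
  \<comment> \<open>Keeping the partial cube below \<open>c {1..m}\<close> makes it disjoint from
    the next direction \<open>c {Suc m}\<close>.\<close>
  have "\<exists>c'. strict_cube L m c' \<and> c' {} = \<bottom> \<and> (\<forall>S\<subseteq>{1..m}. c' S \<sqsubseteq> a \<sqinter> c {1..m})"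
    if "m \<le> n" for m
    using that
  proof (induction m)
    case 0
    then show ?case
      using strict_cube_0[of \<bottom>] ab cube by (intro exI[of _ "\<lambda>_. \<bottom>"]) simp
  next
    case (Suc m)
    then obtain c' where c': "strict_cube L m c'" "c' {} = \<bottom>" "\<forall>S\<subseteq>{1..m}. c' S \<sqsubseteq> a \<sqinter> c {1..m}"
      by auto
    have cl: "c {1..m} \<in> carrier L" "c {Suc m} \<in> carrier L" "c {1..Suc m} \<in> carrier L"
      using Suc.prems by (auto intro!: strict_cube_closed[OF cube(1)])
    define y where "y = c {Suc m} \<sqinter> a"
    have yc: "y \<in> carrier L" using cl ab by (simp add: y_def)
    have "c {Suc m} \<noteq> c {}"
      using cube(1) Suc.prems unfolding strict_cube_def
      by (auto dest!: inj_onD[of c _ "{Suc m}" "{}"])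
    then have y0: "y \<noteq> \<bottom>"
      using essentialD[OF ess cl(2)] cube(2,3) Suc.prems by (auto simp: y_def)
    have "c {Suc m} \<sqinter> c {1..m} = c ({Suc m} \<inter> {1..m})"
      using cube(1)[unfolded strict_cube_def, THEN conjunct2, THEN conjunct2, rule_format,
          of "{Suc m}" "{1..m}"] Suc.prems by simp
    then have "c {Suc m} \<sqinter> c {1..m} = \<bottom>" using cube(2) by simp
    then have yx: "y \<sqinter> (a \<sqinter> c {1..m}) = \<bottom>"
      by (rule disjoint_mono[rotated -1]) (use cl ab in \<open>simp_all add: y_def meet_left meet_right\<close>)
    obtain c'' where c'': "strict_cube L (Suc m) c''" "c'' {} = \<bottom>"
        "\<forall>S\<subseteq>{1..Suc m}. c'' S \<sqsubseteq> (a \<sqinter> c {1..m}) \<squnion> y"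
      using strict_cube_extend[OF c'(1), of "a \<sqinter> c {1..m}" y] c' yx y0 yc ab cl by auto
    have le: "c {1..m} \<sqsubseteq> c {1..Suc m}" "c {Suc m} \<sqsubseteq> c {1..Suc m}"
      using Suc.prems by (auto intro!: strict_cube_mono[OF cube(1)])
    have "a \<sqinter> c {1..m} \<sqsubseteq> c {1..Suc m}" "y \<sqsubseteq> c {1..Suc m}"
      unfolding y_def using meet_le2[OF ab(1) cl(1,3) le(1)] meet_le1[OF cl(2) ab(1) cl(3) le(2)]
      by auto
    then have "(a \<sqinter> c {1..m}) \<squnion> y \<sqsubseteq> a \<sqinter> c {1..Suc m}"
      using cl ab yc meet_right[OF cl(2) ab(1), folded y_def] meet_left[OF ab(1) cl(1)]
      by (simp only: join_le_iff le_meet_iff meet_closed join_closed simp_thms)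
    then have "c'' S \<sqsubseteq> a \<sqinter> c {1..Suc m}" if "S \<subseteq> {1..Suc m}" for S
      using c''(3) that strict_cube_closed[OF c''(1) that] yc ab cl
      by (meson join_closed le_trans meet_closed)
    then show ?case using c'' by blast
  qed
  from this[of n] obtain c' where c': "strict_cube L n c'" "\<forall>S\<subseteq>{1..n}. c' S \<sqsubseteq> a \<sqinter> c {1..n}"
    by auto
  have "c' S \<sqsubseteq> a" if "S \<subseteq> {1..n}" for S
    using c'(2)[rule_format, OF that] strict_cube_closed[OF c'(1) that]
      strict_cube_closed[OF cube(1) order_refl] ab by (simp only: le_meet_iff)
  then show ?thesis using c' by blast
qed

text \<open>A finite supremum of a non-empty set of naturals in \<open>enat\<close> is a maximum;
  the constant 0-cube shows that the set is non-empty.\<close>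

lemma rk0_attained:
  assumes "rk0 L = enat d"
  shows "\<exists>c. strict_cube L d c"
proof -
  define A where "A = {enat n | n. \<exists>c. strict_cube L n c}"
  have "A \<noteq> {}" using strict_cube_0[of \<bottom>] by (auto simp: A_def)
  moreover have "Sup A = enat d" using assms by (simp add: rk0_def A_def)
  ultimately have "enat d \<in> A"
    by (auto simp: Sup_enat_def split: if_splits dest: Max_in)
  then show ?thesis by (auto simp: A_def)
qed

end

section \<open>Ranks, and cubes under maps of lattices\<close>

lemma enat_le_rk0: "strict_cube L n c \<Longrightarrow> enat n \<le> rk0 L"
  unfolding rk0_def by (rule Sup_upper) blast

lemma rk0_le: "(\<And>n c. strict_cube L n c \<Longrightarrow> enat n \<le> m) \<Longrightarrow> rk0 L \<le> m"
  unfolding rk0_def by (rule Sup_least) blast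

lemma rk_bot_le: "(\<And>n c. \<lbrakk>strict_cube L n c; c {} = \<bottom>\<^bsub>L\<^esub>\<rbrakk> \<Longrightarrow> enat n \<le> m) \<Longrightarrow> rk_bot L \<le> m"
  unfolding rk_bot_def by (rule Sup_least) blast

text \<open>Joins and meets are compared only for vertices of the cube: direct images respect meets,
  and preimages respect joins, only for suitable subobjects.\<close>

lemma strict_cube_map:
  assumes "strict_cube L n c"
    and "\<And>S. S \<subseteq> {1..n} \<Longrightarrow> f (c S) \<in> carrier M"
    and "\<And>S T. \<lbrakk>S \<subseteq> {1..n}; T \<subseteq> {1..n}; f (c S) = f (c T)\<rbrakk> \<Longrightarrow> c S = c T"
    and "\<And>S T. \<lbrakk>S \<subseteq> {1..n}; T \<subseteq> {1..n}\<rbrakk> \<Longrightarrow> f (c S \<squnion>\<^bsub>L\<^esub> c T) = f (c S) \<squnion>\<^bsub>M\<^esub> f (c T)"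
    and "\<And>S T. \<lbrakk>S \<subseteq> {1..n}; T \<subseteq> {1..n}\<rbrakk> \<Longrightarrow> f (c S \<sqinter>\<^bsub>L\<^esub> c T) = f (c S) \<sqinter>\<^bsub>M\<^esub> f (c T)"
  shows "strict_cube M n (f \<circ> c)"
  using assms unfolding strict_cube_def inj_on_def by (auto simp: Pi_iff)

text \<open>The two sides have the same upper bounds, since both are tested in \<open>L\<close>
  through \<open>g\<close>.\<close>

lemma left_adjoint_join:
  assumes L: "bounded_modular_lattice L" and M: "bounded_modular_lattice M"
    and f: "f \<in> carrier L \<rightarrow> carrier M" and g: "g \<in> carrier M \<rightarrow> carrier L"
    and adj: "\<forall>x\<in>carrier L. \<forall>y\<in>carrier M. f x \<sqsubseteq>\<^bsub>M\<^esub> y \<longleftrightarrow> x \<sqsubseteq>\<^bsub>L\<^esub> g y"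
    and x: "x \<in> carrier L" "y \<in> carrier L"
  shows "f (x \<squnion>\<^bsub>L\<^esub> y) = f x \<squnion>\<^bsub>M\<^esub> f y"
proof -
  interpret L: bounded_modular_lattice L by (rule L)
  interpret M: bounded_modular_lattice M by (rule M)
  have fc: "f x \<in> carrier M" "f y \<in> carrier M" "f (x \<squnion>\<^bsub>L\<^esub> y) \<in> carrier M"
    using f x by auto
  have le: "f (x \<squnion>\<^bsub>L\<^esub> y) \<sqsubseteq>\<^bsub>M\<^esub> z \<longleftrightarrow> f x \<squnion>\<^bsub>M\<^esub> f y \<sqsubseteq>\<^bsub>M\<^esub> z" if z: "z \<in> carrier M" for z
    using adj[rule_format, OF x(1) z] adj[rule_format, OF x(2) z] adj[rule_format, OF L.join_closed[OF x] z] L.join_le_iff[OF x, of "g z"]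
      M.join_le_iff[OF fc(1,2) z] g z by auto
  show ?thesis
    by (rule M.le_antisym) (use le[of "f (x \<squnion>\<^bsub>L\<^esub> y)"] le[of "f x \<squnion>\<^bsub>M\<^esub> f y"] fc in auto)
qed

lemma right_adjoint_meet:
  assumes L: "bounded_modular_lattice L" and M: "bounded_modular_lattice M"
    and f: "f \<in> carrier L \<rightarrow> carrier M" and g: "g \<in> carrier M \<rightarrow> carrier L"
    and adj: "\<forall>x\<in>carrier L. \<forall>y\<in>carrier M. f x \<sqsubseteq>\<^bsub>M\<^esub> y \<longleftrightarrow> x \<sqsubseteq>\<^bsub>L\<^esub> g y"
    and x: "x \<in> carrier M" "y \<in> carrier M"
  shows "g (x \<sqinter>\<^bsub>M\<^esub> y) = g x \<sqinter>\<^bsub>L\<^esub> g y"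
proof -
  interpret L: bounded_modular_lattice L by (rule L)
  interpret M: bounded_modular_lattice M by (rule M)
  have gc: "g x \<in> carrier L" "g y \<in> carrier L" "g (x \<sqinter>\<^bsub>M\<^esub> y) \<in> carrier L"
    using g x by auto
  have le: "z \<sqsubseteq>\<^bsub>L\<^esub> g (x \<sqinter>\<^bsub>M\<^esub> y) \<longleftrightarrow> z \<sqsubseteq>\<^bsub>L\<^esub> g x \<sqinter>\<^bsub>L\<^esub> g y" if z: "z \<in> carrier L" for z
    using adj[rule_format, OF z x(1)] adj[rule_format, OF z x(2)] adj[rule_format, OF z M.meet_closed[OF x]] M.le_meet_iff[OF x, of "f z"]
      L.le_meet_iff[OF gc(1,2) z] f z by auto
  show ?thesis
    by (rule L.le_antisym) (use le[of "g (x \<sqinter>\<^bsub>M\<^esub> y)"] le[of "g x \<sqinter>\<^bsub>L\<^esub> g y"] gc in auto)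
qed

section \<open>Flattening maps\<close>

context bounded_modular_lattice
begin

lemma flat_of_top: "flat_of L \<top> = quasi_atoms L"
  by (auto simp: flat_of_def quasi_atoms_def meet_absorb)

lemma flat_of_bottom: "flat_of L \<bottom> = {}"
  using meet_right[of _ \<bottom>] by (auto simp: flat_of_def quasi_atoms_def le_bottom_iff)

lemma quasi_atom_below_in_flat_of:
  "\<lbrakk>q \<in> quasi_atoms L; x \<in> carrier L; q \<sqsubseteq> x\<rbrakk> \<Longrightarrow> q \<in> flat_of L x"
  using meet_absorb[of q x] by (auto simp: flat_of_def quasi_atoms_def)

text \<open>Only cubes below \<open>x\<close> have to be bounded, which is how the finite rank of
  \<open>F(K)\<close> becomes usable in the square of a quotient of \<open>F(K)\<close>.\<close>

lemma bottom_if_flat_of_empty: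
  assumes "x \<in> carrier L" "flat_of L x = {}"
    and "\<not> (\<exists>c. strict_cube L n c \<and> (\<forall>S\<subseteq>{1..n}. c S \<sqsubseteq> x))"
  shows "x = \<bottom>"
  using cubes_below_without_quasi_atoms[of x n] quasi_atom_below_in_flat_of[of _ x] assms by blast

text \<open>Let \<open>z\<close> below \<open>y\<close> be disjoint from \<open>x\<close>. A
  quasi-atom meeting \<open>z\<close> meets \<open>y\<close>, hence \<open>x\<close>, and its parts
  in \<open>z\<close> and in \<open>x\<close> would intersect. So no quasi-atom meets
  \<open>z\<close>, and the bound on cubes forces \<open>z = \<bottom>\<close>.\<close>

lemma essential_if_flat_of_subset:
  assumes c: "x \<in> carrier L" "y \<in> carrier L" "x \<sqsubseteq> y" and sub: "flat_of L y \<subseteq> flat_of L x"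
    and bound: "\<not> (\<exists>c. strict_cube L n c \<and> (\<forall>S\<subseteq>{1..n}. c S \<sqsubseteq> y))"
  shows "essential x y"
  unfolding essential_def
proof (intro conjI ballI impI)
  show "x \<sqsubseteq> y" by (rule c)
  fix z assume z: "z \<in> carrier L" and "z \<sqsubseteq> y \<and> z \<sqinter> x = \<bottom>"
  then have zy: "z \<sqsubseteq> y" and zx: "z \<sqinter> x = \<bottom>" by auto
  have "flat_of L z = {}"
  proof (rule ccontr)
    assume "flat_of L z \<noteq> {}"
    then obtain q where q: "q \<in> quasi_atoms L" "q \<sqinter> z \<noteq> \<bottom>" by (auto simp: flat_of_def)
    note qc = qa_closed[OF q(1)]
    have "q \<sqinter> z \<sqsubseteq> q \<sqinter> y"
      using qc z c zy by (simp add: le_meet_iff meet_left meet_le2)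
    then have "q \<sqinter> y \<noteq> \<bottom>"
      using q(2) qc z c le_bottom_iff[of "q \<sqinter> z"] by auto
    then have qx: "q \<sqinter> x \<noteq> \<bottom>" using q(1) sub by (auto simp: flat_of_def)
    have "(q \<sqinter> z) \<sqinter> (q \<sqinter> x) \<sqsubseteq> z \<sqinter> x"
      using qc z c by (simp only: le_meet_iff meet_closed) (simp add: meet_le1 meet_le2 meet_right)
    then have "(q \<sqinter> z) \<sqinter> (q \<sqinter> x) = \<bottom>"
      unfolding zx using le_bottom_iff qc z c by simp
    then show False
      using q qx qc z c unfolding quasi_atoms_def by (auto simp: meet_left)
  qed
  moreover have "\<not> (\<exists>c. strict_cube L n c \<and> (\<forall>S\<subseteq>{1..n}. c S \<sqsubseteq> z))"
  proof
    assume "\<exists>c. strict_cube L n c \<and> (\<forall>S\<subseteq>{1..n}. c S \<sqsubseteq> z)"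
    then obtain k where "strict_cube L n k" "\<forall>S\<subseteq>{1..n}. k S \<sqsubseteq> z" by blast
    then show False
      using bound strict_cube_closed le_trans[OF _ zy] z c by metis
  qed
  ultimately show "z = \<bottom>" by (rule bottom_if_flat_of_empty[OF z])
qed

text \<open>Inside a quasi-atom any two non-zero elements intersect, so its parts in
  \<open>x\<close> and in \<open>y\<close> have a common non-zero part.\<close>

lemma flat_of_meet:
  assumes c: "x \<in> carrier L" "y \<in> carrier L"
  shows "flat_of L (x \<sqinter> y) = flat_of L x \<inter> flat_of L y"
proof -
  have "q \<sqinter> (x \<sqinter> y) \<noteq> \<bottom> \<longleftrightarrow> q \<sqinter> x \<noteq> \<bottom> \<and> q \<sqinter> y \<noteq> \<bottom>" if q: "q \<in> quasi_atoms L" for q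
  proof -
    note qc = qa_closed[OF q]
    have eq: "(q \<sqinter> x) \<sqinter> (q \<sqinter> y) = q \<sqinter> (x \<sqinter> y)"
    proof (rule le_antisym)
      show "(q \<sqinter> x) \<sqinter> (q \<sqinter> y) \<sqsubseteq> q \<sqinter> (x \<sqinter> y)"
        using qc c by (simp only: le_meet_iff meet_closed) (simp add: meet_le1 meet_le2 meet_left meet_right)
      show "q \<sqinter> (x \<sqinter> y) \<sqsubseteq> (q \<sqinter> x) \<sqinter> (q \<sqinter> y)"
        using qc c by (simp only: le_meet_iff meet_closed) (simp add: meet_le1 meet_le2 meet_left meet_right)
    qed (use qc c in auto)
    show ?thesis
    proof
      assume nz: "q \<sqinter> (x \<sqinter> y) \<noteq> \<bottom>"
      have "q \<sqinter> x \<noteq> \<bottom>"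
      proof
        assume "q \<sqinter> x = \<bottom>"
        then have "q \<sqinter> (x \<sqinter> y) = \<bottom>"
          by (rule disjoint_mono[rotated -1]) (use qc c in \<open>simp_all add: meet_left\<close>)
        then show False using nz by simp
      qed
      moreover have "q \<sqinter> y \<noteq> \<bottom>"
      proof
        assume "q \<sqinter> y = \<bottom>"
        then have "q \<sqinter> (x \<sqinter> y) = \<bottom>"
          by (rule disjoint_mono[rotated -1]) (use qc c in \<open>simp_all add: meet_right\<close>)
        then show False using nz by simp
      qed
      ultimately show "q \<sqinter> x \<noteq> \<bottom> \<and> q \<sqinter> y \<noteq> \<bottom>" ..
    next
      assume "q \<sqinter> x \<noteq> \<bottom> \<and> q \<sqinter> y \<noteq> \<bottom>"
      then have "(q \<sqinter> x) \<sqinter> (q \<sqinter> y) \<noteq> \<bottom>"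
        using q qc c unfolding quasi_atoms_def by (auto simp: meet_left)
      then show "q \<sqinter> (x \<sqinter> y) \<noteq> \<bottom>" unfolding eq .
    qed
  qed
  then show ?thesis by (auto simp: flat_of_def)
qed

text \<open>A non-zero \<open>w\<close> below \<open>y\<close> and disjoint from \<open>x\<close>
  would add a direction to the cube without leaving \<open>y\<close>.\<close>

lemma essential_if_maximal_cube:
  assumes c: "x \<in> carrier L" "y \<in> carrier L" "x \<sqsubseteq> y"
    and cube: "strict_cube L n k" "\<And>S. S \<subseteq> {1..n} \<Longrightarrow> k S \<sqsubseteq> x"
    and max: "\<not> (\<exists>k. strict_cube L (Suc n) k \<and> (\<forall>S\<subseteq>{1..Suc n}. k S \<sqsubseteq> y))"
  shows "essential x y"
  unfolding essential_def
proof (intro conjI ballI impI)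
  show "x \<sqsubseteq> y" by (rule c)
  fix w assume w: "w \<in> carrier L" and "w \<sqsubseteq> y \<and> w \<sqinter> x = \<bottom>"
  then have wy: "w \<sqsubseteq> y" and wx: "w \<sqinter> x = \<bottom>" by auto
  show "w = \<bottom>"
  proof (rule ccontr)
    assume nz: "w \<noteq> \<bottom>"
    have k0: "k {} \<in> carrier L" "k {} \<sqsubseteq> x"
      using strict_cube_closed[OF cube(1)] cube(2) by auto
    \<comment> \<open>The base of the cube need not be \<open>\<bottom>\<close>, so \<open>w\<close>
      is raised to it; by modularity \<open>z\<close> meets \<open>x\<close> only in the
      base.\<close>
    define z where "z = k {} \<squnion> w"
    have z: "z \<in> carrier L" using k0 w by (simp add: z_def)
    have "z \<sqinter> x = k {}"
      using modular[OF k0(1) w c(1) k0(2)] wx k0 by (simp add: z_def join_absorb)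
    moreover have "z \<noteq> k {}"
    proof
      assume "z = k {}"
      then have "w \<sqsubseteq> k {}" using join_right[of "k {}" w] k0 w by (simp add: z_def)
      then have "w \<sqsubseteq> x" using k0 w c le_trans by blast
      then show False using wx nz w c by (simp add: meet_absorb)
    qed
    ultimately obtain k' where k': "strict_cube L (Suc n) k'" "\<forall>S\<subseteq>{1..Suc n}. k' S \<sqsubseteq> x \<squnion> z"
      using strict_cube_extend[OF cube(1) c(1) z cube(2)] by blast
    have "k {} \<sqsubseteq> y" using k0 c le_trans by blast
    then have le: "x \<squnion> z \<sqsubseteq> y" using c wy w k0 z by (simp add: join_le_iff z_def)
    have "k' S \<sqsubseteq> y" if "S \<subseteq> {1..Suc n}" for S
      using k'(2)[rule_format, OF that] le strict_cube_closed[OF k'(1) that] c z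
      by (meson join_closed le_trans)
    then show False using max k'(1) by blast
  qed
qed

text \<open>For a quasi-atom \<open>q\<close>, the element \<open>q \<sqinter> y\<close> lies below
  \<open>y\<close>; if it is non-zero, essentiality makes it meet \<open>x\<close>.\<close>

lemma flat_of_essential:
  assumes c: "x \<in> carrier L" "y \<in> carrier L" and ess: "essential x y"
  shows "flat_of L x = flat_of L y"
proof -
  have "q \<sqinter> x \<noteq> \<bottom> \<longleftrightarrow> q \<sqinter> y \<noteq> \<bottom>" if q: "q \<in> quasi_atoms L" for q
  proof
    note qc = qa_closed[OF q]
    assume "q \<sqinter> x \<noteq> \<bottom>"
    moreover have "q \<sqinter> x \<sqsubseteq> q \<sqinter> y"
      using qc c essential_le[OF ess] by (simp add: le_meet_iff meet_left meet_le2)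
    ultimately show "q \<sqinter> y \<noteq> \<bottom>"
      using le_bottom_iff qc c by (metis meet_closed)
  next
    note qc = qa_closed[OF q]
    assume qy: "q \<sqinter> y \<noteq> \<bottom>"
    show "q \<sqinter> x \<noteq> \<bottom>"
    proof
      assume "q \<sqinter> x = \<bottom>"
      then have "(q \<sqinter> y) \<sqinter> x = \<bottom>"
        by (rule disjoint_mono[rotated -1]) (use qc c in \<open>simp_all add: meet_left\<close>)
      then show False using essentialD[OF ess] qy qc c meet_right by simp
    qed
  qed
  then show ?thesis by (auto simp: flat_of_def)
qed

end

locale flattening =
  L: bounded_modular_lattice L + M: bounded_modular_lattice M
  for L :: "'e gorder" and M :: "'f gorder" and f +
  assumes flattening: "flattening_map L M f"
begin

lemma map_closed: "x \<in> carrier L \<Longrightarrow> f x \<in> carrier M"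
  using flattening L.flat_of_closed by (auto simp: flattening_map_def dest: bij_betwE)

lemma map_le_iff: "\<lbrakk>x \<in> carrier L; y \<in> carrier L\<rbrakk> \<Longrightarrow> f x \<sqsubseteq>\<^bsub>M\<^esub> f y \<longleftrightarrow> flat_of L x \<subseteq> flat_of L y"
  using flattening L.flat_of_closed
  by (auto simp: flattening_map_def order_emb_def) (auto simp: flat_lattice_def)

text \<open>Comparing an arbitrary \<open>U\<close> with values of \<open>f\<close> becomes
  inclusion of flats. Meets and joins formed in \<open>M\<close> are handled in this way, without
  presenting them as values of \<open>f\<close>.\<close>

lemma element_as_flat:
  assumes "U \<in> carrier M"
  obtains S where "S \<in> carrier (flat_lattice L)"
    "\<And>x. x \<in> carrier L \<Longrightarrow> f x \<sqsubseteq>\<^bsub>M\<^esub> U \<longleftrightarrow> flat_of L x \<subseteq> S"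
    "\<And>x. x \<in> carrier L \<Longrightarrow> U \<sqsubseteq>\<^bsub>M\<^esub> f x \<longleftrightarrow> S \<subseteq> flat_of L x"
proof -
  obtain g where bij: "bij_betw g (carrier (flat_lattice L)) (carrier M)"
    and emb: "order_emb (flat_lattice L) M g" and map: "\<forall>x\<in>carrier L. f x = g (flat_of L x)"
    using flattening by (auto simp: flattening_map_def)
  have iff: "g S \<sqsubseteq>\<^bsub>M\<^esub> g T \<longleftrightarrow> S \<subseteq> T"
    if "S \<in> carrier (flat_lattice L)" "T \<in> carrier (flat_lattice L)" for S T
    using emb that by (simp add: order_emb_def flat_lattice_def)
  obtain S where S: "S \<in> carrier (flat_lattice L)" "g S = U"
    using bij assms by (metis bij_betw_imp_surj_on imageE)
  then show thesis
    using that[OF S(1)] iff[OF S(1) L.flat_of_closed] iff[OF L.flat_of_closed S(1)] map by simp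
qed

lemma map_eq_iff: "\<lbrakk>x \<in> carrier L; y \<in> carrier L\<rbrakk> \<Longrightarrow> f x = f y \<longleftrightarrow> flat_of L x = flat_of L y"
  using map_le_iff[of x y] map_le_iff[of y x] map_le_iff[of x x] map_closed[of x] map_closed[of y]
    M.le_antisym[of "f x" "f y"] by (metis order_refl subset_antisym)

lemma map_mono: "\<lbrakk>x \<in> carrier L; y \<in> carrier L; x \<sqsubseteq>\<^bsub>L\<^esub> y\<rbrakk> \<Longrightarrow> f x \<sqsubseteq>\<^bsub>M\<^esub> f y"
  using map_le_iff L.flat_of_meet[of x y] L.meet_absorb[of x y] by auto

lemma map_top: "f \<top>\<^bsub>L\<^esub> = \<top>\<^bsub>M\<^esub>"
proof -
  obtain S where "S \<in> carrier (flat_lattice L)" "\<top>\<^bsub>M\<^esub> \<sqsubseteq>\<^bsub>M\<^esub> f \<top>\<^bsub>L\<^esub> \<longleftrightarrow> S \<subseteq> flat_of L \<top>\<^bsub>L\<^esub>"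
    using element_as_flat[OF M.top_closed] L.top_closed by metis
  then have "\<top>\<^bsub>M\<^esub> \<sqsubseteq>\<^bsub>M\<^esub> f \<top>\<^bsub>L\<^esub>"
    by (simp add: L.flat_of_top flat_lattice_def)
  then show ?thesis
    using map_closed[OF L.top_closed] M.le_antisym by (metis M.top_closed M.top_higher)
qed

lemma map_bottom: "f \<bottom>\<^bsub>L\<^esub> = \<bottom>\<^bsub>M\<^esub>"
proof -
  obtain S where "f \<bottom>\<^bsub>L\<^esub> \<sqsubseteq>\<^bsub>M\<^esub> \<bottom>\<^bsub>M\<^esub> \<longleftrightarrow> flat_of L \<bottom>\<^bsub>L\<^esub> \<subseteq> S"
    using element_as_flat[OF M.bottom_closed] L.bottom_closed by metis
  then show ?thesis
    using map_closed[OF L.bottom_closed] M.le_bottom_iff by (simp add: L.flat_of_bottom)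
qed

text \<open>A flat contained in the flats of \<open>x\<close> and \<open>y\<close> lies in that of
  \<open>x \<sqinter> y = \<bottom>\<close>. A flat containing both consists of all quasi-atoms, by
  \<open>flat_complement_spans\<close>.\<close>

lemma map_complement:
  assumes c: "x \<in> carrier L" "y \<in> carrier L" and xy: "x \<sqinter>\<^bsub>L\<^esub> y = \<bottom>\<^bsub>L\<^esub>" "x \<squnion>\<^bsub>L\<^esub> y = \<top>\<^bsub>L\<^esub>"
  shows "f x \<sqinter>\<^bsub>M\<^esub> f y = \<bottom>\<^bsub>M\<^esub>" "f x \<squnion>\<^bsub>M\<^esub> f y = \<top>\<^bsub>M\<^esub>"
proof -
  note fc = map_closed[OF c(1)] map_closed[OF c(2)]
  obtain S where S: "\<And>z. z \<in> carrier L \<Longrightarrow> f x \<sqinter>\<^bsub>M\<^esub> f y \<sqsubseteq>\<^bsub>M\<^esub> f z \<longleftrightarrow> S \<subseteq> flat_of L z"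
    using element_as_flat[OF M.meet_closed[OF fc]] by metis
  have "S \<subseteq> flat_of L (x \<sqinter>\<^bsub>L\<^esub> y)"
    using S[OF c(1)] S[OF c(2)] M.meet_left[OF fc] M.meet_right[OF fc] by (simp add: L.flat_of_meet[OF c])
  then have "f x \<sqinter>\<^bsub>M\<^esub> f y \<sqsubseteq>\<^bsub>M\<^esub> f \<bottom>\<^bsub>L\<^esub>"
    using S[OF L.bottom_closed] xy by simp
  then show "f x \<sqinter>\<^bsub>M\<^esub> f y = \<bottom>\<^bsub>M\<^esub>"
    using map_bottom M.le_bottom_iff[OF M.meet_closed[OF fc]] by simp
  obtain T where T: "T \<in> carrier (flat_lattice L)"
      "\<And>z. z \<in> carrier L \<Longrightarrow> f z \<sqsubseteq>\<^bsub>M\<^esub> f x \<squnion>\<^bsub>M\<^esub> f y \<longleftrightarrow> flat_of L z \<subseteq> T"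
    using element_as_flat[OF M.join_closed[OF fc]] by metis
  have "flat_of L x \<subseteq> T" "flat_of L y \<subseteq> T"
    using T(2)[OF c(1)] T(2)[OF c(2)] M.join_left[OF fc] M.join_right[OF fc] by simp_all
  then have "\<top>\<^bsub>M\<^esub> \<sqsubseteq>\<^bsub>M\<^esub> f x \<squnion>\<^bsub>M\<^esub> f y"
    using L.flat_complement_spans[OF c xy T(1)] T(2)[OF L.top_closed] map_top by (simp add: L.flat_of_top)
  then show "f x \<squnion>\<^bsub>M\<^esub> f y = \<top>\<^bsub>M\<^esub>"
    using fc by (metis M.join_closed M.le_antisym M.top_closed M.top_higher)
qed

end

section \<open>Arrows of a linear category\<close>

context linear_category
begin

text \<open>The hom-set is read off from the first summand, so that sums can be rewritten without
  mentioning objects.\<close>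

definition hadd :: "'a \<Rightarrow> 'a \<Rightarrow> 'a" (infixl \<open>\<boxplus>\<close> 65) where
  "f \<boxplus> g = f \<oplus>\<^bsub>Hom C (Dom C f) (Cod C f)\<^esub> g"

definition hneg :: "'a \<Rightarrow> 'a" where
  "hneg f = \<ominus>\<^bsub>Hom C (Dom C f) (Cod C f)\<^esub> f"

abbreviation hzero :: "'o \<Rightarrow> 'o \<Rightarrow> 'a" where
  "hzero X Y \<equiv> \<zero>\<^bsub>Hom C X Y\<^esub>"

lemma Hom_abelian_group: "\<lbrakk>X \<in> Ob C; Y \<in> Ob C\<rbrakk> \<Longrightarrow> abelian_group (Hom C X Y)"
proof -
  assume "X \<in> Ob C" "Y \<in> Ob C"
  then interpret vectorspace class_ring "Hom C X Y" by (rule Hom_vectorspace)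
  show ?thesis by unfold_locales
qed

lemma Hom_abelian_monoid: "\<lbrakk>X \<in> Ob C; Y \<in> Ob C\<rbrakk> \<Longrightarrow> abelian_monoid (Hom C X Y)"
  by (rule abelian_group.axioms(1)) (rule Hom_abelian_group)

lemma arrow_Ob [simp]: "arrow C f \<Longrightarrow> Dom C f \<in> Ob C" "arrow C f \<Longrightarrow> Cod C f \<in> Ob C"
  by (auto simp: arrow_def)

text \<open>Membership in a hom-set turns into equations for \<open>Dom\<close> and
  \<open>Cod\<close>, so composability is a side condition that rewriting discharges.\<close>

lemma hom_iff:
  "\<lbrakk>X \<in> Ob C; Y \<in> Ob C\<rbrakk> \<Longrightarrow> f \<in> carrier (Hom C X Y) \<longleftrightarrow> arrow C f \<and> Dom C f = X \<and> Cod C f = Y"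
  unfolding arrow_def using Hom_Dom_Cod[of X Y f] by metis

lemma arrow_hom: "arrow C f \<Longrightarrow> f \<in> carrier (Hom C (Dom C f) (Cod C f))"
  unfolding arrow_def by blast

lemma cmp_arrow [simp]:
  assumes "arrow C f" "arrow C g" "Cod C f = Dom C g"
  shows "arrow C (g \<cdot> f)" "Dom C (g \<cdot> f) = Dom C f" "Cod C (g \<cdot> f) = Cod C g"
proof -
  have "(\<lambda>f. g \<cdot> f) \<in> module_hom class_ring (Hom C (Dom C f) (Dom C g)) (Hom C (Dom C f) (Cod C g))"
    using assms by (intro cmp_linear_right) (auto simp: hom_iff)
  then have "g \<cdot> f \<in> carrier (Hom C (Dom C f) (Cod C g))"
    using module_hom_closed arrow_hom assms by (metis Pi_mem)
  then show "arrow C (g \<cdot> f)" "Dom C (g \<cdot> f) = Dom C f" "Cod C (g \<cdot> f) = Cod C g"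
    using assms by (auto simp: hom_iff)
qed

lemma Idn_arrow [simp]:
  assumes "X \<in> Ob C"
  shows "arrow C (Idn C X)" "Dom C (Idn C X) = X" "Cod C (Idn C X) = X"
  using Idn_closed[OF assms] assms by (auto simp: hom_iff)

lemma cmp_Idn_right [simp]: "\<lbrakk>arrow C f; X = Dom C f\<rbrakk> \<Longrightarrow> f \<cdot> Idn C X = f"
  and cmp_Idn_left [simp]: "\<lbrakk>arrow C f; Y = Cod C f\<rbrakk> \<Longrightarrow> Idn C Y \<cdot> f = f"
  using cmp_Idn[of "Dom C f" "Cod C f" f] by (auto simp: arrow_hom)

lemma cmp_assoc' [simp]:
  "\<lbrakk>arrow C f; arrow C g; arrow C h; Cod C f = Dom C g; Cod C g = Dom C h\<rbrakk>
    \<Longrightarrow> (h \<cdot> g) \<cdot> f = h \<cdot> g \<cdot> f"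
  using cmp_assoc[of "Dom C f" "Dom C g" "Dom C h" "Cod C h" f g h] by (auto simp: hom_iff)

text \<open>Composition is kept associated to the right, which hides \<open>g \<cdot> f\<close>
  inside \<open>g \<cdot> f \<cdot> x\<close>; this rule applies an equation for
  \<open>g \<cdot> f\<close> there.\<close>

lemma cmp_eq_cmp:
  "\<lbrakk>g \<cdot> f = k; arrow C x; arrow C f; arrow C g; Cod C x = Dom C f; Cod C f = Dom C g\<rbrakk>
    \<Longrightarrow> g \<cdot> f \<cdot> x = k \<cdot> x"
  using cmp_assoc'[of x f g] by simp

lemma hadd_arrow [simp]:
  assumes "arrow C f" "arrow C g" "Dom C g = Dom C f" "Cod C g = Cod C f"
  shows "arrow C (f \<boxplus> g)" "Dom C (f \<boxplus> g) = Dom C f" "Cod C (f \<boxplus> g) = Cod C f"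
proof -
  interpret abelian_group "Hom C (Dom C f) (Cod C f)"
    using assms by (simp add: Hom_abelian_group)
  have "f \<boxplus> g \<in> carrier (Hom C (Dom C f) (Cod C f))"
    unfolding hadd_def using assms by (intro a_closed) (auto simp: hom_iff)
  then show "arrow C (f \<boxplus> g)" "Dom C (f \<boxplus> g) = Dom C f" "Cod C (f \<boxplus> g) = Cod C f"
    using assms by (auto simp: hom_iff)
qed

lemma hzero_arrow [simp]:
  assumes "X \<in> Ob C" "Y \<in> Ob C"
  shows "arrow C (hzero X Y)" "Dom C (hzero X Y) = X" "Cod C (hzero X Y) = Y"
proof -
  interpret abelian_group "Hom C X Y"
    using assms by (simp add: Hom_abelian_group)
  show "arrow C (hzero X Y)" "Dom C (hzero X Y) = X" "Cod C (hzero X Y) = Y"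
    using zero_closed unfolding hom_iff[OF assms] by auto
qed

lemma hneg_arrow [simp]:
  assumes "arrow C f"
  shows "arrow C (hneg f)" "Dom C (hneg f) = Dom C f" "Cod C (hneg f) = Cod C f"
proof -
  interpret abelian_group "Hom C (Dom C f) (Cod C f)"
    using assms by (simp add: Hom_abelian_group)
  have "hneg f \<in> carrier (Hom C (Dom C f) (Cod C f))"
    unfolding hneg_def using assms by (intro a_inv_closed) (auto simp: hom_iff)
  then show "arrow C (hneg f)" "Dom C (hneg f) = Dom C f" "Cod C (hneg f) = Cod C f"
    using assms by (auto simp: hom_iff)
qed

lemma hadd_commute:
  "\<lbrakk>arrow C f; arrow C g; Dom C g = Dom C f; Cod C g = Cod C f\<rbrakk> \<Longrightarrow> f \<boxplus> g = g \<boxplus> f"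
  unfolding hadd_def
  using abelian_monoid.a_comm[OF Hom_abelian_monoid, of "Dom C f" "Cod C f" f g] by (auto simp: hom_iff)

lemma hadd_assoc:
  "\<lbrakk>arrow C f; arrow C g; arrow C h; Dom C g = Dom C f; Cod C g = Cod C f; Dom C h = Dom C f;
    Cod C h = Cod C f\<rbrakk> \<Longrightarrow> (f \<boxplus> g) \<boxplus> h = f \<boxplus> (g \<boxplus> h)"
  using abelian_monoid.a_assoc[OF Hom_abelian_monoid, of "Dom C f" "Cod C f" f g h] hadd_arrow[of f g]
  by (auto simp: hom_iff hadd_def)

lemma hadd_zero_right [simp]:
  "\<lbrakk>arrow C f; X = Dom C f; Y = Cod C f\<rbrakk> \<Longrightarrow> f \<boxplus> hzero X Y = f"
  using abelian_monoid.r_zero[OF Hom_abelian_monoid, of "Dom C f" "Cod C f" f]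
  by (auto simp: hom_iff hadd_def)

lemma hadd_zero_left [simp]:
  "\<lbrakk>arrow C f; X = Dom C f; Y = Cod C f\<rbrakk> \<Longrightarrow> hzero X Y \<boxplus> f = f"
  by (metis arrow_Ob hadd_commute hadd_zero_right hzero_arrow)

lemma hadd_neg_right [simp]: "arrow C f \<Longrightarrow> f \<boxplus> hneg f = hzero (Dom C f) (Cod C f)"
  using abelian_group.r_neg[OF Hom_abelian_group, of "Dom C f" "Cod C f" f]
  by (auto simp: hom_iff hadd_def hneg_def)

lemma hadd_neg_left [simp]: "arrow C f \<Longrightarrow> hneg f \<boxplus> f = hzero (Dom C f) (Cod C f)"
  by (metis hadd_commute hadd_neg_right hneg_arrow)

lemma cmp_hadd_right:
  assumes "arrow C f" "arrow C g" "arrow C h" "Dom C g = Dom C f" "Cod C g = Cod C f" "Cod C f = Dom C h"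
  shows "h \<cdot> (f \<boxplus> g) = h \<cdot> f \<boxplus> h \<cdot> g"
  using module_hom_add[OF cmp_linear_right[of "Dom C f" "Dom C h" "Cod C h" h], of f g] assms
  by (simp add: hom_iff hadd_def)

lemma cmp_hadd_left:
  assumes "arrow C f" "arrow C g" "arrow C h" "Dom C g = Dom C f" "Cod C g = Cod C f" "Cod C h = Dom C f"
  shows "(f \<boxplus> g) \<cdot> h = f \<cdot> h \<boxplus> g \<cdot> h"
  using module_hom_add[OF cmp_linear_left[of "Dom C h" "Dom C f" "Cod C f" h], of f g] assms
  by (simp add: hom_iff hadd_def)

lemmas cmp_hadd = cmp_hadd_left cmp_hadd_right

lemma hadd_cancel:
  assumes "arrow C f" "arrow C g" "Dom C g = Dom C f" "Cod C g = Cod C f" "f \<boxplus> g = f"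
  shows "g = hzero (Dom C f) (Cod C f)"
proof -
  have "(hneg f \<boxplus> f) \<boxplus> g = hneg f \<boxplus> (f \<boxplus> g)" using assms by (intro hadd_assoc) auto
  then show ?thesis using assms by simp
qed

text \<open>By additivity the composite is its own double, hence zero by cancellation.\<close>

lemma cmp_zero_right [simp]:
  assumes "arrow C h" "X \<in> Ob C" "Y = Dom C h"
  shows "h \<cdot> hzero X Y = hzero X (Cod C h)"
proof -
  have "h \<cdot> (hzero X Y \<boxplus> hzero X Y) = h \<cdot> hzero X Y \<boxplus> h \<cdot> hzero X Y"
    using assms by (intro cmp_hadd_right) simp_all
  moreover have "hzero X Y \<boxplus> hzero X Y = hzero X Y" using assms by simp
  ultimately show ?thesis
    using hadd_cancel[of "h \<cdot> hzero X Y" "h \<cdot> hzero X Y"] assms by simp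
qed

lemma cmp_zero_left [simp]:
  assumes "arrow C h" "Z \<in> Ob C" "Y = Cod C h"
  shows "hzero Y Z \<cdot> h = hzero (Dom C h) Z"
proof -
  have "(hzero Y Z \<boxplus> hzero Y Z) \<cdot> h = hzero Y Z \<cdot> h \<boxplus> hzero Y Z \<cdot> h"
    using assms by (intro cmp_hadd_left) simp_all
  moreover have "hzero Y Z \<boxplus> hzero Y Z = hzero Y Z" using assms by simp
  ultimately show ?thesis
    using hadd_cancel[of "hzero Y Z \<cdot> h" "hzero Y Z \<cdot> h"] assms by simp
qed

lemma hadd_eq_zero_iff:
  assumes "arrow C f" "arrow C g" "Dom C g = Dom C f" "Cod C g = Cod C f"
  shows "f \<boxplus> hneg g = hzero (Dom C f) (Cod C f) \<longleftrightarrow> f = g"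
proof
  assume 0: "f \<boxplus> hneg g = hzero (Dom C f) (Cod C f)"
  have "(f \<boxplus> hneg g) \<boxplus> g = f \<boxplus> (hneg g \<boxplus> g)" using assms by (intro hadd_assoc) auto
  then show "f = g" using 0 assms by simp
qed (use assms in simp)

lemma hneg_unique:
  assumes "arrow C f" "arrow C g" "Dom C g = Dom C f" "Cod C g = Cod C f"
    "f \<boxplus> g = hzero (Dom C f) (Cod C f)"
  shows "g = hneg f"
proof -
  have "(hneg f \<boxplus> f) \<boxplus> g = hneg f \<boxplus> (f \<boxplus> g)" using assms by (intro hadd_assoc) auto
  then show ?thesis using assms by simp
qed

lemma hneg_zero [simp]: "\<lbrakk>X \<in> Ob C; Y \<in> Ob C\<rbrakk> \<Longrightarrow> hneg (hzero X Y) = hzero X Y"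
  by (metis hadd_neg_right hadd_zero_left hneg_arrow hzero_arrow)

lemma cmp_hneg_right:
  "\<lbrakk>arrow C f; arrow C h; Cod C f = Dom C h\<rbrakk> \<Longrightarrow> h \<cdot> hneg f = hneg (h \<cdot> f)"
  using cmp_hadd_right[of f "hneg f" h] by (intro hneg_unique) auto

lemma cmp_hneg_left:
  "\<lbrakk>arrow C f; arrow C h; Cod C h = Dom C f\<rbrakk> \<Longrightarrow> hneg f \<cdot> h = hneg (f \<cdot> h)"
  using cmp_hadd_left[of f "hneg f" h] by (intro hneg_unique) auto

lemmas cmp_hneg = cmp_hneg_left cmp_hneg_right

lemma finsum_1:
  fixes f :: "nat \<Rightarrow> 'a"
  assumes "X \<in> Ob C" "Y \<in> Ob C" "f 0 \<in> carrier (Hom C X Y)"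
  shows "finsum (Hom C X Y) f {..<1} = f 0"
proof -
  interpret abelian_monoid "Hom C X Y" using assms by (simp add: Hom_abelian_monoid)
  show ?thesis
    using finsum_insert[of "{}" "0 :: nat" f] assms(3) by (simp add: lessThan_Suc)
qed

lemma finsum_2:
  fixes f :: "nat \<Rightarrow> 'a"
  assumes "X \<in> Ob C" "Y \<in> Ob C" "f 0 \<in> carrier (Hom C X Y)" "f 1 \<in> carrier (Hom C X Y)"
  shows "finsum (Hom C X Y) f {..<2} = f 0 \<boxplus> f 1"
proof -
  interpret abelian_monoid "Hom C X Y" using assms by (simp add: Hom_abelian_monoid)
  have "{..<2} = {0, 1 :: nat}" by auto
  then have "finsum (Hom C X Y) f {..<2} = f 0 \<oplus>\<^bsub>Hom C X Y\<^esub> f 1"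
    using finsum_insert[of "{1}" 0 f] finsum_insert[of "{}" 1 f] assms(3,4) by simp
  then show ?thesis
    using assms by (simp add: hadd_def hom_iff)
qed

subsection \<open>Monomorphisms, epimorphisms, kernels\<close>

lemma monic_arrow [simp]: "monic C m \<Longrightarrow> arrow C m"
  and epic_arrow [simp]: "epic C m \<Longrightarrow> arrow C m"
  by (auto simp: monic_def epic_def)

lemma monicD:
  "\<lbrakk>monic C m; arrow C g; arrow C h; Cod C g = Dom C m; Cod C h = Dom C m; Dom C h = Dom C g;
    m \<cdot> g = m \<cdot> h\<rbrakk> \<Longrightarrow> g = h"
  unfolding monic_def by (metis arrow_Ob(1) arrow_hom)

lemma epicD:
  "\<lbrakk>epic C e; arrow C g; arrow C h; Dom C g = Cod C e; Dom C h = Cod C e; Cod C h = Cod C g;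
    g \<cdot> e = h \<cdot> e\<rbrakk> \<Longrightarrow> g = h"
  unfolding epic_def by (metis arrow_Ob(2) arrow_hom)

lemma monic_zero:
  "\<lbrakk>monic C m; arrow C g; Cod C g = Dom C m; m \<cdot> g = hzero (Dom C g) (Cod C m)\<rbrakk>
    \<Longrightarrow> g = hzero (Dom C g) (Dom C m)"
  by (rule monicD[of m]) auto

lemma epic_zero:
  "\<lbrakk>epic C e; arrow C g; Dom C g = Cod C e; g \<cdot> e = hzero (Dom C e) (Cod C g)\<rbrakk>
    \<Longrightarrow> g = hzero (Cod C e) (Cod C g)"
  by (rule epicD[of e]) auto

lemma monicI:
  assumes "arrow C m"
    and "\<And>g. \<lbrakk>arrow C g; Cod C g = Dom C m; m \<cdot> g = hzero (Dom C g) (Cod C m)\<rbrakk>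
      \<Longrightarrow> g = hzero (Dom C g) (Dom C m)"
  shows "monic C m"
  unfolding monic_def
proof (intro conjI ballI impI)
  fix X g h assume "X \<in> Ob C" "g \<in> carrier (Hom C X (Dom C m))" "h \<in> carrier (Hom C X (Dom C m))"
    and eq: "m \<cdot> g = m \<cdot> h"
  then have gh: "arrow C g" "arrow C h" "Cod C g = Dom C m" "Cod C h = Dom C m" "Dom C g = X" "Dom C h = X"
    using assms(1) by (auto simp: hom_iff)
  then have "g \<boxplus> hneg h = hzero X (Dom C m)"
    using assms(2)[of "g \<boxplus> hneg h"] assms(1) eq by (simp add: cmp_hadd cmp_hneg)
  then show "g = h" using gh hadd_eq_zero_iff[of g h] by simp
qed (rule assms)

lemma epicI:
  assumes "arrow C e"
    and "\<And>g. \<lbrakk>arrow C g; Dom C g = Cod C e; g \<cdot> e = hzero (Dom C e) (Cod C g)\<rbrakk>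
      \<Longrightarrow> g = hzero (Cod C e) (Cod C g)"
  shows "epic C e"
  unfolding epic_def
proof (intro conjI ballI impI)
  fix X g h assume "X \<in> Ob C" "g \<in> carrier (Hom C (Cod C e) X)" "h \<in> carrier (Hom C (Cod C e) X)"
    and eq: "g \<cdot> e = h \<cdot> e"
  then have gh: "arrow C g" "arrow C h" "Dom C g = Cod C e" "Dom C h = Cod C e" "Cod C g = X" "Cod C h = X"
    using assms(1) by (auto simp: hom_iff)
  then have "g \<boxplus> hneg h = hzero (Cod C e) X"
    using assms(2)[of "g \<boxplus> hneg h"] assms(1) eq by (simp add: cmp_hadd cmp_hneg)
  then show "g = h" using gh hadd_eq_zero_iff[of g h] by simp
qed (rule assms)

lemma epic_Idn [simp]: "X \<in> Ob C \<Longrightarrow> epic C (Idn C X)"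
  by (rule epicI) auto

lemma monic_Idn [simp]: "X \<in> Ob C \<Longrightarrow> monic C (Idn C X)"
  by (rule monicI) auto

lemma epic_cmp [simp]:
  assumes "epic C e" "epic C f" "Cod C f = Dom C e"
  shows "epic C (e \<cdot> f)"
proof (rule epicI)
  fix g assume "arrow C g" "Dom C g = Cod C (e \<cdot> f)" "g \<cdot> (e \<cdot> f) = hzero (Dom C (e \<cdot> f)) (Cod C g)"
  then show "g = hzero (Cod C (e \<cdot> f)) (Cod C g)"
    using assms epic_zero[of f "g \<cdot> e"] epic_zero[of e g] by simp
qed (use assms in simp)

lemma monic_cmp [simp]:
  assumes "monic C e" "monic C f" "Cod C f = Dom C e"
  shows "monic C (e \<cdot> f)"
proof (rule monicI)
  fix g assume "arrow C g" "Cod C g = Dom C (e \<cdot> f)" "(e \<cdot> f) \<cdot> g = hzero (Dom C g) (Cod C (e \<cdot> f))"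
  then show "g = hzero (Dom C g) (Dom C (e \<cdot> f))"
    using assms monic_zero[of e "f \<cdot> g"] monic_zero[of f g] by simp
qed (use assms in simp)

lemma is_kernelD:
  assumes "is_kernel C k f"
  shows "arrow C f" "arrow C k" "Cod C k = Dom C f" "f \<cdot> k = hzero (Dom C k) (Cod C f)"
  using assms by (auto simp: is_kernel_def)

lemma is_cokernelD:
  assumes "is_cokernel C q f"
  shows "arrow C f" "arrow C q" "Dom C q = Cod C f" "q \<cdot> f = hzero (Dom C f) (Cod C q)"
  using assms by (auto simp: is_cokernel_def)

lemma kernel_factor:
  assumes "is_kernel C k f" "arrow C g" "Cod C g = Dom C f" "f \<cdot> g = hzero (Dom C g) (Cod C f)"
  obtains u where "arrow C u" "Dom C u = Dom C g" "Cod C u = Dom C k" "k \<cdot> u = g"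
proof -
  have "g \<in> carrier (Hom C (Dom C g) (Dom C f))" using assms is_kernelD by (simp add: hom_iff)
  then obtain u where "u \<in> carrier (Hom C (Dom C g) (Dom C k))" "k \<cdot> u = g"
    using assms arrow_Ob(1)[OF assms(2)] unfolding is_kernel_def by metis
  then show ?thesis
    using that[of u] is_kernelD[OF assms(1)] assms(2) by (simp add: hom_iff)
qed

lemma cokernel_factor:
  assumes "is_cokernel C q f" "arrow C g" "Dom C g = Cod C f" "g \<cdot> f = hzero (Dom C f) (Cod C g)"
  obtains u where "arrow C u" "Dom C u = Cod C q" "Cod C u = Cod C g" "u \<cdot> q = g"
proof -
  have "g \<in> carrier (Hom C (Cod C f) (Cod C g))" using assms is_cokernelD by (simp add: hom_iff)
  then obtain u where "u \<in> carrier (Hom C (Cod C q) (Cod C g))" "u \<cdot> q = g"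
    using assms arrow_Ob(2)[OF assms(2)] unfolding is_cokernel_def by metis
  then show ?thesis
    using that[of u] is_cokernelD[OF assms(1)] assms(2) by (simp add: hom_iff)
qed

lemma kernel_monic:
  assumes "is_kernel C k f"
  shows "monic C k"
proof (rule monicI)
  note k = is_kernelD[OF assms]
  show "arrow C k" by (rule k)
  fix g assume g: "arrow C g" "Cod C g = Dom C k" "k \<cdot> g = hzero (Dom C g) (Cod C k)"
  have "\<exists>!u. u \<in> carrier (Hom C (Dom C g) (Dom C k)) \<and> k \<cdot> u = hzero (Dom C g) (Cod C k)"
    using assms k g unfolding is_kernel_def by (metis (no_types) arrow_Ob(1) cmp_zero_right hom_iff hzero_arrow)
  then show "g = hzero (Dom C g) (Dom C k)"
    using g k by (metis arrow_Ob(1) cmp_zero_right hom_iff hzero_arrow)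
qed

lemma cokernel_epic:
  assumes "is_cokernel C q f"
  shows "epic C q"
proof (rule epicI)
  note q = is_cokernelD[OF assms]
  show "arrow C q" by (rule q)
  fix g assume g: "arrow C g" "Dom C g = Cod C q" "g \<cdot> q = hzero (Dom C q) (Cod C g)"
  have "\<exists>!u. u \<in> carrier (Hom C (Cod C q) (Cod C g)) \<and> u \<cdot> q = hzero (Dom C q) (Cod C g)"
    using assms q g unfolding is_cokernel_def by (metis (no_types) arrow_Ob(2) cmp_zero_left hom_iff hzero_arrow)
  then show "g = hzero (Cod C q) (Cod C g)"
    using g q by (metis arrow_Ob(2) cmp_zero_left hom_iff hzero_arrow)
qed

lemma is_biproduct_2D:
  assumes "is_biproduct C 2 X P inc prj"
  shows "P \<in> Ob C" "X 0 \<in> Ob C" "X 1 \<in> Ob C"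
    "arrow C (inc 0)" "arrow C (inc 1)" "arrow C (prj 0)" "arrow C (prj 1)"
    "Dom C (inc 0) = X 0" "Dom C (inc 1) = X 1" "Cod C (inc 0) = P" "Cod C (inc 1) = P"
    "Dom C (prj 0) = P" "Dom C (prj 1) = P" "Cod C (prj 0) = X 0" "Cod C (prj 1) = X 1"
    "prj 0 \<cdot> inc 0 = Idn C (X 0)" "prj 1 \<cdot> inc 1 = Idn C (X 1)"
    "prj 0 \<cdot> inc 1 = hzero (X 1) (X 0)" "prj 1 \<cdot> inc 0 = hzero (X 0) (X 1)"
    "inc 0 \<cdot> prj 0 \<boxplus> inc 1 \<cdot> prj 1 = Idn C P"
proof -
  show ob: "P \<in> Ob C" "X 0 \<in> Ob C" "X 1 \<in> Ob C"
    using assms by (auto simp: is_biproduct_def)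
  show ar: "arrow C (inc 0)" "arrow C (inc 1)" "arrow C (prj 0)" "arrow C (prj 1)"
    "Dom C (inc 0) = X 0" "Dom C (inc 1) = X 1" "Cod C (inc 0) = P" "Cod C (inc 1) = P"
    "Dom C (prj 0) = P" "Dom C (prj 1) = P" "Cod C (prj 0) = X 0" "Cod C (prj 1) = X 1"
    using assms[unfolded is_biproduct_def, THEN conjunct2, THEN conjunct1, rule_format, of 0]
      assms[unfolded is_biproduct_def, THEN conjunct2, THEN conjunct1, rule_format, of 1] ob
    by (simp_all add: hom_iff del: One_nat_def)
  show "prj 0 \<cdot> inc 0 = Idn C (X 0)" "prj 1 \<cdot> inc 1 = Idn C (X 1)"
    "prj 0 \<cdot> inc 1 = hzero (X 1) (X 0)" "prj 1 \<cdot> inc 0 = hzero (X 0) (X 1)"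
    using assms by (auto simp: is_biproduct_def)
  have "finsum (Hom C P P) (\<lambda>i. inc i \<cdot> prj i) {..<2} = Idn C P"
    using assms by (simp add: is_biproduct_def)
  then show "inc 0 \<cdot> prj 0 \<boxplus> inc 1 \<cdot> prj 1 = Idn C P"
    using finsum_2[of P P "\<lambda>i. inc i \<cdot> prj i"] ob ar by (simp add: hom_iff)
qed

end

section \<open>Subobjects in an abelian category\<close>

context abelian_category
begin

text \<open>A monomorphism is a kernel of some \<open>f\<close>. As \<open>f\<close> kills
  \<open>m\<close>, it factors through the cokernel \<open>c\<close>, so \<open>f\<close> kills
  whatever \<open>c\<close> kills.\<close>

lemma monic_kernel_of_cokernel:
  assumes "monic C m" "is_cokernel C c m" "arrow C x" "Cod C x = Cod C m"
    "c \<cdot> x = hzero (Dom C x) (Cod C c)"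
  obtains u where "arrow C u" "Dom C u = Dom C x" "Cod C u = Dom C m" "m \<cdot> u = x"
proof -
  obtain f where f: "is_kernel C m f" using monic_is_kernel assms(1) by blast
  note fD = is_kernelD[OF f] and cD = is_cokernelD[OF assms(2)]
  obtain v where v: "arrow C v" "Dom C v = Cod C c" "Cod C v = Cod C f" "v \<cdot> c = f"
    using cokernel_factor[OF assms(2) fD(1)] fD by auto
  have "f \<cdot> x = v \<cdot> (c \<cdot> x)"
    using v cD fD assms(3,4) cmp_assoc'[of x c v] by simp
  then have "f \<cdot> x = hzero (Dom C x) (Cod C f)"
    using v assms(3,5) by simp
  then show thesis
    using kernel_factor[OF f assms(3)] assms(4) fD that by auto
qed

text \<open>Dually, \<open>e\<close> is a cokernel of some \<open>f\<close>, and \<open>f\<close>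
  factors through the kernel \<open>k\<close>; an arrow killing \<open>k\<close> therefore kills
  \<open>f\<close>.\<close>

lemma epic_cokernel_of_kernel:
  assumes "epic C e" "is_kernel C k e" "arrow C x" "Dom C x = Dom C e"
    "x \<cdot> k = hzero (Dom C k) (Cod C x)"
  obtains u where "arrow C u" "Dom C u = Cod C e" "Cod C u = Cod C x" "u \<cdot> e = x"
proof -
  obtain f where f: "is_cokernel C e f" using epic_is_cokernel assms(1) by blast
  note fD = is_cokernelD[OF f] and kD = is_kernelD[OF assms(2)]
  obtain v where v: "arrow C v" "Dom C v = Dom C f" "Cod C v = Dom C k" "k \<cdot> v = f"
    using kernel_factor[OF assms(2) fD(1)] fD by auto
  have "x \<cdot> f = (x \<cdot> k) \<cdot> v"
    using v kD fD assms(3,4) cmp_assoc'[of v k x] by simp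
  then have "x \<cdot> f = hzero (Dom C f) (Cod C x)"
    using v assms(3,5) by simp
  then show thesis
    using cokernel_factor[OF f assms(3)] assms(4) fD that by auto
qed

text \<open>The monic part is the kernel of the cokernel of \<open>f\<close>. The work lies in
  showing that \<open>e\<close> is epic: if \<open>u\<close> kills \<open>e\<close> and
  \<open>k\<close> is the kernel of \<open>u\<close>, then \<open>f\<close> factors through
  \<open>m \<cdot> k\<close>, and this cannot be smaller than \<open>m\<close>.\<close>

lemma epic_mono_factorization:
  assumes f: "arrow C f"
  obtains m e where "monic C m" "epic C e" "Dom C e = Dom C f" "Cod C e = Dom C m" "Cod C m = Cod C f"
    "f = m \<cdot> e"
proof -
  obtain c where c: "is_cokernel C c f" using cokernel_exists f by blast
  note cD = is_cokernelD[OF c]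
  obtain m where m: "is_kernel C m c" using kernel_exists cD by blast
  note mD = is_kernelD[OF m]
  have mm: "monic C m" using kernel_monic m by blast
  obtain e where e: "arrow C e" "Dom C e = Dom C f" "Cod C e = Dom C m" "m \<cdot> e = f"
    using kernel_factor[OF m f] cD by auto
  have "epic C e"
  proof (rule epicI)
    fix u assume u: "arrow C u" "Dom C u = Cod C e" "u \<cdot> e = hzero (Dom C e) (Cod C u)"
    obtain k where k: "is_kernel C k u" using kernel_exists u by blast
    note kD = is_kernelD[OF k]
    obtain e' where e': "arrow C e'" "Dom C e' = Dom C e" "Cod C e' = Dom C k" "k \<cdot> e' = e"
      using kernel_factor[OF k e(1)] u by auto
    have "monic C (m \<cdot> k)"
      using mm kernel_monic[OF k] kD u e by simp
    obtain w where w: "is_cokernel C w (m \<cdot> k)"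
      using cokernel_exists[of "m \<cdot> k"] kD(2,3) mD(2) u(2) e(3) by auto
    note wD = is_cokernelD[OF w]
    have "f = (m \<cdot> k) \<cdot> e'"
      using kD(2,3) mD(2) e e' u(2) by simp
    \<comment> \<open>Since \<open>w\<close> kills \<open>f\<close>, it factors through the cokernel
      \<open>c\<close> and so kills all of \<open>m\<close>; hence \<open>m\<close> factors through
      \<open>m \<cdot> k\<close>.\<close>
    then have "w \<cdot> f = hzero (Dom C (m \<cdot> k)) (Cod C w) \<cdot> e'"
      using cmp_eq_cmp[OF wD(4) e'(1)] wD(1-3) kD(2,3) mD(2) e'(3) u(2) e(3) by simp
    then have "w \<cdot> f = hzero (Dom C f) (Cod C w)"
      using wD(2) e(2,3) e' kD(2,3) mD(2) u(2) by simp
    then obtain w' where w': "arrow C w'" "Dom C w' = Cod C c" "Cod C w' = Cod C w" "w' \<cdot> c = w"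
      using cokernel_factor[OF c wD(2)] wD(3) mD(2,3) cD(3) kD(2,3) u(2) e(3) by auto
    have "w \<cdot> m = hzero (Dom C m) (Cod C w)"
      using cmp_assoc'[of m c w'] w' cD(2) mD(2-4) by simp
    then obtain t where t: "arrow C t" "Dom C t = Dom C m" "Cod C t = Dom C k" "(m \<cdot> k) \<cdot> t = m"
      using monic_kernel_of_cokernel[OF \<open>monic C (m \<cdot> k)\<close> w mD(2)] kD(2,3) mD(2) u(2) e(3) by auto
    \<comment> \<open>Thus \<open>k\<close> is split epic, and \<open>u \<cdot> k = 0\<close> gives
      \<open>u = 0\<close>.\<close>
    have kt: "k \<cdot> t = Idn C (Dom C m)"
      by (rule monicD[OF mm]) (use t kD(2,3) mD(2) u(2) e(3) in simp_all)
    have "u \<cdot> k \<cdot> t = hzero (Dom C k) (Cod C u) \<cdot> t"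
      by (rule cmp_eq_cmp[OF kD(4)]) (use t kD u in simp_all)
    then show "u = hzero (Cod C e) (Cod C u)"
      unfolding kt using t(1-3) kD(2) u(1,2) e(3) by simp
  qed (rule e)
  then show thesis
    using that[OF mm _ e(2,3) _ e(4)[symmetric]] mD(3) cD(3) by simp
qed

text \<open>The pullback is the kernel of \<open>w = (e, -g)\<close> on the biproduct. Its
  restriction to the first summand is \<open>e\<close>, so \<open>w\<close> is epic and thus a
  cokernel of its kernel; this is what makes the projection \<open>p\<close> epic.\<close>

lemma pullback_epic:
  assumes e: "epic C e" and g: "arrow C g" "Cod C g = Cod C e"
  obtains p x where "epic C p" "Cod C p = Dom C g" "arrow C x" "Dom C x = Dom C p" "Cod C x = Dom C e"
    "e \<cdot> x = g \<cdot> p"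
proof -
  obtain P i r where "is_biproduct C 2 (pair_fun (Dom C e) (Dom C g)) P i r"
    using biproduct_exists[of "Dom C e" "Dom C g"] e g by auto
  note b = is_biproduct_2D[OF this, simplified]
  define w where "w = e \<cdot> r 0 \<boxplus> hneg (g \<cdot> r 1)"
  have w: "arrow C w" "Dom C w = P" "Cod C w = Cod C e"
    using b e g by (auto simp: w_def)
  have wi: "w \<cdot> i 0 = e" "w \<cdot> i 1 = hneg g"
    using b e g by (simp_all add: w_def cmp_hadd cmp_hneg)
  have ew: "epic C w"
  proof (rule epicI)
    fix u assume u: "arrow C u" "Dom C u = Cod C w" "u \<cdot> w = hzero (Dom C w) (Cod C u)"
    have "u \<cdot> w \<cdot> i 0 = hzero (Dom C w) (Cod C u) \<cdot> i 0"
      by (rule cmp_eq_cmp[OF u(3)]) (use u w b in simp_all)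
    then have "u \<cdot> e = hzero (Dom C e) (Cod C u)"
      unfolding wi using w(2) b(4,8,10) u(1) by simp
    then show "u = hzero (Cod C w) (Cod C u)"
      using u w e epic_zero[OF e u(1)] by simp
  qed (rule w)
  obtain k where k: "is_kernel C k w" using kernel_exists w by blast
  note kD = is_kernelD[OF k]
  define p where "p = r 1 \<cdot> k"
  define x where "x = r 0 \<cdot> k"
  have px: "arrow C p" "arrow C x" "Dom C p = Dom C k" "Dom C x = Dom C k" "Cod C p = Dom C g" "Cod C x = Dom C e"
    using b kD w by (auto simp: p_def x_def)
  have "w \<cdot> k = e \<cdot> x \<boxplus> hneg (g \<cdot> p)"
    unfolding w_def x_def p_def using b(1-15) kD(2,3) w(2) e g by (simp add: cmp_hadd cmp_hneg)
  then have "e \<cdot> x \<boxplus> hneg (g \<cdot> p) = hzero (Dom C k) (Cod C w)"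
    using kD(4) by simp
  then have "e \<cdot> x = g \<cdot> p"
    using hadd_eq_zero_iff[of "e \<cdot> x" "g \<cdot> p"] w(3) px e g by simp
  moreover have "epic C p"
  proof (rule epicI)
    \<comment> \<open>The arrow \<open>u \<cdot> r 1\<close> kills \<open>k\<close>, so it factors
      as \<open>v \<cdot> w\<close>. On the first summand this reads \<open>v \<cdot> e = 0\<close>,
      so \<open>v\<close> vanishes and \<open>u\<close> with it.\<close>
    fix u assume u: "arrow C u" "Dom C u = Cod C p" "u \<cdot> p = hzero (Dom C p) (Cod C u)"
    then have "(u \<cdot> r 1) \<cdot> k = hzero (Dom C k) (Cod C u)"
      using px b kD w by (simp add: p_def)
    then obtain v where v: "arrow C v" "Dom C v = Cod C w" "Cod C v = Cod C u" "v \<cdot> w = u \<cdot> r 1"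
      using epic_cokernel_of_kernel[OF ew k, of "u \<cdot> r 1"] u px b w by auto
    have "v \<cdot> w \<cdot> i 0 = (u \<cdot> r 1) \<cdot> i 0"
      by (rule cmp_eq_cmp[OF v(4)]) (use v w b in simp_all)
    then have "v \<cdot> e = hzero (Dom C e) (Cod C u)"
      unfolding wi using u px b by simp
    then have "v = hzero (Cod C e) (Cod C u)"
      using epic_zero[OF e v(1)] v w by simp
    then have "u \<cdot> r 1 = hzero P (Cod C u)" using v w u by simp
    then have "u \<cdot> r 1 \<cdot> i 1 = hzero P (Cod C u) \<cdot> i 1"
      by (rule cmp_eq_cmp) (use u px b in simp_all)
    then show "u = hzero (Cod C p) (Cod C u)" using u px b by simp
  qed (rule px)
  ultimately show thesis using that px by auto
qed

text \<open>\<open>m\<close> is a kernel of some \<open>f\<close>, which is zero because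
  \<open>m\<close> is epic; so the identity factors through \<open>m\<close>.\<close>

lemma monic_epic_inverse:
  assumes "monic C m" "epic C m"
  obtains u where "arrow C u" "Dom C u = Cod C m" "Cod C u = Dom C m" "m \<cdot> u = Idn C (Cod C m)"
    "u \<cdot> m = Idn C (Dom C m)"
proof -
  obtain f where f: "is_kernel C m f" using monic_is_kernel assms(1) by blast
  note fD = is_kernelD[OF f]
  have "f = hzero (Cod C m) (Cod C f)"
    using epic_zero[OF assms(2) fD(1)] fD by simp
  then have "f \<cdot> Idn C (Cod C m) = hzero (Cod C m) (Cod C f)"
    using fD by simp
  then obtain u where u: "arrow C u" "Dom C u = Cod C m" "Cod C u = Dom C m" "m \<cdot> u = Idn C (Cod C m)"
    using kernel_factor[OF f, of "Idn C (Cod C m)"] fD by auto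
  have "m \<cdot> u \<cdot> m = Idn C (Cod C m) \<cdot> m"
    by (rule cmp_eq_cmp[OF u(4)]) (use u assms in simp_all)
  then have "u \<cdot> m = Idn C (Dom C m)"
    using monicD[OF assms(1), of "u \<cdot> m" "Idn C (Dom C m)"] u(1-3) assms by simp
  then show thesis using that u by blast
qed

subsection \<open>Generalized elements\<close>

text \<open>An arrow \<open>x\<close> into \<open>X\<close> is treated as a generalized element of \<open>X\<close>; since pullbacks of
  epimorphisms are epimorphisms, elements may be lifted along an epimorphism after precomposing
  with another epimorphism, and this does not affect membership in a subobject.\<close>

definition mem :: "'c \<Rightarrow> 'c set \<Rightarrow> bool" where
  "mem x S \<longleftrightarrow> arrow C x \<and> (\<exists>m\<in>S. Cod C m = Cod C x \<and> factors C x m)"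

abbreviation Subs :: "'b \<Rightarrow> 'c set set" where
  "Subs X \<equiv> carrier (Sub C X)"

lemma Subs_iff: "S \<in> Subs X \<longleftrightarrow> (\<exists>m. monic C m \<and> Cod C m = X \<and> S = sub_of C m)"
  by (auto simp: Sub_def)

lemma factorsE:
  assumes "factors C x m" "arrow C x" "arrow C m"
  obtains u where "arrow C u" "Dom C u = Dom C x" "Cod C u = Dom C m" "x = m \<cdot> u"
  using assms by (auto simp: factors_def hom_iff)

lemma factorsI:
  "\<lbrakk>arrow C u; arrow C m; Cod C u = Dom C m\<rbrakk> \<Longrightarrow> factors C (m \<cdot> u) m"
  using arrow_hom[of u] by (auto simp: factors_def)

lemma factors_trans:
  assumes "factors C x m" "factors C m n" "arrow C x" "arrow C m" "arrow C n"
  shows "factors C x n"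
proof -
  obtain u where u: "arrow C u" "Dom C u = Dom C x" "Cod C u = Dom C m" "x = m \<cdot> u"
    using factorsE[OF assms(1,3,4)] .
  obtain v where v: "arrow C v" "Dom C v = Dom C m" "Cod C v = Dom C n" "m = n \<cdot> v"
    using factorsE[OF assms(2,4,5)] .
  have "x = n \<cdot> (v \<cdot> u)"
    unfolding u(4) v(4) using u(1-3) v(1-3) assms(5) by (intro cmp_assoc') simp_all
  then show ?thesis using factorsI[of "v \<cdot> u" n] u(1-3) v(1-3) assms(5) by simp
qed

lemma factors_refl: "arrow C m \<Longrightarrow> factors C m m"
  using factorsI[of "Idn C (Dom C m)" m] by simp

lemma sub_of_self: "monic C m \<Longrightarrow> m \<in> sub_of C m"
  by (simp add: sub_of_def factors_refl)

lemma Subs_monic: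
  assumes "S \<in> Subs X" "m \<in> S"
  shows "monic C m" "Cod C m = X" "S = sub_of C m"
proof -
  obtain n where n: "monic C n" "Cod C n = X" "S = sub_of C n" using assms by (auto simp: Subs_iff)
  then show m: "monic C m" "Cod C m = X" using assms by (auto simp: sub_of_def)
  show "S = sub_of C m"
    using n assms m by (auto simp: sub_of_def intro: factors_trans[of _ n] factors_trans[of _ m] factors_trans[of n] factors_trans[of m])
qed

lemma Subs_rep:
  assumes "S \<in> Subs X"
  obtains m where "m \<in> S" "monic C m" "Cod C m = X" "S = sub_of C m"
  using assms sub_of_self by (auto simp: Subs_iff)

lemma Subs_Ob: "S \<in> Subs X \<Longrightarrow> X \<in> Ob C"
  by (auto simp: Subs_iff)

lemma mem_rep:
  assumes "S \<in> Subs X" "m \<in> S"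
  shows "mem x S \<longleftrightarrow> arrow C x \<and> Cod C x = X \<and>
    (\<exists>u. arrow C u \<and> Dom C u = Dom C x \<and> Cod C u = Dom C m \<and> x = m \<cdot> u)"
proof
  assume "mem x S"
  then obtain n where n: "n \<in> S" "Cod C n = Cod C x" "factors C x n" "arrow C x"
    by (auto simp: mem_def)
  have "factors C n m" "monic C n" "monic C m" "Cod C m = X"
    using n assms Subs_monic[OF assms] by (auto simp: sub_of_def)
  then have "factors C x m" using n factors_trans[of x n m] by simp
  then show "arrow C x \<and> Cod C x = X \<and>
    (\<exists>u. arrow C u \<and> Dom C u = Dom C x \<and> Cod C u = Dom C m \<and> x = m \<cdot> u)"
    using n \<open>monic C n\<close> \<open>monic C m\<close> \<open>Cod C m = X\<close> Subs_monic(2)[OF assms(1) n(1)]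
      factorsE[OF \<open>factors C x m\<close>] by (metis monic_arrow)
next
  assume "arrow C x \<and> Cod C x = X \<and>
    (\<exists>u. arrow C u \<and> Dom C u = Dom C x \<and> Cod C u = Dom C m \<and> x = m \<cdot> u)"
  then show "mem x S"
    using assms Subs_monic[OF assms] factorsI[of _ m] by (auto simp: mem_def intro!: bexI[of _ m])
qed

lemma mem_sub_of:
  assumes "monic C m"
  shows "mem x (sub_of C m) \<longleftrightarrow> arrow C x \<and> Cod C x = Cod C m \<and>
    (\<exists>u. arrow C u \<and> Dom C u = Dom C x \<and> Cod C u = Dom C m \<and> x = m \<cdot> u)"
  by (rule mem_rep) (use assms sub_of_self in \<open>auto simp: Subs_iff\<close>)

lemma mem_arrow: "\<lbrakk>mem x S; S \<in> Subs X\<rbrakk> \<Longrightarrow> arrow C x \<and> Cod C x = X"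
  by (metis Subs_rep mem_rep)

lemma mem_self: "\<lbrakk>S \<in> Subs X; m \<in> S\<rbrakk> \<Longrightarrow> mem m S"
  using Subs_monic[of S X m] factors_refl by (auto simp: mem_def)

text \<open>A representative of \<open>S\<close> is itself an element of \<open>S\<close>, and the
  most general one: testing on it yields the factorization that defines the order.\<close>

lemma Sub_le_iff:
  assumes "S \<in> Subs X" "T \<in> Subs X"
  shows "S \<sqsubseteq>\<^bsub>Sub C X\<^esub> T \<longleftrightarrow> (\<forall>x. mem x S \<longrightarrow> mem x T)"
proof
  assume "S \<sqsubseteq>\<^bsub>Sub C X\<^esub> T"
  then obtain m n where mn: "m \<in> S" "n \<in> T" "factors C m n" by (auto simp: Sub_def)
  note m = Subs_monic[OF assms(1) mn(1)] and n = Subs_monic[OF assms(2) mn(2)]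
  show "\<forall>x. mem x S \<longrightarrow> mem x T"
  proof (intro allI impI)
    fix x assume "mem x S"
    then have x: "arrow C x" "Cod C x = X" "factors C x m"
      using mem_rep[OF assms(1) mn(1)] m factorsI by auto
    then have "factors C x n" using factors_trans[of x m n] mn m n by simp
    then show "mem x T" using x mn n by (auto simp: mem_def)
  qed
next
  assume *: "\<forall>x. mem x S \<longrightarrow> mem x T"
  obtain m where m: "m \<in> S" using assms Subs_rep by blast
  then have "mem m T" using * mem_self assms by blast
  then show "S \<sqsubseteq>\<^bsub>Sub C X\<^esub> T" using m by (auto simp: Sub_def mem_def)
qed

lemma Sub_eqI:
  assumes "S \<in> Subs X" "T \<in> Subs X" "\<And>x. \<lbrakk>arrow C x; Cod C x = X\<rbrakk> \<Longrightarrow> mem x S \<longleftrightarrow> mem x T"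
  shows "S = T"
proof -
  have *: "mem x S \<longleftrightarrow> mem x T" for x
    using assms mem_arrow by blast
  obtain m where m: "m \<in> S" "monic C m" "Cod C m = X" "S = sub_of C m" using Subs_rep[OF assms(1)] .
  obtain n where n: "n \<in> T" "monic C n" "Cod C n = X" "T = sub_of C n" using Subs_rep[OF assms(2)] .
  have "mem m T" "mem n S" using * m n mem_self assms by blast+
  then have "factors C m n" "factors C n m"
    using mem_rep[OF assms(2) n(1), of m] mem_rep[OF assms(1) m(1), of n] factorsI m(2) n(2)
    by (metis monic_arrow)+
  then have "m \<in> T" using m n by (simp add: sub_of_def)
  then show ?thesis using m Subs_monic[OF assms(2)] by simp
qed

lemma quot_map_cokernel:
  assumes "S \<in> Subs X"
  obtains m where "m \<in> S" "is_cokernel C (quot_map C S) m"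
proof -
  obtain m where m: "m \<in> S" "monic C m" using Subs_rep[OF assms] by metis
  obtain q where "is_cokernel C q m" using cokernel_exists[OF monic_arrow[OF m(2)]] by blast
  then have "\<exists>m\<in>S. is_cokernel C (quot_map C S) m"
    unfolding quot_map_def by (rule_tac someI_ex) (use m in blast)
  then show thesis using that by blast
qed

lemma quot_map_arrow:
  assumes "S \<in> Subs X"
  shows "epic C (quot_map C S)" "arrow C (quot_map C S)" "Dom C (quot_map C S) = X"
    "Cod C (quot_map C S) = quot_ob C S" "quot_ob C S \<in> Ob C"
proof -
  obtain m where m: "m \<in> S" "is_cokernel C (quot_map C S) m" using quot_map_cokernel[OF assms] .
  show "epic C (quot_map C S)" by (rule cokernel_epic) (rule m)
  then show "arrow C (quot_map C S)" by simp
  then show "quot_ob C S \<in> Ob C" "Cod C (quot_map C S) = quot_ob C S" by (auto simp: quot_ob_def)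
  show "Dom C (quot_map C S) = X"
    using is_cokernelD[OF m(2)] Subs_monic[OF assms m(1)] by simp
qed

text \<open>A monomorphism is the kernel of its cokernel, so membership is an equation. Closure
  under sums, negatives and precomposition, and descent along epimorphisms, are read off from
  it.\<close>

lemma mem_iff_quot_map:
  assumes "S \<in> Subs X"
  shows "mem x S \<longleftrightarrow> arrow C x \<and> Cod C x = X \<and> quot_map C S \<cdot> x = hzero (Dom C x) (quot_ob C S)"
proof -
  obtain m where m: "m \<in> S" "is_cokernel C (quot_map C S) m" using quot_map_cokernel[OF assms] .
  note mm = Subs_monic[OF assms m(1)] and c = is_cokernelD[OF m(2)] and q = quot_map_arrow[OF assms]
  show ?thesis
  proof
    assume "mem x S"
    then obtain u where u: "arrow C x" "Cod C x = X" "arrow C u" "Dom C u = Dom C x" "Cod C u = Dom C m"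
        "x = m \<cdot> u"
      using mem_rep[OF assms m(1)] by auto
    have "quot_map C S \<cdot> x = hzero (Dom C m) (Cod C (quot_map C S)) \<cdot> u"
      unfolding u(6) by (rule cmp_eq_cmp[OF c(4)]) (use u(3-5) c(1-3) mm(2) in simp_all)
    then show "arrow C x \<and> Cod C x = X \<and> quot_map C S \<cdot> x = hzero (Dom C x) (quot_ob C S)"
      using u(1-5) q by simp
  next
    assume x: "arrow C x \<and> Cod C x = X \<and> quot_map C S \<cdot> x = hzero (Dom C x) (quot_ob C S)"
    then obtain u where "arrow C u" "Dom C u = Dom C x" "Cod C u = Dom C m" "m \<cdot> u = x"
      using monic_kernel_of_cokernel[OF mm(1) m(2), of x] mm q by auto
    then show "mem x S" using mem_rep[OF assms m(1)] x by auto
  qed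
qed

lemma mem_cmp:
  assumes "S \<in> Subs X" "mem x S" "arrow C g" "Cod C g = Dom C x"
  shows "mem (x \<cdot> g) S"
proof -
  note q = quot_map_arrow[OF assms(1)]
  have x: "arrow C x" "Cod C x = X" "quot_map C S \<cdot> x = hzero (Dom C x) (quot_ob C S)"
    using assms mem_iff_quot_map by auto
  have "quot_map C S \<cdot> x \<cdot> g = hzero (Dom C x) (quot_ob C S) \<cdot> g"
    by (rule cmp_eq_cmp[OF x(3)]) (use x q assms in simp_all)
  then show ?thesis using x q(5) assms(3,4) mem_iff_quot_map[OF assms(1)] by simp
qed

lemma mem_local:
  assumes "S \<in> Subs X" "arrow C x" "Cod C x = X" "epic C p" "Cod C p = Dom C x" "mem (x \<cdot> p) S"
  shows "mem x S"
proof -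
  note q = quot_map_arrow[OF assms(1)]
  have "(quot_map C S \<cdot> x) \<cdot> p = hzero (Dom C p) (quot_ob C S)"
    using assms(6) mem_iff_quot_map[OF assms(1)] q assms by simp
  then show ?thesis
    using mem_iff_quot_map[OF assms(1)] epic_zero[OF assms(4), of "quot_map C S \<cdot> x"] q assms by simp
qed

lemma mem_add:
  assumes "S \<in> Subs X" "mem x S" "mem y S" "Dom C y = Dom C x"
  shows "mem (x \<boxplus> y) S"
  using assms quot_map_arrow[OF assms(1)] by (auto simp: mem_iff_quot_map cmp_hadd)

lemma mem_neg:
  assumes "S \<in> Subs X" "mem x S"
  shows "mem (hneg x) S"
  using assms quot_map_arrow[OF assms(1)] by (auto simp: mem_iff_quot_map cmp_hneg)

lemma mem_zero:
  assumes "S \<in> Subs X" "Y \<in> Ob C"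
  shows "mem (hzero Y X) S"
  using assms quot_map_arrow[OF assms(1)] Subs_Ob[OF assms(1)] by (auto simp: mem_iff_quot_map)

section \<open>Kernels, preimages and images of subobjects\<close>

definition ker_sub :: "'c \<Rightarrow> 'c set" where
  "ker_sub f = sub_of C (SOME k. is_kernel C k f)"

text \<open>Formed as a kernel rather than a pullback, so that \<open>mem_iff_quot_map\<close>
  yields its elements at once.\<close>

definition preim :: "'c \<Rightarrow> 'c set \<Rightarrow> 'c set" where
  "preim f S = ker_sub (quot_map C S \<cdot> f)"

lemma
  assumes f: "arrow C f"
  shows ker_sub_closed: "ker_sub f \<in> Subs (Dom C f)"
    and mem_ker_sub: "mem x (ker_sub f) \<longleftrightarrow>
      arrow C x \<and> Cod C x = Dom C f \<and> f \<cdot> x = hzero (Dom C x) (Cod C f)"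
proof -
  define k where "k = (SOME k. is_kernel C k f)"
  have k: "is_kernel C k f"
    unfolding k_def using kernel_exists[OF f] by (rule someI_ex)
  note kD = is_kernelD[OF k] and km = kernel_monic[OF k]
  show "ker_sub f \<in> Subs (Dom C f)"
    using km kD by (auto simp: ker_sub_def k_def[symmetric] Subs_iff)
  have "arrow C x \<and> Cod C x = Dom C f \<and>
    (\<exists>u. arrow C u \<and> Dom C u = Dom C x \<and> Cod C u = Dom C k \<and> x = k \<cdot> u) \<longleftrightarrow>
    arrow C x \<and> Cod C x = Dom C f \<and> f \<cdot> x = hzero (Dom C x) (Cod C f)" (is "?L \<longleftrightarrow> ?R")
  proof
    assume ?L
    then obtain u where u: "arrow C x" "Cod C x = Dom C f" "arrow C u" "Dom C u = Dom C x" "Cod C u = Dom C k"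
      "x = k \<cdot> u" by blast
    have "f \<cdot> x = hzero (Dom C k) (Cod C f) \<cdot> u"
      unfolding u(6) by (rule cmp_eq_cmp[OF kD(4)]) (use u(3-5) kD in simp_all)
    then show ?R using u(1-5) f by simp
  next
    assume ?R
    then show ?L using kernel_factor[OF k, of x] by metis
  qed
  then show "mem x (ker_sub f) \<longleftrightarrow>
      arrow C x \<and> Cod C x = Dom C f \<and> f \<cdot> x = hzero (Dom C x) (Cod C f)"
    unfolding ker_sub_def k_def[symmetric] mem_sub_of[OF km] using kD by simp
qed

lemma
  assumes f: "arrow C f" and S: "S \<in> Subs (Cod C f)"
  shows preim_closed: "preim f S \<in> Subs (Dom C f)"
    and mem_preim: "mem x (preim f S) \<longleftrightarrow> arrow C x \<and> Cod C x = Dom C f \<and> mem (f \<cdot> x) S"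
proof -
  note q = quot_map_arrow[OF S]
  show "preim f S \<in> Subs (Dom C f)"
    using ker_sub_closed[of "quot_map C S \<cdot> f"] q f by (simp add: preim_def)
  show "mem x (preim f S) \<longleftrightarrow> arrow C x \<and> Cod C x = Dom C f \<and> mem (f \<cdot> x) S"
    using mem_ker_sub[of "quot_map C S \<cdot> f" x] q f by (auto simp: preim_def mem_iff_quot_map[OF S])
qed

text \<open>\<open>im_sub\<close> collects the monic parts of all factorizations, and these have to
  be seen to form exactly one class. An element of the image lifts to the domain only after
  precomposition with an epimorphism.\<close>

lemma
  assumes f: "arrow C f"
  shows im_sub_closed: "im_sub C f \<in> Subs (Cod C f)"
    and mem_im_sub: "mem x (im_sub C f) \<longleftrightarrow> arrow C x \<and> Cod C x = Cod C f \<and>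
      (\<exists>p u. epic C p \<and> Cod C p = Dom C x \<and> arrow C u \<and> Dom C u = Dom C p \<and> Cod C u = Dom C f \<and>
        x \<cdot> p = f \<cdot> u)"
proof -
  obtain m e where me: "monic C m" "epic C e" "Dom C e = Dom C f" "Cod C e = Dom C m" "Cod C m = Cod C f"
      "f = m \<cdot> e"
    using epic_mono_factorization[OF f] .
  \<comment> \<open>Two monic parts factor through each other: the cokernel of \<open>m\<close>
    kills \<open>n \<cdot> e\<close>, and \<open>e\<close> is epic.\<close>
  have fact: "factors C n m" if n: "monic C n" "monic C m" "Cod C n = Cod C m" "epic C e" "epic C e'"
      "Cod C e = Dom C n" "Cod C e' = Dom C m" "Dom C e = Dom C e'" "n \<cdot> e = m \<cdot> e'" for n m e e'
  proof -
    obtain c where c: "is_cokernel C c m" using cokernel_exists[OF monic_arrow[OF n(2)]] by blast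
    note cD = is_cokernelD[OF c]
    have "(c \<cdot> n) \<cdot> e = hzero (Dom C m) (Cod C c) \<cdot> e'"
      using cmp_eq_cmp[OF cD(4), of e'] cD(1-3) n by simp
    then have "c \<cdot> n = hzero (Dom C n) (Cod C c)"
      using epic_zero[OF n(4), of "c \<cdot> n"] cD(1-3) n by simp
    then obtain u where "arrow C u" "Dom C u = Dom C n" "Cod C u = Dom C m" "m \<cdot> u = n"
      using monic_kernel_of_cokernel[OF n(2) c, of n] n by auto
    then show ?thesis using factorsI[of u m] n by auto
  qed
  have eq: "im_sub C f = sub_of C m"
  proof (intro Set.set_eqI iffI)
    fix n assume "n \<in> im_sub C f"
    then obtain e' where n: "monic C n" "Cod C n = Cod C f" "epic C e'" "Dom C e' = Dom C f" "Cod C e' = Dom C n"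
        "f = n \<cdot> e'" by (auto simp: im_sub_def)
    then have "n \<cdot> e' = m \<cdot> e" using me(6) by metis
    then show "n \<in> sub_of C m"
      using fact[of n m e' e] fact[of m n e e'] n(1-5) me(1-5) by (simp add: sub_of_def)
  next
    fix n assume "n \<in> sub_of C m"
    then have n: "monic C n" "Cod C n = Cod C m" "factors C m n" "factors C n m"
      by (auto simp: sub_of_def)
    obtain v where v: "arrow C v" "Dom C v = Dom C m" "Cod C v = Dom C n" "m = n \<cdot> v"
      using factorsE[OF n(3) monic_arrow[OF me(1)] monic_arrow[OF n(1)]] .
    obtain u where u: "arrow C u" "Dom C u = Dom C n" "Cod C u = Dom C m" "n = m \<cdot> u"
      using factorsE[OF n(4) monic_arrow[OF n(1)] monic_arrow[OF me(1)]] .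
    have "n \<cdot> (v \<cdot> u) = n"
      using cmp_eq_cmp[OF v(4)[symmetric], of u] u(1-3) u(4)[symmetric] n(1) v(1-3) by simp
    \<comment> \<open>Conversely, every mono equivalent to \<open>m\<close> is a monic part: the
      comparison arrow \<open>v\<close> is split epic, so \<open>v \<cdot> e\<close> is
      epic.\<close>
    then have vu: "v \<cdot> u = Idn C (Dom C n)"
      using monicD[OF n(1), of "v \<cdot> u" "Idn C (Dom C n)"] u(1-3) v(1-3) n by simp
    have "epic C v"
    proof (rule epicI)
      fix w assume w: "arrow C w" "Dom C w = Cod C v" "w \<cdot> v = hzero (Dom C v) (Cod C w)"
      have "w \<cdot> v \<cdot> u = hzero (Dom C v) (Cod C w) \<cdot> u"
        by (rule cmp_eq_cmp[OF w(3)]) (use w(1,2) u(1-3) v(1-3) in simp_all)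
      then show "w = hzero (Cod C v) (Cod C w)"
        unfolding vu using w(1,2) u(1-3) v(2,3) by simp
    qed (rule v)
    then have "epic C (v \<cdot> e)" using me(2,4) v(2) by simp
    moreover have "f = n \<cdot> (v \<cdot> e)"
      unfolding me(6) by (rule cmp_eq_cmp[OF v(4)[symmetric], symmetric]) (use me(2,4) v(1-3) n(1) in simp_all)
    ultimately show "n \<in> im_sub C f"
      unfolding im_sub_def using n(1,2) me(1-5) v(1-3) by (auto intro!: exI[of _ "v \<cdot> e"])
  qed
  show "im_sub C f \<in> Subs (Cod C f)"
    unfolding eq using me(1,5) by (auto simp: Subs_iff)
  show "mem x (im_sub C f) \<longleftrightarrow> arrow C x \<and> Cod C x = Cod C f \<and>
      (\<exists>p u. epic C p \<and> Cod C p = Dom C x \<and> arrow C u \<and> Dom C u = Dom C p \<and> Cod C u = Dom C f \<and>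
        x \<cdot> p = f \<cdot> u)" (is "_ \<longleftrightarrow> ?R")
  proof
    assume "mem x (im_sub C f)"
    then obtain u where u: "arrow C x" "Cod C x = Cod C m" "arrow C u" "Dom C u = Dom C x" "Cod C u = Dom C m"
        "x = m \<cdot> u"
      unfolding eq mem_sub_of[OF me(1)] by auto
    obtain p y where p: "epic C p" "Cod C p = Dom C u" "arrow C y" "Dom C y = Dom C p" "Cod C y = Dom C e"
        "e \<cdot> y = u \<cdot> p"
      using pullback_epic[OF me(2) u(3)] u(5) me(4) by auto
    have "x \<cdot> p = m \<cdot> (u \<cdot> p)"
      unfolding u(6) by (rule cmp_assoc') (use p(1,2) u(3-5) me(1) in simp_all)
    also have "\<dots> = f \<cdot> y"
      unfolding me(6) p(6)[symmetric] by (rule cmp_assoc'[symmetric]) (use p(3-5) me(1-5) in simp_all)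
    finally show ?R using u(1-5) p(1-5) me(3,5) by auto
  next
    assume ?R
    then obtain p u where pu: "arrow C x" "Cod C x = Cod C f" "epic C p" "Cod C p = Dom C x" "arrow C u"
        "Dom C u = Dom C p" "Cod C u = Dom C f" "x \<cdot> p = f \<cdot> u"
      by blast
    have "x \<cdot> p = m \<cdot> (e \<cdot> u)"
      unfolding pu(8) me(6) by (rule cmp_assoc') (use pu(5-7) me(1-5) in simp_all)
    then have "mem (x \<cdot> p) (sub_of C m)"
      unfolding mem_sub_of[OF me(1)] using pu(1-7) me(1-5) by (auto intro!: exI[of _ "e \<cdot> u"])
    then show "mem x (im_sub C f)"
      unfolding eq using pu(1-4) me(1,5) by (intro mem_local[of "sub_of C m" "Cod C f" x p]) (auto simp: Subs_iff)
  qed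
qed

lemma mem_im_subI:
  "\<lbrakk>arrow C f; arrow C u; Cod C u = Dom C f\<rbrakk> \<Longrightarrow> mem (f \<cdot> u) (im_sub C f)"
  by (subst mem_im_sub) (simp_all, rule exI[of _ "Idn C (Dom C u)"], auto)

text \<open>All representatives \<open>m\<close> give the same image, because its elements can be
  described through \<open>S\<close> alone.\<close>

lemma
  assumes f: "arrow C f" and S: "S \<in> Subs (Dom C f)"
  shows direct_im_closed: "direct_im C f S \<in> Subs (Cod C f)"
    and mem_direct_im: "mem x (direct_im C f S) \<longleftrightarrow> arrow C x \<and> Cod C x = Cod C f \<and>
      (\<exists>p s. epic C p \<and> Cod C p = Dom C x \<and> mem s S \<and> Dom C s = Dom C p \<and> x \<cdot> p = f \<cdot> s)"
proof -
  have mem1: "mem x (im_sub C (f \<cdot> m)) \<longleftrightarrow> arrow C x \<and> Cod C x = Cod C f \<and>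
      (\<exists>p s. epic C p \<and> Cod C p = Dom C x \<and> mem s S \<and> Dom C s = Dom C p \<and> x \<cdot> p = f \<cdot> s)"
    if m: "m \<in> S" for x m
  proof -
    note mm = Subs_monic[OF S m]
    have "(\<exists>u. arrow C u \<and> Dom C u = Dom C p \<and> Cod C u = Dom C (f \<cdot> m) \<and> x \<cdot> p = (f \<cdot> m) \<cdot> u) \<longleftrightarrow>
        (\<exists>s. mem s S \<and> Dom C s = Dom C p \<and> x \<cdot> p = f \<cdot> s)" (is "?L \<longleftrightarrow> ?R") for p
    proof
      assume ?L
      then obtain u where u: "arrow C u" "Dom C u = Dom C p" "Cod C u = Dom C m" "x \<cdot> p = f \<cdot> m \<cdot> u"
        using mm f by auto
      then have "mem (m \<cdot> u) S" unfolding mem_rep[OF S m] using mm by auto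
      then show ?R using u(1-3) u(4) mm(1) by (intro exI[of _ "m \<cdot> u"]) simp
    next
      assume ?R
      then obtain u where "arrow C u" "Dom C u = Dom C p" "Cod C u = Dom C m" "x \<cdot> p = f \<cdot> (m \<cdot> u)"
        unfolding mem_rep[OF S m] by auto
      then show ?L using mm(1,2) f by (intro exI[of _ u]) simp
    qed
    then show ?thesis
      using mem_im_sub[of "f \<cdot> m" x] mm f by simp
  qed
  obtain m where m: "m \<in> S" using Subs_rep[OF S] by blast
  have cl: "im_sub C (f \<cdot> n) \<in> Subs (Cod C f)" if "n \<in> S" for n
    using im_sub_closed[of "f \<cdot> n"] Subs_monic[OF S that] f by simp
  have "im_sub C (f \<cdot> n) = im_sub C (f \<cdot> m)" if "n \<in> S" for n
    by (rule Sub_eqI[OF cl[OF that] cl[OF m]]) (simp add: mem1[OF that] mem1[OF m])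
  then have eq: "direct_im C f S = im_sub C (f \<cdot> m)"
    unfolding direct_im_def using m by blast
  show "direct_im C f S \<in> Subs (Cod C f)"
    unfolding eq by (rule cl[OF m])
  show "mem x (direct_im C f S) \<longleftrightarrow> arrow C x \<and> Cod C x = Cod C f \<and>
      (\<exists>p s. epic C p \<and> Cod C p = Dom C x \<and> mem s S \<and> Dom C s = Dom C p \<and> x \<cdot> p = f \<cdot> s)"
    unfolding eq by (rule mem1[OF m])
qed

subsection \<open>The lattice of subobjects\<close>

lemma pair_zero_iff:
  assumes b: "is_biproduct C 2 X P i r" and f: "arrow C f" "Cod C f = X 0" and g: "arrow C g" "Cod C g = X 1"
    and fg: "Dom C g = Dom C f"
  shows "i 0 \<cdot> f \<boxplus> i 1 \<cdot> g = hzero (Dom C f) P \<longleftrightarrow> f = hzero (Dom C f) (X 0) \<and> g = hzero (Dom C f) (X 1)"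
proof
  note b = is_biproduct_2D[OF b]
  assume 0: "i 0 \<cdot> f \<boxplus> i 1 \<cdot> g = hzero (Dom C f) P"
  have "r 0 \<cdot> (i 0 \<cdot> f \<boxplus> i 1 \<cdot> g) = f"
    using b f g fg cmp_eq_cmp[OF b(16), of f] cmp_eq_cmp[OF b(18), of g] by (simp add: cmp_hadd del: One_nat_def)
  moreover have "r 1 \<cdot> (i 0 \<cdot> f \<boxplus> i 1 \<cdot> g) = g"
    using b f g fg cmp_eq_cmp[OF b(17), of g] cmp_eq_cmp[OF b(19), of f] by (simp add: cmp_hadd del: One_nat_def)
  ultimately show "f = hzero (Dom C f) (X 0) \<and> g = hzero (Dom C f) (X 1)"
    unfolding 0 using b(1-15) f fg by simp
next
  assume "f = hzero (Dom C f) (X 0) \<and> g = hzero (Dom C f) (X 1)"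
  moreover have "i 0 \<cdot> hzero (Dom C f) (X 0) \<boxplus> i 1 \<cdot> hzero (Dom C f) (X 1) = hzero (Dom C f) P"
    using is_biproduct_2D[OF b] f by simp
  ultimately show "i 0 \<cdot> f \<boxplus> i 1 \<cdot> g = hzero (Dom C f) P" by metis
qed

text \<open>The meet is the kernel of the arrow from \<open>X\<close> into the biproduct of the two
  quotients.\<close>

lemma Sub_meet_exists:
  assumes S: "S \<in> Subs X" and T: "T \<in> Subs X"
  obtains U where "U \<in> Subs X" "\<And>x. mem x U \<longleftrightarrow> mem x S \<and> mem x T"
proof -
  note s = quot_map_arrow[OF S] and t = quot_map_arrow[OF T]
  obtain P i r where b: "is_biproduct C 2 (pair_fun (quot_ob C S) (quot_ob C T)) P i r"
    using biproduct_exists s t by blast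
  note bD = is_biproduct_2D[OF b, simplified]
  define f where "f = i 0 \<cdot> quot_map C S \<boxplus> i 1 \<cdot> quot_map C T"
  have f: "arrow C f" "Dom C f = X" "Cod C f = P"
    using bD s t by (auto simp: f_def)
  have "mem x (ker_sub f) \<longleftrightarrow> mem x S \<and> mem x T" for x
  proof (cases "arrow C x \<and> Cod C x = X")
    case True
    have "f \<cdot> x = i 0 \<cdot> (quot_map C S \<cdot> x) \<boxplus> i 1 \<cdot> (quot_map C T \<cdot> x)"
      unfolding f_def using bD(1-15) s t True by (simp add: cmp_hadd)
    then show ?thesis
      unfolding mem_ker_sub[OF f(1)] mem_iff_quot_map[OF S] mem_iff_quot_map[OF T]
      using pair_zero_iff[OF b, of "quot_map C S \<cdot> x" "quot_map C T \<cdot> x"] s t f True by simp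
  next
    case False
    then show ?thesis using mem_arrow S T by (auto simp: mem_ker_sub[OF f(1)] f(2))
  qed
  then show thesis using that[of "ker_sub f"] ker_sub_closed[OF f(1)] f(2) by simp
qed

text \<open>The join is the image of the sum arrow on the biproduct of two representatives, which is
  why an element splits as a sum only after precomposition with an epimorphism.\<close>

lemma Sub_join_exists:
  assumes S: "S \<in> Subs X" and T: "T \<in> Subs X"
  obtains U where "U \<in> Subs X" "\<And>x. mem x U \<longleftrightarrow> arrow C x \<and> Cod C x = X \<and>
    (\<exists>p s t. epic C p \<and> Cod C p = Dom C x \<and> mem s S \<and> Dom C s = Dom C p \<and> mem t T \<and> Dom C t = Dom C p \<and>
      x \<cdot> p = s \<boxplus> t)"
proof -
  obtain m where m: "m \<in> S" "monic C m" "Cod C m = X" using Subs_rep[OF S] by metis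
  obtain n where n: "n \<in> T" "monic C n" "Cod C n = X" using Subs_rep[OF T] by metis
  obtain P i r where b: "is_biproduct C 2 (pair_fun (Dom C m) (Dom C n)) P i r"
    using biproduct_exists[of "Dom C m" "Dom C n"] m n by auto
  note bD = is_biproduct_2D[OF b, simplified]
  define f where "f = m \<cdot> r 0 \<boxplus> n \<cdot> r 1"
  have f: "arrow C f" "Dom C f = P" "Cod C f = X"
    using bD m n by (auto simp: f_def)
  have *: "(\<exists>u. arrow C u \<and> Dom C u = Dom C p \<and> Cod C u = Dom C f \<and> x \<cdot> p = f \<cdot> u) \<longleftrightarrow>
    (\<exists>s t. mem s S \<and> Dom C s = Dom C p \<and> mem t T \<and> Dom C t = Dom C p \<and> x \<cdot> p = s \<boxplus> t)"
    (is "?L \<longleftrightarrow> ?R") for x p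
  proof
    assume ?L
    then obtain u where u: "arrow C u" "Dom C u = Dom C p" "Cod C u = P" "x \<cdot> p = f \<cdot> u" using f by auto
    have "f \<cdot> u = m \<cdot> (r 0 \<cdot> u) \<boxplus> n \<cdot> (r 1 \<cdot> u)"
      unfolding f_def using u(1-3) bD(1-15) m n by (simp add: cmp_hadd)
    moreover have "mem (m \<cdot> (r 0 \<cdot> u)) S" "mem (n \<cdot> (r 1 \<cdot> u)) T"
      unfolding mem_rep[OF S m(1)] mem_rep[OF T n(1)] using u(1-3) bD(1-15) m n
      by (auto intro: exI[of _ "r 0 \<cdot> u"] exI[of _ "r (Suc 0) \<cdot> u"])
    moreover have "Dom C (m \<cdot> (r 0 \<cdot> u)) = Dom C p" "Dom C (n \<cdot> (r 1 \<cdot> u)) = Dom C p"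
      using u(1-3) bD(1-15) m n by auto
    ultimately show ?R using u(4) by metis
  next
    assume ?R
    then obtain u v where u: "arrow C u" "Dom C u = Dom C p" "Cod C u = Dom C m"
        and v: "arrow C v" "Dom C v = Dom C p" "Cod C v = Dom C n" and eq: "x \<cdot> p = m \<cdot> u \<boxplus> n \<cdot> v"
      unfolding mem_rep[OF S m(1)] mem_rep[OF T n(1)] by auto
    have w: "r 0 \<cdot> (i 0 \<cdot> u \<boxplus> i 1 \<cdot> v) = u" "r 1 \<cdot> (i 0 \<cdot> u \<boxplus> i 1 \<cdot> v) = v"
      using bD u v cmp_eq_cmp[OF bD(16), of u] cmp_eq_cmp[OF bD(17), of v] cmp_eq_cmp[OF bD(18), of v]
        cmp_eq_cmp[OF bD(19), of u] by (simp_all add: cmp_hadd)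
    have "f \<cdot> (i 0 \<cdot> u \<boxplus> i 1 \<cdot> v) = m \<cdot> (r 0 \<cdot> (i 0 \<cdot> u \<boxplus> i 1 \<cdot> v)) \<boxplus> n \<cdot> (r 1 \<cdot> (i 0 \<cdot> u \<boxplus> i 1 \<cdot> v))"
      unfolding f_def using bD(1-15) u v m n by (simp add: cmp_hadd_left)
    then have "x \<cdot> p = f \<cdot> (i 0 \<cdot> u \<boxplus> i 1 \<cdot> v)"
      unfolding w eq by simp
    then show ?L using bD(1-15) u v f by (intro exI[of _ "i 0 \<cdot> u \<boxplus> i 1 \<cdot> v"]) simp
  qed
  have "mem x (im_sub C f) \<longleftrightarrow> arrow C x \<and> Cod C x = X \<and>
    (\<exists>p s t. epic C p \<and> Cod C p = Dom C x \<and> mem s S \<and> Dom C s = Dom C p \<and> mem t T \<and> Dom C t = Dom C p \<and>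
      x \<cdot> p = s \<boxplus> t)" for x
    unfolding mem_im_sub[OF f(1)] f(3) using *[of _ x] by meson
  then show thesis using that[of "im_sub C f"] im_sub_closed[OF f(1)] f(3) by simp
qed

lemma mem_if_zero: "\<lbrakk>S \<in> Subs X; arrow C x; x = hzero (Dom C x) X\<rbrakk> \<Longrightarrow> mem x S"
  by (metis arrow_Ob(1) mem_zero)

lemma mem_sub_of_Idn: "X \<in> Ob C \<Longrightarrow> mem x (sub_of C (Idn C X)) \<longleftrightarrow> arrow C x \<and> Cod C x = X"
  by (auto simp: mem_sub_of intro!: exI[of _ x])

lemma Sub_partial_order: "partial_order (Sub C X)"
proof
  fix S T U assume S: "S \<in> Subs X" and T: "T \<in> Subs X" and U: "U \<in> Subs X"
  show "S \<sqsubseteq>\<^bsub>Sub C X\<^esub> S" using Sub_le_iff[OF S S] by blast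
  show "S .=\<^bsub>Sub C X\<^esub> T" if "S \<sqsubseteq>\<^bsub>Sub C X\<^esub> T" "T \<sqsubseteq>\<^bsub>Sub C X\<^esub> S"
    using that Sub_le_iff[OF S T] Sub_le_iff[OF T S] Sub_eqI[OF S T] by (auto simp: Sub_def)
  show "S \<sqsubseteq>\<^bsub>Sub C X\<^esub> U" if "S \<sqsubseteq>\<^bsub>Sub C X\<^esub> T" "T \<sqsubseteq>\<^bsub>Sub C X\<^esub> U"
    using that Sub_le_iff[OF S T] Sub_le_iff[OF T U] Sub_le_iff[OF S U] by blast
qed (auto simp: Sub_def)

lemma Sub_greatest_meet:
  assumes S: "S \<in> Subs X" and T: "T \<in> Subs X" and U: "U \<in> Subs X"
    and mem_U: "\<And>x. mem x U \<longleftrightarrow> mem x S \<and> mem x T"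
  shows "greatest (Sub C X) U (Lower (Sub C X) {S, T})"
  using Sub_le_iff[OF U S] Sub_le_iff[OF U T] mem_U S T U Sub_le_iff[OF _ S] Sub_le_iff[OF _ T] Sub_le_iff[OF _ U]
  by (auto simp: greatest_def Lower_def)

lemma Sub_least_join:
  assumes S: "S \<in> Subs X" and T: "T \<in> Subs X" and U: "U \<in> Subs X"
    and mem_U: "\<And>x. mem x U \<longleftrightarrow> arrow C x \<and> Cod C x = X \<and>
      (\<exists>p s t. epic C p \<and> Cod C p = Dom C x \<and> mem s S \<and> Dom C s = Dom C p \<and> mem t T \<and> Dom C t = Dom C p \<and>
        x \<cdot> p = s \<boxplus> t)"
  shows "least (Sub C X) U (Upper (Sub C X) {S, T})"
proof -
  have "S \<sqsubseteq>\<^bsub>Sub C X\<^esub> U"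
    unfolding Sub_le_iff[OF S U]
  proof (intro allI impI)
    fix x assume "mem x S"
    moreover from this have x: "arrow C x" "Cod C x = X" using mem_arrow S by auto
    ultimately have "epic C (Idn C (Dom C x)) \<and> Cod C (Idn C (Dom C x)) = Dom C x \<and> mem x S \<and>
        Dom C x = Dom C (Idn C (Dom C x)) \<and> mem (hzero (Dom C x) X) T \<and>
        Dom C (hzero (Dom C x) X) = Dom C (Idn C (Dom C x)) \<and>
        x \<cdot> Idn C (Dom C x) = x \<boxplus> hzero (Dom C x) X"
      using mem_zero[OF T, of "Dom C x"] Subs_Ob[OF S] by simp
    then show "mem x U"
      unfolding mem_U using x by blast
  qed
  moreover have "T \<sqsubseteq>\<^bsub>Sub C X\<^esub> U"
    unfolding Sub_le_iff[OF T U]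
  proof (intro allI impI)
    fix x assume "mem x T"
    moreover from this have x: "arrow C x" "Cod C x = X" using mem_arrow T by auto
    ultimately have "epic C (Idn C (Dom C x)) \<and> Cod C (Idn C (Dom C x)) = Dom C x \<and>
        mem (hzero (Dom C x) X) S \<and> Dom C (hzero (Dom C x) X) = Dom C (Idn C (Dom C x)) \<and>
        mem x T \<and> Dom C x = Dom C (Idn C (Dom C x)) \<and>
        x \<cdot> Idn C (Dom C x) = hzero (Dom C x) X \<boxplus> x"
      using mem_zero[OF S, of "Dom C x"] Subs_Ob[OF S] by simp
    then show "mem x U"
      unfolding mem_U using x by blast
  qed
  moreover have "U \<sqsubseteq>\<^bsub>Sub C X\<^esub> V" if V: "V \<in> Subs X" and "S \<sqsubseteq>\<^bsub>Sub C X\<^esub> V" "T \<sqsubseteq>\<^bsub>Sub C X\<^esub> V" for V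
  proof -
    have SV: "\<And>x. mem x S \<Longrightarrow> mem x V" and TV: "\<And>x. mem x T \<Longrightarrow> mem x V"
      using that Sub_le_iff[OF S V] Sub_le_iff[OF T V] by auto
    show ?thesis
      unfolding Sub_le_iff[OF U V] mem_U
    proof (intro allI impI, elim conjE exE)
      fix x p s t assume x: "arrow C x" "Cod C x = X" and p: "epic C p" "Cod C p = Dom C x"
        and st: "mem s S" "Dom C s = Dom C p" "mem t T" "Dom C t = Dom C p" "x \<cdot> p = s \<boxplus> t"
      have "mem (s \<boxplus> t) V" using SV TV st mem_add[OF V] by auto
      then show "mem x V" using mem_local[OF V x p] st(5) by simp
    qed
  qed
  ultimately show ?thesis
    using S T U by (auto simp: least_def Upper_def)
qed

lemma Sub_lattice: "lattice (Sub C X)"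
proof -
  interpret partial_order "Sub C X" by (rule Sub_partial_order)
  show ?thesis
  proof
    fix S T assume S: "S \<in> Subs X" and T: "T \<in> Subs X"
    show "\<exists>U. least (Sub C X) U (Upper (Sub C X) {S, T})"
    proof (rule Sub_join_exists[OF S T], goal_cases)
      case (1 U)
      then show ?case using Sub_least_join[OF S T 1] by blast
    qed
    show "\<exists>U. greatest (Sub C X) U (Lower (Sub C X) {S, T})"
    proof (rule Sub_meet_exists[OF S T], goal_cases)
      case (1 U)
      then show ?case using Sub_greatest_meet[OF S T 1] by blast
    qed
  qed
qed

lemma mem_meet:
  assumes S: "S \<in> Subs X" and T: "T \<in> Subs X"
  shows "mem x (S \<sqinter>\<^bsub>Sub C X\<^esub> T) \<longleftrightarrow> mem x S \<and> mem x T"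
proof -
  interpret lattice "Sub C X" by (rule Sub_lattice)
  obtain U where U: "U \<in> Subs X" "\<And>x. mem x U \<longleftrightarrow> mem x S \<and> mem x T"
    using Sub_meet_exists[OF S T] by blast
  have "U = S \<sqinter>\<^bsub>Sub C X\<^esub> T"
    by (rule meetI[where P = "\<lambda>V. U = V"]) (use greatest_unique[OF Sub_greatest_meet[OF S T U]] S T in blast)+
  then show ?thesis using U by simp
qed

lemma mem_join:
  assumes S: "S \<in> Subs X" and T: "T \<in> Subs X"
  shows "mem x (S \<squnion>\<^bsub>Sub C X\<^esub> T) \<longleftrightarrow> arrow C x \<and> Cod C x = X \<and>
    (\<exists>p s t. epic C p \<and> Cod C p = Dom C x \<and> mem s S \<and> Dom C s = Dom C p \<and> mem t T \<and> Dom C t = Dom C p \<and>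
      x \<cdot> p = s \<boxplus> t)"
proof -
  interpret lattice "Sub C X" by (rule Sub_lattice)
  obtain U where U: "U \<in> Subs X" "\<And>x. mem x U \<longleftrightarrow> arrow C x \<and> Cod C x = X \<and>
    (\<exists>p s t. epic C p \<and> Cod C p = Dom C x \<and> mem s S \<and> Dom C s = Dom C p \<and> mem t T \<and> Dom C t = Dom C p \<and>
      x \<cdot> p = s \<boxplus> t)"
    using Sub_join_exists[OF S T] by blast
  have "U = S \<squnion>\<^bsub>Sub C X\<^esub> T"
    by (rule joinI[where P = "\<lambda>V. U = V"]) (use least_unique[OF Sub_least_join[OF S T U]] S T in blast)+
  then show ?thesis using U by simp
qed

text \<open>Modularity is the usual argument with elements: if \<open>s + t\<close> lies in
  \<open>U\<close> and \<open>s\<close> lies in \<open>S \<le> U\<close>, then \<open>t\<close> lies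
  in \<open>U\<close>. The splitting exists after precomposition with an epimorphism, and
  \<open>mem_local\<close> removes that epimorphism again.\<close>

lemma Sub_bounded_modular_lattice:
  assumes X: "X \<in> Ob C"
  shows "bounded_modular_lattice (Sub C X)"
proof -
  interpret lattice "Sub C X" by (rule Sub_lattice)
  have bot: "ker_sub (Idn C X) \<in> Subs X" and top: "sub_of C (Idn C X) \<in> Subs X"
    using ker_sub_closed[of "Idn C X"] X by (auto simp: Subs_iff intro: exI[of _ "Idn C X"])
  have "least (Sub C X) (ker_sub (Idn C X)) (Subs X)"
    using bot X by (auto simp: least_def Sub_le_iff[OF bot] mem_ker_sub mem_if_zero)
  moreover have "greatest (Sub C X) (sub_of C (Idn C X)) (Subs X)"
    using top X mem_arrow by (auto simp: greatest_def Sub_le_iff[OF _ top] mem_sub_of_Idn)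
  moreover have "S \<squnion>\<^bsub>Sub C X\<^esub> (T \<sqinter>\<^bsub>Sub C X\<^esub> U) = (S \<squnion>\<^bsub>Sub C X\<^esub> T) \<sqinter>\<^bsub>Sub C X\<^esub> U"
    if S: "S \<in> Subs X" and T: "T \<in> Subs X" and U: "U \<in> Subs X" and SU: "S \<sqsubseteq>\<^bsub>Sub C X\<^esub> U" for S T U
  proof (rule Sub_eqI)
    have TU: "T \<sqinter>\<^bsub>Sub C X\<^esub> U \<in> Subs X" and ST: "S \<squnion>\<^bsub>Sub C X\<^esub> T \<in> Subs X" using S T U by auto
    show "S \<squnion>\<^bsub>Sub C X\<^esub> (T \<sqinter>\<^bsub>Sub C X\<^esub> U) \<in> Subs X" "(S \<squnion>\<^bsub>Sub C X\<^esub> T) \<sqinter>\<^bsub>Sub C X\<^esub> U \<in> Subs X"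
      using S T U by auto
    have su: "\<And>x. mem x S \<Longrightarrow> mem x U" using SU Sub_le_iff[OF S U] by blast
    fix x assume x: "arrow C x" "Cod C x = X"
    show "mem x (S \<squnion>\<^bsub>Sub C X\<^esub> (T \<sqinter>\<^bsub>Sub C X\<^esub> U)) \<longleftrightarrow> mem x ((S \<squnion>\<^bsub>Sub C X\<^esub> T) \<sqinter>\<^bsub>Sub C X\<^esub> U)"
      unfolding mem_join[OF S TU] mem_meet[OF ST U] mem_join[OF S T] mem_meet[OF T U]
    proof (intro iffI conjI; elim conjE exE)
      fix p s t assume p: "epic C p" "Cod C p = Dom C x" and st: "mem s S" "Dom C s = Dom C p" "mem t T"
        "mem t U" "Dom C t = Dom C p" "x \<cdot> p = s \<boxplus> t"
      show "\<exists>p s t. epic C p \<and> Cod C p = Dom C x \<and> mem s S \<and> Dom C s = Dom C p \<and> mem t T \<and> Dom C t = Dom C p \<and>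
          x \<cdot> p = s \<boxplus> t"
        using p st by blast
      have "mem (s \<boxplus> t) U" using st su mem_add[OF U] by simp
      then show "mem x U" using mem_local[OF U x p] st by simp
    next
      fix p s t assume p: "epic C p" "Cod C p = Dom C x" and st: "mem s S" "Dom C s = Dom C p" "mem t T"
        "Dom C t = Dom C p" "x \<cdot> p = s \<boxplus> t" and xU: "mem x U"
      have s: "arrow C s" "Cod C s = X" and t: "arrow C t" "Cod C t = X" using mem_arrow S T st by auto
      have "mem (x \<cdot> p) U" using mem_cmp[OF U xU] p by simp
      then have "mem (hneg s \<boxplus> x \<cdot> p) U"
        using mem_neg[OF U su[OF st(1)]] s st(2) x p by (intro mem_add[OF U]) auto
      moreover have "hneg s \<boxplus> (s \<boxplus> t) = (hneg s \<boxplus> s) \<boxplus> t"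
        using s t st by (intro hadd_assoc[symmetric]) auto
      ultimately have "mem t U" using st s t by simp
      then show "\<exists>p s t. epic C p \<and> Cod C p = Dom C x \<and> mem s S \<and> Dom C s = Dom C p \<and> (mem t T \<and> mem t U) \<and>
          Dom C t = Dom C p \<and> x \<cdot> p = s \<boxplus> t"
        using p st by blast
    qed (use x in auto)
  qed
  ultimately show ?thesis
    by unfold_locales blast+
qed

lemma mem_bottom:
  assumes X: "X \<in> Ob C"
  shows "mem x \<bottom>\<^bsub>Sub C X\<^esub> \<longleftrightarrow> arrow C x \<and> Cod C x = X \<and> x = hzero (Dom C x) X"
proof -
  interpret bounded_modular_lattice "Sub C X" by (rule Sub_bounded_modular_lattice[OF X])
  have bot: "ker_sub (Idn C X) \<in> Subs X"
    using ker_sub_closed[of "Idn C X"] X by simp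
  have "ker_sub (Idn C X) \<sqsubseteq>\<^bsub>Sub C X\<^esub> \<bottom>\<^bsub>Sub C X\<^esub>"
    using X mem_if_zero[OF bottom_closed] by (auto simp: Sub_le_iff[OF bot bottom_closed] mem_ker_sub)
  then have "\<bottom>\<^bsub>Sub C X\<^esub> = ker_sub (Idn C X)"
    using le_bottom_iff[OF bot] by simp
  then show ?thesis using X by (auto simp only: mem_ker_sub Idn_arrow cmp_Idn_left)
qed

lemma mem_top:
  assumes X: "X \<in> Ob C"
  shows "mem x \<top>\<^bsub>Sub C X\<^esub> \<longleftrightarrow> arrow C x \<and> Cod C x = X"
proof -
  interpret bounded_modular_lattice "Sub C X" by (rule Sub_bounded_modular_lattice[OF X])
  have top: "sub_of C (Idn C X) \<in> Subs X"
    using X by (auto simp: Subs_iff intro: exI[of _ "Idn C X"])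
  then have "sub_of C (Idn C X) \<sqsubseteq>\<^bsub>Sub C X\<^esub> \<top>\<^bsub>Sub C X\<^esub>" by simp
  then have "mem x \<top>\<^bsub>Sub C X\<^esub>" if "arrow C x" "Cod C x = X"
    using that X by (simp add: Sub_le_iff[OF top top_closed] mem_sub_of_Idn)
  then show ?thesis using mem_arrow[OF _ top_closed] by blast
qed

end

context abelian_category
begin

subsection \<open>Transfer of cubes along arrows\<close>

lemma direct_im_le_iff:
  assumes f: "arrow C f" and S: "S \<in> Subs (Dom C f)" and U: "U \<in> Subs (Cod C f)"
  shows "direct_im C f S \<sqsubseteq>\<^bsub>Sub C (Cod C f)\<^esub> U \<longleftrightarrow> S \<sqsubseteq>\<^bsub>Sub C (Dom C f)\<^esub> preim f U"
  unfolding Sub_le_iff[OF direct_im_closed[OF f S] U] Sub_le_iff[OF S preim_closed[OF f U]]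
proof (intro iffI allI impI)
  fix x assume *: "\<forall>x. mem x (direct_im C f S) \<longrightarrow> mem x U" and x: "mem x S"
  have "arrow C x" "Cod C x = Dom C f" using mem_arrow[OF x S] by auto
  moreover from this have "mem (f \<cdot> x) (direct_im C f S)"
    using f x unfolding mem_direct_im[OF f S]
    by (intro conjI exI[of _ "Idn C (Dom C x)"] exI[of _ x]) simp_all
  ultimately show "mem x (preim f U)" unfolding mem_preim[OF f U] using * by blast
next
  fix x assume *: "\<forall>x. mem x S \<longrightarrow> mem x (preim f U)" and "mem x (direct_im C f S)"
  then obtain p s where p: "arrow C x" "Cod C x = Cod C f" "epic C p" "Cod C p = Dom C x" "mem s S" "x \<cdot> p = f \<cdot> s"
    unfolding mem_direct_im[OF f S] by blast
  have "mem (f \<cdot> s) U" using * p(5) unfolding mem_preim[OF f U] by blast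
  then show "mem x U" using mem_local[OF U p(1-4)] p(6) by simp
qed

text \<open>Elements with the same image differ by an element killed by \<open>f\<close>, and
  \<open>S\<close> contains those.\<close>

lemma preim_direct_im:
  assumes f: "arrow C f" and S: "S \<in> Subs (Dom C f)"
    and ker: "\<And>x. \<lbrakk>arrow C x; Cod C x = Dom C f; f \<cdot> x = hzero (Dom C x) (Cod C f)\<rbrakk> \<Longrightarrow> mem x S"
  shows "preim f (direct_im C f S) = S"
proof (rule Sub_eqI[OF preim_closed[OF f direct_im_closed[OF f S]] S])
  note D = direct_im_closed[OF f S]
  fix x assume x: "arrow C x" "Cod C x = Dom C f"
  show "mem x (preim f (direct_im C f S)) \<longleftrightarrow> mem x S"
  proof
    assume "mem x (preim f (direct_im C f S))"
    then obtain p s where p: "epic C p" "Cod C p = Dom C x" "mem s S" "Dom C s = Dom C p" "(f \<cdot> x) \<cdot> p = f \<cdot> s"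
      unfolding mem_preim[OF f D] mem_direct_im[OF f S] using x f by auto
    have s: "arrow C s" "Cod C s = Dom C f" using mem_arrow[OF p(3) S] by auto
    have "f \<cdot> (x \<cdot> p) = f \<cdot> s" using p x f by simp
    then have "f \<cdot> (x \<cdot> p \<boxplus> hneg s) = hzero (Dom C p) (Cod C f)"
      using p(1,2,4) x s f by (simp add: cmp_hadd cmp_hneg)
    then have "mem (x \<cdot> p \<boxplus> hneg s) S"
      using p(1,2,4) x s f by (intro ker) simp_all
    then have "mem ((x \<cdot> p \<boxplus> hneg s) \<boxplus> s) S"
      using mem_add[OF S _ p(3)] p(1,2,4) x s by simp
    moreover have "(x \<cdot> p \<boxplus> hneg s) \<boxplus> s = x \<cdot> p \<boxplus> (hneg s \<boxplus> s)"
      using p(1,2,4) x s f by (intro hadd_assoc) simp_all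
    ultimately have "mem (x \<cdot> p) S" using p(1,2,4) x s by simp
    then show "mem x S" using mem_local[OF S x p(1,2)] by simp
  next
    assume "mem x S"
    then show "mem x (preim f (direct_im C f S))"
      unfolding mem_preim[OF f D] mem_direct_im[OF f S] using x f
      by (intro conjI exI[of _ "Idn C (Dom C x)"] exI[of _ x]) simp_all
  qed
qed

text \<open>As \<open>U\<close> lies in the image, its elements lift to the domain after
  precomposition with an epimorphism.\<close>

lemma direct_im_preim:
  assumes f: "arrow C f" and U: "U \<in> Subs (Cod C f)"
    and im: "\<And>y. mem y U \<Longrightarrow> mem y (im_sub C f)"
  shows "direct_im C f (preim f U) = U"
proof (rule Sub_eqI[OF direct_im_closed[OF f preim_closed[OF f U]] U])
  note D = preim_closed[OF f U]
  fix y assume y: "arrow C y" "Cod C y = Cod C f"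
  show "mem y (direct_im C f (preim f U)) \<longleftrightarrow> mem y U"
  proof
    assume "mem y (direct_im C f (preim f U))"
    then obtain p s where p: "epic C p" "Cod C p = Dom C y" "mem (f \<cdot> s) U" "y \<cdot> p = f \<cdot> s"
      unfolding mem_direct_im[OF f D] mem_preim[OF f U] by blast
    then show "mem y U" using mem_local[OF U y p(1,2)] by simp
  next
    assume yU: "mem y U"
    then obtain p u where p: "epic C p" "Cod C p = Dom C y" "arrow C u" "Dom C u = Dom C p" "Cod C u = Dom C f"
        "y \<cdot> p = f \<cdot> u"
      using im[OF yU] unfolding mem_im_sub[OF f] by blast
    have "mem (y \<cdot> p) U" using mem_cmp[OF U yU] p(1,2) by simp
    then have "mem u (preim f U)" unfolding mem_preim[OF f U] using p by simp
    then show "mem y (direct_im C f (preim f U))"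
      unfolding mem_direct_im[OF f D] using y p by blast
  qed
qed

text \<open>On subobjects containing the kernel, \<open>preim f\<close> undoes
  \<open>direct_im C f\<close>. Joins are respected by a left adjoint. For meets, the preimage of
  the meet of two images is the meet of the originals, and it maps back onto that meet.\<close>

lemma strict_cube_direct_im:
  assumes f: "arrow C f" and cube: "strict_cube (Sub C (Dom C f)) n c"
    and ker: "\<And>x S. \<lbrakk>S \<subseteq> {1..n}; arrow C x; Cod C x = Dom C f; f \<cdot> x = hzero (Dom C x) (Cod C f)\<rbrakk>
      \<Longrightarrow> mem x (c S)"
  shows "strict_cube (Sub C (Cod C f)) n (direct_im C f \<circ> c)"
proof -
  let ?L = "Sub C (Dom C f)" and ?M = "Sub C (Cod C f)"
  have L: "bounded_modular_lattice ?L" and M: "bounded_modular_lattice ?M"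
    using f by (auto intro: Sub_bounded_modular_lattice)
  interpret L: bounded_modular_lattice ?L by (rule L)
  interpret M: bounded_modular_lattice ?M by (rule M)
  note cl = L.strict_cube_closed[OF cube]
  have adj: "\<forall>S\<in>carrier ?L. \<forall>U\<in>carrier ?M. direct_im C f S \<sqsubseteq>\<^bsub>?M\<^esub> U \<longleftrightarrow> S \<sqsubseteq>\<^bsub>?L\<^esub> preim f U"
    using direct_im_le_iff[OF f] by blast
  have fg: "direct_im C f \<in> carrier ?L \<rightarrow> carrier ?M" "preim f \<in> carrier ?M \<rightarrow> carrier ?L"
    using direct_im_closed[OF f] preim_closed[OF f] by auto
  have gf: "preim f (direct_im C f (c S)) = c S" if "S \<subseteq> {1..n}" for S
    using preim_direct_im[OF f cl[OF that]] ker[OF that] by blast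
  show ?thesis
  proof (rule strict_cube_map[OF cube])
    fix S assume S: "S \<subseteq> {1..n}"
    show "direct_im C f (c S) \<in> carrier ?M" using fg cl[OF S] by auto
    fix T assume T: "T \<subseteq> {1..n}"
    show "c S = c T" if "direct_im C f (c S) = direct_im C f (c T)"
      using that gf[OF S] gf[OF T] by metis
    show "direct_im C f (c S \<squnion>\<^bsub>?L\<^esub> c T) = direct_im C f (c S) \<squnion>\<^bsub>?M\<^esub> direct_im C f (c T)"
      by (rule left_adjoint_join[where f = "direct_im C f" and g = "preim f", OF L M fg adj cl[OF S] cl[OF T]])
    note dS = direct_im_closed[OF f cl[OF S]] and dT = direct_im_closed[OF f cl[OF T]]
    have im: "direct_im C f (c S) \<sqinter>\<^bsub>?M\<^esub> direct_im C f (c T) \<in> carrier ?M"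
      using dS dT by simp
    have "direct_im C f (preim f (direct_im C f (c S) \<sqinter>\<^bsub>?M\<^esub> direct_im C f (c T))) =
        direct_im C f (c S) \<sqinter>\<^bsub>?M\<^esub> direct_im C f (c T)"
    proof (rule direct_im_preim[OF f im])
      fix y assume "mem y (direct_im C f (c S) \<sqinter>\<^bsub>?M\<^esub> direct_im C f (c T))"
      then have "mem y (direct_im C f (c S))"
        using mem_meet[OF dS dT] by blast
      then show "mem y (im_sub C f)"
        using mem_arrow[OF _ cl[OF S]] unfolding mem_direct_im[OF f cl[OF S]] mem_im_sub[OF f] by blast
    qed
    moreover have "preim f (direct_im C f (c S) \<sqinter>\<^bsub>?M\<^esub> direct_im C f (c T)) = c S \<sqinter>\<^bsub>?L\<^esub> c T"
      using right_adjoint_meet[where f = "direct_im C f" and g = "preim f", OF L M fg adj dS dT] gf[OF S] gf[OF T] by simp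
    ultimately show "direct_im C f (c S \<sqinter>\<^bsub>?L\<^esub> c T) = direct_im C f (c S) \<sqinter>\<^bsub>?M\<^esub> direct_im C f (c T)"
      by simp
  qed
qed

text \<open>The counterpart inside the image of \<open>f\<close>: meets are respected by a right
  adjoint, and joins because a join of preimages contains the kernel and is therefore recovered from
  its image.\<close>

lemma strict_cube_preim:
  assumes f: "arrow C f" and cube: "strict_cube (Sub C (Cod C f)) n c"
    and im: "\<And>y S. \<lbrakk>S \<subseteq> {1..n}; mem y (c S)\<rbrakk> \<Longrightarrow> mem y (im_sub C f)"
  shows "strict_cube (Sub C (Dom C f)) n (preim f \<circ> c)"
proof -
  let ?L = "Sub C (Dom C f)" and ?M = "Sub C (Cod C f)"
  have L: "bounded_modular_lattice ?L" and M: "bounded_modular_lattice ?M"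
    using f by (auto intro: Sub_bounded_modular_lattice)
  interpret L: bounded_modular_lattice ?L by (rule L)
  interpret M: bounded_modular_lattice ?M by (rule M)
  note cl = M.strict_cube_closed[OF cube]
  have adj: "\<forall>S\<in>carrier ?L. \<forall>U\<in>carrier ?M. direct_im C f S \<sqsubseteq>\<^bsub>?M\<^esub> U \<longleftrightarrow> S \<sqsubseteq>\<^bsub>?L\<^esub> preim f U"
    using direct_im_le_iff[OF f] by blast
  have fg: "direct_im C f \<in> carrier ?L \<rightarrow> carrier ?M" "preim f \<in> carrier ?M \<rightarrow> carrier ?L"
    using direct_im_closed[OF f] preim_closed[OF f] by auto
  have gf: "direct_im C f (preim f (c S)) = c S" if "S \<subseteq> {1..n}" for S
    using direct_im_preim[OF f cl[OF that]] im[OF that] by blast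
  show ?thesis
  proof (rule strict_cube_map[OF cube])
    fix S assume S: "S \<subseteq> {1..n}"
    show "preim f (c S) \<in> carrier ?L" using fg cl[OF S] by auto
    fix T assume T: "T \<subseteq> {1..n}"
    show "c S = c T" if "preim f (c S) = preim f (c T)"
      using that gf[OF S] gf[OF T] by metis
    show "preim f (c S \<sqinter>\<^bsub>?M\<^esub> c T) = preim f (c S) \<sqinter>\<^bsub>?L\<^esub> preim f (c T)"
      by (rule right_adjoint_meet[where f = "direct_im C f" and g = "preim f", OF L M fg adj cl[OF S] cl[OF T]])
    have pS: "preim f (c S) \<in> carrier ?L" and pT: "preim f (c T) \<in> carrier ?L"
      using fg cl[OF S] cl[OF T] by auto
    have "preim f (direct_im C f (preim f (c S) \<squnion>\<^bsub>?L\<^esub> preim f (c T))) = preim f (c S) \<squnion>\<^bsub>?L\<^esub> preim f (c T)"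
    proof (rule preim_direct_im[OF f])
      fix x assume x: "arrow C x" "Cod C x = Dom C f" "f \<cdot> x = hzero (Dom C x) (Cod C f)"
      then have "mem x (preim f (c S))"
        unfolding mem_preim[OF f cl[OF S]] using mem_zero[OF cl[OF S]] by simp
      then show "mem x (preim f (c S) \<squnion>\<^bsub>?L\<^esub> preim f (c T))"
        using Sub_le_iff[OF pS L.join_closed[OF pS pT]] L.join_left[OF pS pT] by blast
    qed (use pS pT in auto)
    moreover have "direct_im C f (preim f (c S) \<squnion>\<^bsub>?L\<^esub> preim f (c T)) = c S \<squnion>\<^bsub>?M\<^esub> c T"
      using left_adjoint_join[where f = "direct_im C f" and g = "preim f", OF L M fg adj pS pT] gf[OF S] gf[OF T] by simp
    ultimately show "preim f (c S \<squnion>\<^bsub>?M\<^esub> c T) = preim f (c S) \<squnion>\<^bsub>?L\<^esub> preim f (c T)"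
      by simp
  qed
qed

section \<open>Squares and graphs\<close>

lemma pow_data_biproduct:
  assumes "is_biproduct C n (\<lambda>_. X) P inc prj"
  shows "is_biproduct C n (\<lambda>_. X) (pow_ob C X n) (pow_inj C X n) (pow_prj C X n)"
proof -
  have "case pow_data C X n of (P, inc, prj) \<Rightarrow> is_biproduct C n (\<lambda>_. X) P inc prj"
    unfolding pow_data_def by (rule someI[of _ "(P, inc, prj)"]) (use assms in simp)
  then show ?thesis
    by (simp add: pow_ob_def pow_inj_def pow_prj_def split: prod.splits)
qed

lemma pow2_biproduct:
  assumes "X \<in> Ob C"
  shows "is_biproduct C 2 (\<lambda>_. X) (pow_ob C X 2) (pow_inj C X 2) (pow_prj C X 2)"
proof -
  obtain P i r where "is_biproduct C 2 (pair_fun X X) P i r" using biproduct_exists[OF assms assms] by blast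
  then show ?thesis using pow_data_biproduct[of 2 X P i r] by simp
qed

lemmas pow2D = is_biproduct_2D[OF pow2_biproduct]

text \<open>\<open>pow_ob C X 1\<close> is a chosen object, not \<open>X\<close> itself. Injection
  and projection are mutually inverse isomorphisms, through which sort 1 of a directory is compared
  with \<open>X\<close>.\<close>

lemma pow1D:
  assumes X: "X \<in> Ob C"
  shows "pow_ob C X 1 \<in> Ob C" "arrow C (pow_inj C X 1 0)" "arrow C (pow_prj C X 1 0)"
    "Dom C (pow_inj C X 1 0) = X" "Cod C (pow_inj C X 1 0) = pow_ob C X 1"
    "Dom C (pow_prj C X 1 0) = pow_ob C X 1" "Cod C (pow_prj C X 1 0) = X"
    "pow_prj C X 1 0 \<cdot> pow_inj C X 1 0 = Idn C X"
    "pow_inj C X 1 0 \<cdot> pow_prj C X 1 0 = Idn C (pow_ob C X 1)"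
proof -
  have "finsum (Hom C X X) (\<lambda>i. Idn C X \<cdot> Idn C X) {..<1::nat} = Idn C X"
    using finsum_1[of X X "\<lambda>i. Idn C X \<cdot> Idn C X"] X Idn_closed[OF X] by simp
  then have "is_biproduct C 1 (\<lambda>_. X) X (\<lambda>_. Idn C X) (\<lambda>_. Idn C X)"
    using X Idn_closed[OF X] by (simp add: is_biproduct_def)
  then have b: "is_biproduct C 1 (\<lambda>_. X) (pow_ob C X 1) (pow_inj C X 1) (pow_prj C X 1)"
    by (rule pow_data_biproduct)
  then show ob: "pow_ob C X 1 \<in> Ob C" by (simp add: is_biproduct_def)
  show ar: "arrow C (pow_inj C X 1 0)" "arrow C (pow_prj C X 1 0)"
    "Dom C (pow_inj C X 1 0) = X" "Cod C (pow_inj C X 1 0) = pow_ob C X 1"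
    "Dom C (pow_prj C X 1 0) = pow_ob C X 1" "Cod C (pow_prj C X 1 0) = X"
    using b X ob by (auto simp: is_biproduct_def hom_iff)
  show "pow_prj C X 1 0 \<cdot> pow_inj C X 1 0 = Idn C X"
    using b by (simp add: is_biproduct_def)
  have "finsum (Hom C (pow_ob C X 1) (pow_ob C X 1)) (\<lambda>i. pow_inj C X 1 i \<cdot> pow_prj C X 1 i) {..<1} =
      Idn C (pow_ob C X 1)"
    using b by (simp only: is_biproduct_def)
  then show "pow_inj C X 1 0 \<cdot> pow_prj C X 1 0 = Idn C (pow_ob C X 1)"
    using finsum_1[of "pow_ob C X 1" "pow_ob C X 1" "\<lambda>i. pow_inj C X 1 i \<cdot> pow_prj C X 1 i"] ob ar
    by (simp add: hom_iff del: One_nat_def)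
qed

section \<open>Arrows into a square, by coordinates\<close>

definition pair :: "'b \<Rightarrow> 'c \<Rightarrow> 'c \<Rightarrow> 'c" where
  "pair X f g = pow_inj C X 2 0 \<cdot> f \<boxplus> pow_inj C X 2 1 \<cdot> g"

abbreviation "fst_arr X \<equiv> pow_prj C X 2 0"
abbreviation "snd_arr X \<equiv> pow_prj C X 2 (Suc 0)"
abbreviation "sq_ob X \<equiv> pow_ob C X 2"

lemma prj_arrow [simp]:
  assumes "X \<in> Ob C"
  shows "sq_ob X \<in> Ob C" "arrow C (fst_arr X)" "arrow C (snd_arr X)" "Dom C (fst_arr X) = sq_ob X"
    "Dom C (snd_arr X) = sq_ob X" "Cod C (fst_arr X) = X" "Cod C (snd_arr X) = X"
  using pow2D[OF assms] by simp_all

context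
  fixes X f g
  assumes f: "arrow C f" "Cod C f = X" and g: "arrow C g" "Cod C g = X" and fg: "Dom C g = Dom C f"
begin

lemma pair_arrow [simp]: "arrow C (pair X f g)" "Dom C (pair X f g) = Dom C f" "Cod C (pair X f g) = sq_ob X"
  using pow2D[of X] f g fg by (auto simp: pair_def)

lemma prj_pair [simp]: "fst_arr X \<cdot> pair X f g = f" "snd_arr X \<cdot> pair X f g = g"
proof -
  have X: "X \<in> Ob C" using f by auto
  note b = pow2D[OF X]
  show "fst_arr X \<cdot> pair X f g = f" "snd_arr X \<cdot> pair X f g = g"
    using b(1-15) f g fg cmp_eq_cmp[OF b(16), of f] cmp_eq_cmp[OF b(18), of g]
      cmp_eq_cmp[OF b(17), of g] cmp_eq_cmp[OF b(19), of f]
    by (simp_all add: pair_def cmp_hadd)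
qed

lemma pair_cmp: "\<lbrakk>arrow C u; Cod C u = Dom C f\<rbrakk> \<Longrightarrow> pair X f g \<cdot> u = pair X (f \<cdot> u) (g \<cdot> u)"
proof -
  assume u: "arrow C u" "Cod C u = Dom C f"
  have X: "X \<in> Ob C" using f by auto
  show ?thesis
    unfolding pair_def using pow2D(1-15)[OF X] f g fg u by (simp add: cmp_hadd)
qed

end

lemma pair_prj:
  assumes X: "X \<in> Ob C" and y: "arrow C y" "Cod C y = sq_ob X"
  shows "pair X (fst_arr X \<cdot> y) (snd_arr X \<cdot> y) = y"
proof -
  note b = pow2D[OF X]
  have "(pow_inj C X 2 0 \<cdot> fst_arr X \<boxplus> pow_inj C X 2 1 \<cdot> snd_arr X) \<cdot> y = y"
    using b(20) y by simp
  then show ?thesis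
    using b(1-15) y by (simp add: pair_def cmp_hadd_left)
qed

lemma pair_eq_iff:
  assumes "X \<in> Ob C" "arrow C y" "Cod C y = sq_ob X" "arrow C z" "Cod C z = sq_ob X"
  shows "y = z \<longleftrightarrow> fst_arr X \<cdot> y = fst_arr X \<cdot> z \<and> snd_arr X \<cdot> y = snd_arr X \<cdot> z"
  using pair_prj[OF assms(1-3)] pair_prj[OF assms(1,4,5)] by metis

text \<open>Lying on a graph is an equation between coordinates, so it descends along the
  epimorphism over which an element of the image lifts.\<close>

lemma mem_endo_graph:
  assumes X: "X \<in> Ob C" and a: "arrow C a" "Dom C a = X" "Cod C a = X"
  shows "endo_graph C X a \<in> Subs (sq_ob X)"
    and "mem y (endo_graph C X a) \<longleftrightarrow>
      arrow C y \<and> Cod C y = sq_ob X \<and> snd_arr X \<cdot> y = a \<cdot> fst_arr X \<cdot> y"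
proof -
  have f: "pow_inj C X 2 0 \<oplus>\<^bsub>Hom C X (pow_ob C X 2)\<^esub> (pow_inj C X 2 1 \<cdot> a) = pair X (Idn C X) a"
    using pow2D[OF X] a by (simp add: pair_def hadd_def)
  have fa: "arrow C (pair X (Idn C X) a)" "Dom C (pair X (Idn C X) a) = X" "Cod C (pair X (Idn C X) a) = sq_ob X"
    using X a by simp_all
  show "endo_graph C X a \<in> Subs (sq_ob X)"
    unfolding endo_graph_def f using im_sub_closed[OF fa(1)] fa by simp
  show "mem y (endo_graph C X a) \<longleftrightarrow>
      arrow C y \<and> Cod C y = sq_ob X \<and> snd_arr X \<cdot> y = a \<cdot> fst_arr X \<cdot> y"
    unfolding endo_graph_def f mem_im_sub[OF fa(1)] fa
  proof (intro iffI; elim conjE exE)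
    fix p u assume y: "arrow C y" "Cod C y = sq_ob X" and p: "epic C p" "Cod C p = Dom C y"
      and u: "arrow C u" "Dom C u = Dom C p" "Cod C u = X" and eq: "y \<cdot> p = pair X (Idn C X) a \<cdot> u"
    have yp: "y \<cdot> p = pair X u (a \<cdot> u)"
      unfolding eq using X a u by (simp add: pair_cmp)
    have "fst_arr X \<cdot> (y \<cdot> p) = u" "snd_arr X \<cdot> (y \<cdot> p) = a \<cdot> u"
      unfolding yp using X a u by simp_all
    then have "(snd_arr X \<cdot> y) \<cdot> p = (a \<cdot> fst_arr X \<cdot> y) \<cdot> p"
      using X a y p(1,2) by simp
    then have "snd_arr X \<cdot> y = a \<cdot> fst_arr X \<cdot> y"
      by (rule epicD[OF p(1), rotated -1]) (use X a y p(2) in simp_all)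
    then show "arrow C y \<and> Cod C y = sq_ob X \<and> snd_arr X \<cdot> y = a \<cdot> fst_arr X \<cdot> y"
      using y by simp
  next
    assume y: "arrow C y" "Cod C y = sq_ob X" "snd_arr X \<cdot> y = a \<cdot> fst_arr X \<cdot> y"
    have "y \<cdot> Idn C (Dom C y) = pair X (Idn C X) a \<cdot> (fst_arr X \<cdot> y)"
      using pair_prj[OF X y(1,2)] X a y by (simp add: pair_cmp)
    then show "arrow C y \<and> Cod C y = sq_ob X \<and> (\<exists>p u. epic C p \<and> Cod C p = Dom C y \<and> arrow C u \<and>
        Dom C u = Dom C p \<and> Cod C u = X \<and> y \<cdot> p = pair X (Idn C X) a \<cdot> u)"
      using X y(1,2) by (intro conjI exI[of _ "Idn C (Dom C y)"] exI[of _ "fst_arr X \<cdot> y"]) simp_all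
  qed
qed

text \<open>Direct sums and powers of subobjects are unions over all representatives. Members with
  the same elements coincide, so such a union equals each of its members.\<close>

lemma Union_constant_image:
  assumes "\<And>Z. Z \<in> \<A> \<Longrightarrow> Z \<in> Subs X \<and> (\<forall>y. mem y Z \<longleftrightarrow> Q y)" "\<A> \<noteq> {}"
  shows "\<Union>\<A> \<in> Subs X \<and> (\<forall>y. mem y (\<Union>\<A>) \<longleftrightarrow> Q y)"
proof -
  obtain Z where Z: "Z \<in> \<A>" using assms(2) by blast
  have "W = Z" if "W \<in> \<A>" for W
    using assms(1)[OF that] assms(1)[OF Z] Sub_eqI[of W X Z] by blast
  then have "\<Union>\<A> = Z" using Z by blast
  then show ?thesis using assms(1)[OF Z] by simp
qed

text \<open>The two summands are subobjects of \<open>pow_ob C X 1\<close>, so the coordinates of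
  \<open>y\<close> in \<open>X\<close> are carried there by \<open>pow_inj C X 1 0\<close>.\<close>

lemma
  assumes X: "X \<in> Ob C" and S: "S \<in> Subs (pow_ob C X 1)" and T: "T \<in> Subs (pow_ob C X 1)"
  shows sub_oplus_closed: "sub_oplus C X 1 1 S T \<in> Subs (sq_ob X)"
    and mem_sub_oplus: "mem y (sub_oplus C X 1 1 S T) \<longleftrightarrow> arrow C y \<and> Cod C y = sq_ob X \<and>
      mem (pow_inj C X 1 0 \<cdot> fst_arr X \<cdot> y) S \<and> mem (pow_inj C X 1 0 \<cdot> snd_arr X \<cdot> y) T"
proof -
  define j where "j = pow_prj C X 1 0"
  define k where "k = pow_inj C X 1 0"
  note jk = pow1D[OF X, folded j_def k_def]
  note b2 = pow2D[OF X]
  have left: "pow_left C X 1 1 = pow_inj C X 2 0 \<cdot> j"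
    unfolding pow_left_def one_add_one j_def
    using finsum_1[of "pow_ob C X 1" "sq_ob X" "\<lambda>i. pow_inj C X 2 i \<cdot> pow_prj C X 1 i"] jk(1-7) b2(1-15)
    by (simp add: hom_iff j_def del: One_nat_def)
  have right: "pow_right C X 1 1 = pow_inj C X 2 1 \<cdot> j"
    unfolding pow_right_def one_add_one j_def
    using finsum_1[of "pow_ob C X 1" "sq_ob X" "\<lambda>i. pow_inj C X 2 (1 + i) \<cdot> pow_prj C X 1 i"] jk(1-7) b2(1-15)
    by (simp add: hom_iff j_def del: One_nat_def)
  let ?Q = "\<lambda>y. arrow C y \<and> Cod C y = sq_ob X \<and> mem (k \<cdot> fst_arr X \<cdot> y) S \<and> mem (k \<cdot> snd_arr X \<cdot> y) T"
  have main: "im_sub C f \<in> Subs (sq_ob X) \<and> (\<forall>y. mem y (im_sub C f) \<longleftrightarrow> ?Q y)"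
    if s: "s \<in> S" and t: "t \<in> T" and b: "is_biproduct C 2 (pair_fun (Dom C s) (Dom C t)) P i r"
      and f_def: "f = (pow_left C X 1 1 \<cdot> s \<cdot> r 0) \<oplus>\<^bsub>Hom C P (pow_ob C X (1 + 1))\<^esub> (pow_right C X 1 1 \<cdot> t \<cdot> r 1)"
    for s t P i r f
  proof -
    note bD = is_biproduct_2D[OF b, simplified]
    note sD = Subs_monic(1,2)[OF S s] and tD = Subs_monic(1,2)[OF T t]
    have ar: "arrow C (j \<cdot> s \<cdot> r 0)" "Dom C (j \<cdot> s \<cdot> r 0) = P" "Cod C (j \<cdot> s \<cdot> r 0) = X"
      "arrow C (j \<cdot> t \<cdot> r 1)" "Dom C (j \<cdot> t \<cdot> r 1) = P" "Cod C (j \<cdot> t \<cdot> r 1) = X"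
      using bD(1-15) sD tD jk(1-7) by simp_all
    have f: "f = pair X (j \<cdot> s \<cdot> r 0) (j \<cdot> t \<cdot> r 1)"
      unfolding f_def left right pair_def one_add_one
      using bD(1-15) sD tD jk(1-7) b2(1-15) by (simp add: hadd_def)
    have fa: "arrow C f" "Dom C f = P" "Cod C f = sq_ob X" unfolding f using ar by simp_all
    have "mem y (im_sub C f) \<longleftrightarrow> ?Q y" for y
    proof
      assume "mem y (im_sub C f)"
      then obtain p u where y: "arrow C y" "Cod C y = sq_ob X" and p: "epic C p" "Cod C p = Dom C y"
          and u: "arrow C u" "Dom C u = Dom C p" "Cod C u = P" and eq: "y \<cdot> p = f \<cdot> u"
        unfolding mem_im_sub[OF fa(1)] fa by blast
      have yp: "y \<cdot> p = pair X (j \<cdot> s \<cdot> r 0 \<cdot> u) (j \<cdot> t \<cdot> r 1 \<cdot> u)"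
        unfolding eq f using ar u bD(1-15) sD tD jk(1-7) by (simp add: pair_cmp)
      have a1: "fst_arr X \<cdot> y \<cdot> p = j \<cdot> s \<cdot> r 0 \<cdot> u" and a2: "snd_arr X \<cdot> y \<cdot> p = j \<cdot> t \<cdot> r 1 \<cdot> u"
        unfolding yp using u bD(1-15) sD tD jk(1-7) by simp_all
      have e1: "(k \<cdot> fst_arr X \<cdot> y) \<cdot> p = s \<cdot> r 0 \<cdot> u"
      proof -
        have "(k \<cdot> fst_arr X \<cdot> y) \<cdot> p = k \<cdot> (fst_arr X \<cdot> y \<cdot> p)" using jk(1-7) y p X by simp
        also have "\<dots> = s \<cdot> r 0 \<cdot> u"
          unfolding a1 using cmp_eq_cmp[OF jk(9), of "s \<cdot> r 0 \<cdot> u"] u bD(1-15) sD jk(1-7) by simp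
        finally show ?thesis .
      qed
      have e2: "(k \<cdot> snd_arr X \<cdot> y) \<cdot> p = t \<cdot> r 1 \<cdot> u"
      proof -
        have "(k \<cdot> snd_arr X \<cdot> y) \<cdot> p = k \<cdot> (snd_arr X \<cdot> y \<cdot> p)" using jk(1-7) y p X by simp
        also have "\<dots> = t \<cdot> r 1 \<cdot> u"
          unfolding a2 using cmp_eq_cmp[OF jk(9), of "t \<cdot> r 1 \<cdot> u"] u bD(1-15) tD jk(1-7) by simp
        finally show ?thesis .
      qed
      have "mem (s \<cdot> r 0 \<cdot> u) S" "mem (t \<cdot> r 1 \<cdot> u) T"
        using mem_cmp[OF S mem_self[OF S s], of "r 0 \<cdot> u"] mem_cmp[OF T mem_self[OF T t], of "r 1 \<cdot> u"]
          u bD(1-15) sD tD by simp_all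
      then have "mem (k \<cdot> fst_arr X \<cdot> y) S" "mem (k \<cdot> snd_arr X \<cdot> y) T"
        using mem_local[OF S _ _ p(1), of "k \<cdot> fst_arr X \<cdot> y"] mem_local[OF T _ _ p(1), of "k \<cdot> snd_arr X \<cdot> y"]
          e1 e2 y p jk(1-7) X by simp_all
      then show "?Q y" using y by blast
    next
      assume Q: "?Q y"
      then have y: "arrow C y" "Cod C y = sq_ob X" by auto
      obtain a where a: "arrow C a" "Dom C a = Dom C y" "Cod C a = Dom C s" "k \<cdot> fst_arr X \<cdot> y = s \<cdot> a"
        using Q y X jk(1-7) unfolding mem_rep[OF S s] by auto
      obtain c where c: "arrow C c" "Dom C c = Dom C y" "Cod C c = Dom C t" "k \<cdot> snd_arr X \<cdot> y = t \<cdot> c"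
        using Q y X jk(1-7) unfolding mem_rep[OF T t] by auto
      define u where "u = i 0 \<cdot> a \<boxplus> i 1 \<cdot> c"
      have u: "arrow C u" "Dom C u = Dom C y" "Cod C u = P"
        using bD(1-15) a(1-3) c(1-3) by (simp_all add: u_def)
      have ru: "r 0 \<cdot> u = a" "r 1 \<cdot> u = c"
        using bD a(1-3) c(1-3) cmp_eq_cmp[OF bD(16), of a] cmp_eq_cmp[OF bD(17), of c]
          cmp_eq_cmp[OF bD(18), of c] cmp_eq_cmp[OF bD(19), of a] by (simp_all add: u_def cmp_hadd)
      have "f \<cdot> u = pair X (j \<cdot> s \<cdot> r 0 \<cdot> u) (j \<cdot> t \<cdot> r 1 \<cdot> u)"
        unfolding f using ar u bD(1-15) sD tD jk(1-7) by (simp add: pair_cmp)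
      also have "\<dots> = pair X (j \<cdot> k \<cdot> fst_arr X \<cdot> y) (j \<cdot> k \<cdot> snd_arr X \<cdot> y)"
        unfolding ru a(4) c(4) ..
      also have "\<dots> = y"
        using cmp_eq_cmp[OF jk(8), of "fst_arr X \<cdot> y"] cmp_eq_cmp[OF jk(8), of "snd_arr X \<cdot> y"] y X jk(1-7)
          pair_prj[OF X y] by simp
      finally have "y \<cdot> Idn C (Dom C y) = f \<cdot> u" using y by simp
      then show "mem y (im_sub C f)"
        unfolding mem_im_sub[OF fa(1)] fa using y u
        by (intro conjI exI[of _ "Idn C (Dom C y)"] exI[of _ u]) simp_all
    qed
    then show ?thesis using im_sub_closed[OF fa(1)] fa by simp
  qed
  obtain s t where st: "s \<in> S" "t \<in> T" using Subs_rep[OF S] Subs_rep[OF T] by metis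
  moreover have "Dom C s \<in> Ob C" "Dom C t \<in> Ob C"
    using Subs_monic(1)[OF S st(1)] Subs_monic(1)[OF T st(2)] by auto
  then obtain P i r where "is_biproduct C 2 (pair_fun (Dom C s) (Dom C t)) P i r"
    using biproduct_exists by blast
  ultimately have "sub_oplus C X 1 1 S T \<in> Subs (sq_ob X) \<and>
      (\<forall>y. mem y (sub_oplus C X 1 1 S T) \<longleftrightarrow> ?Q y)"
    unfolding sub_oplus_def using main by (intro Union_constant_image) blast+
  then show "sub_oplus C X 1 1 S T \<in> Subs (sq_ob X)"
    "mem y (sub_oplus C X 1 1 S T) \<longleftrightarrow> arrow C y \<and> Cod C y = sq_ob X \<and>
      mem (pow_inj C X 1 0 \<cdot> fst_arr X \<cdot> y) S \<and> mem (pow_inj C X 1 0 \<cdot> snd_arr X \<cdot> y) T"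
    unfolding k_def by blast+
qed

text \<open>The summand \<open>X \<oplus> 0\<close>, expressed by operations that can be followed
  through the flattening: a directory morphism commutes with \<open>oplus\<close>, and a flattening
  map preserves top and bottom.\<close>

definition fst_sub :: "'b \<Rightarrow> 'c set" where
  "fst_sub X = sub_oplus C X 1 1 \<top>\<^bsub>Sub C (pow_ob C X 1)\<^esub> \<bottom>\<^bsub>Sub C (pow_ob C X 1)\<^esub>"

definition snd_sub :: "'b \<Rightarrow> 'c set" where
  "snd_sub X = sub_oplus C X 1 1 \<bottom>\<^bsub>Sub C (pow_ob C X 1)\<^esub> \<top>\<^bsub>Sub C (pow_ob C X 1)\<^esub>"

lemma
  assumes X: "X \<in> Ob C"
  shows fst_sub_closed: "fst_sub X \<in> Subs (sq_ob X)"
    and snd_sub_closed: "snd_sub X \<in> Subs (sq_ob X)"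
    and mem_fst_sub: "mem y (fst_sub X) \<longleftrightarrow>
      arrow C y \<and> Cod C y = sq_ob X \<and> snd_arr X \<cdot> y = hzero (Dom C y) X"
    and mem_snd_sub: "mem y (snd_sub X) \<longleftrightarrow>
      arrow C y \<and> Cod C y = sq_ob X \<and> fst_arr X \<cdot> y = hzero (Dom C y) X"
proof -
  note p1 = pow1D[OF X]
  interpret bounded_modular_lattice "Sub C (pow_ob C X 1)"
    by (rule Sub_bounded_modular_lattice[OF p1(1)])
  show "fst_sub X \<in> Subs (sq_ob X)" "snd_sub X \<in> Subs (sq_ob X)"
    unfolding fst_sub_def snd_sub_def
    by (rule sub_oplus_closed[OF X top_closed bottom_closed] sub_oplus_closed[OF X bottom_closed top_closed])+
  have z: "pow_inj C X 1 0 \<cdot> z = hzero (Dom C z) (pow_ob C X 1) \<longleftrightarrow> z = hzero (Dom C z) X"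
    if "arrow C z" "Cod C z = X" for z
  proof
    assume "pow_inj C X 1 0 \<cdot> z = hzero (Dom C z) (pow_ob C X 1)"
    then have "pow_prj C X 1 0 \<cdot> pow_inj C X 1 0 \<cdot> z = hzero (Dom C z) X"
      using p1(1-7) that by simp
    then show "z = hzero (Dom C z) X"
      using cmp_eq_cmp[OF p1(8), of z] p1(1-7) that by simp
  next
    assume "z = hzero (Dom C z) X"
    then show "pow_inj C X 1 0 \<cdot> z = hzero (Dom C z) (pow_ob C X 1)"
      using p1(1-7) that by (metis arrow_Ob(1) cmp_zero_right)
  qed
  show "mem y (fst_sub X) \<longleftrightarrow>
      arrow C y \<and> Cod C y = sq_ob X \<and> snd_arr X \<cdot> y = hzero (Dom C y) X"
    unfolding fst_sub_def mem_sub_oplus[OF X top_closed bottom_closed] mem_bottom[OF p1(1)] mem_top[OF p1(1)]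
    using z[of "snd_arr X \<cdot> y"] p1(1-7) X by auto
  show "mem y (snd_sub X) \<longleftrightarrow>
      arrow C y \<and> Cod C y = sq_ob X \<and> fst_arr X \<cdot> y = hzero (Dom C y) X"
    unfolding snd_sub_def mem_sub_oplus[OF X bottom_closed top_closed] mem_bottom[OF p1(1)] mem_top[OF p1(1)]
    using z[of "fst_arr X \<cdot> y"] p1(1-7) X by auto
qed

lemma pow_arr_2:
  assumes f: "arrow C f"
  shows "pow_arr C 2 f = pair (Cod C f) (f \<cdot> fst_arr (Dom C f)) (f \<cdot> snd_arr (Dom C f))"
proof -
  note X = pow2D[OF arrow_Ob(1)[OF f]] and Y = pow2D[OF arrow_Ob(2)[OF f]]
  show ?thesis
    unfolding pow_arr_def pair_def
    using finsum_2[of "sq_ob (Dom C f)" "sq_ob (Cod C f)"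
        "\<lambda>i. pow_inj C (Cod C f) 2 i \<cdot> f \<cdot> pow_prj C (Dom C f) 2 i"] X(1-15) Y(1-15) f
    by (simp add: hom_iff)
qed

lemma pow_arr_2_cmp:
  assumes f: "arrow C f" and u: "arrow C u" "Cod C u = sq_ob (Dom C f)"
  shows "pow_arr C 2 f \<cdot> u = pair (Cod C f) (f \<cdot> fst_arr (Dom C f) \<cdot> u) (f \<cdot> snd_arr (Dom C f) \<cdot> u)"
  unfolding pow_arr_2[OF f] using f u by (simp add: pair_cmp)

lemma pow_arr_2_arrow:
  assumes f: "arrow C f"
  shows "arrow C (pow_arr C 2 f)" "Dom C (pow_arr C 2 f) = sq_ob (Dom C f)" "Cod C (pow_arr C 2 f) = sq_ob (Cod C f)"
  unfolding pow_arr_2[OF f] using f by simp_all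

lemma
  assumes A: "A \<in> Subs X"
  shows pow_sub_2_closed: "pow_sub C 2 A \<in> Subs (sq_ob X)"
    and mem_pow_sub_2: "mem y (pow_sub C 2 A) \<longleftrightarrow>
      arrow C y \<and> Cod C y = sq_ob X \<and> mem (fst_arr X \<cdot> y) A \<and> mem (snd_arr X \<cdot> y) A"
proof -
  let ?Q = "\<lambda>y. arrow C y \<and> Cod C y = sq_ob X \<and> mem (fst_arr X \<cdot> y) A \<and> mem (snd_arr X \<cdot> y) A"
  have X: "X \<in> Ob C" using Subs_Ob[OF A] .
  have main: "im_sub C (pow_arr C 2 m) \<in> Subs (sq_ob X) \<and> (\<forall>y. mem y (im_sub C (pow_arr C 2 m)) \<longleftrightarrow> ?Q y)"
    if m: "m \<in> A" for m
  proof -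
    note mD = Subs_monic(1,2)[OF A m]
    have ma: "arrow C m" using mD by simp
    note pa = pow_arr_2_arrow[OF ma]
    have "mem y (im_sub C (pow_arr C 2 m)) \<longleftrightarrow> ?Q y" for y
    proof
      assume "mem y (im_sub C (pow_arr C 2 m))"
      then obtain p u where y: "arrow C y" "Cod C y = sq_ob X" and p: "epic C p" "Cod C p = Dom C y"
          and u: "arrow C u" "Dom C u = Dom C p" "Cod C u = sq_ob (Dom C m)" and eq: "y \<cdot> p = pow_arr C 2 m \<cdot> u"
        unfolding mem_im_sub[OF pa(1)] pa mD by blast
      have yp: "y \<cdot> p = pair X (m \<cdot> fst_arr (Dom C m) \<cdot> u) (m \<cdot> snd_arr (Dom C m) \<cdot> u)"
        unfolding eq pow_arr_2_cmp[OF ma u(1,3)] mD ..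
      have "fst_arr X \<cdot> y \<cdot> p = m \<cdot> fst_arr (Dom C m) \<cdot> u" "snd_arr X \<cdot> y \<cdot> p = m \<cdot> snd_arr (Dom C m) \<cdot> u"
        unfolding yp using u ma mD by simp_all
      moreover have "mem (m \<cdot> fst_arr (Dom C m) \<cdot> u) A" "mem (m \<cdot> snd_arr (Dom C m) \<cdot> u) A"
        using mem_cmp[OF A mem_self[OF A m]] u ma by simp_all
      ultimately have "mem (fst_arr X \<cdot> y \<cdot> p) A" "mem (snd_arr X \<cdot> y \<cdot> p) A"
        by (simp_all only:)
      then show "?Q y"
        using mem_local[OF A _ _ p(1), of "fst_arr X \<cdot> y"] mem_local[OF A _ _ p(1), of "snd_arr X \<cdot> y"] y p X by simp
    next
      assume Q: "?Q y"
      then have y: "arrow C y" "Cod C y = sq_ob X" by auto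
      obtain a where a: "arrow C a" "Dom C a = Dom C y" "Cod C a = Dom C m" "fst_arr X \<cdot> y = m \<cdot> a"
        using Q y X unfolding mem_rep[OF A m] by auto
      obtain c where c: "arrow C c" "Dom C c = Dom C y" "Cod C c = Dom C m" "snd_arr X \<cdot> y = m \<cdot> c"
        using Q y X unfolding mem_rep[OF A m] by auto
      have "pow_arr C 2 m \<cdot> pair (Dom C m) a c = pair X (fst_arr X \<cdot> y) (snd_arr X \<cdot> y)"
        unfolding a(4) c(4) using a(1-3) c(1-3) ma mD by (simp add: pow_arr_2_cmp)
      then have "y = pow_arr C 2 m \<cdot> pair (Dom C m) a c"
        using pair_prj[OF X y] by simp
      moreover have "mem (pow_arr C 2 m \<cdot> pair (Dom C m) a c) (im_sub C (pow_arr C 2 m))"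
        using a(1-3) c(1-3) pa by (intro mem_im_subI) simp_all
      ultimately show "mem y (im_sub C (pow_arr C 2 m))" by metis
    qed
    then show ?thesis using im_sub_closed[OF pa(1)] pa mD by simp
  qed
  have "A \<noteq> {}" using Subs_rep[OF A] by blast
  then have "pow_sub C 2 A \<in> Subs (sq_ob X) \<and> (\<forall>y. mem y (pow_sub C 2 A) \<longleftrightarrow> ?Q y)"
    unfolding pow_sub_def using main by (intro Union_constant_image) blast+
  then show "pow_sub C 2 A \<in> Subs (sq_ob X)" "mem y (pow_sub C 2 A) \<longleftrightarrow> ?Q y" by blast+
qed

text \<open>The part coming from the square of \<open>A\<close> is killed by the quotient map, so up
  to an epimorphism the elements are the pairs \<open>(q x, q a x)\<close>.\<close>

lemma
  assumes A: "A \<in> Subs X" and a: "arrow C a" "Dom C a = X" "Cod C a = X"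
  defines "q \<equiv> quot_map C A"
  shows quot_graph_closed: "quot_sub C X A 2 (endo_graph C X a) \<in> Subs (sq_ob (quot_ob C A))"
    and mem_quot_graph: "mem y (quot_sub C X A 2 (endo_graph C X a)) \<longleftrightarrow>
      arrow C y \<and> Cod C y = sq_ob (quot_ob C A) \<and> (\<exists>p x. epic C p \<and> Cod C p = Dom C y \<and> arrow C x \<and>
        Dom C x = Dom C p \<and> Cod C x = X \<and> y \<cdot> p = pair (quot_ob C A) (q \<cdot> x) (q \<cdot> a \<cdot> x))"
proof -
  have X: "X \<in> Ob C" using Subs_Ob[OF A] .
  note qD = quot_map_arrow[OF A, folded q_def]
  let ?Q = "quot_ob C A" and ?G = "endo_graph C X a"
  note G = mem_endo_graph[OF X a]
  note A2 = pow_sub_2_closed[OF A]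
  interpret bounded_modular_lattice "Sub C (sq_ob X)" by (rule Sub_bounded_modular_lattice) (use X in simp)
  note J = join_closed[OF G(1) A2]
  note pa = pow_arr_2_arrow[OF qD(2)] and pc = pow_arr_2_cmp[OF qD(2), unfolded qD]
  have dim: "?G \<squnion>\<^bsub>Sub C (sq_ob X)\<^esub> pow_sub C 2 A \<in> Subs (Dom C (pow_arr C 2 q))"
    using J pa qD by simp
  show "quot_sub C X A 2 ?G \<in> Subs (sq_ob ?Q)"
    unfolding quot_sub_def q_def[symmetric] using direct_im_closed[OF pa(1) dim] pa qD by simp
  show "mem y (quot_sub C X A 2 ?G) \<longleftrightarrow>
      arrow C y \<and> Cod C y = sq_ob ?Q \<and> (\<exists>p x. epic C p \<and> Cod C p = Dom C y \<and> arrow C x \<and>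
        Dom C x = Dom C p \<and> Cod C x = X \<and> y \<cdot> p = pair ?Q (q \<cdot> x) (q \<cdot> a \<cdot> x))"
    unfolding quot_sub_def q_def[symmetric] mem_direct_im[OF pa(1) dim] pa qD
  proof (intro iffI; elim conjE exE)
    fix p s assume y: "arrow C y" "Cod C y = sq_ob ?Q" and p: "epic C p" "Cod C p = Dom C y"
      and s: "mem s (?G \<squnion>\<^bsub>Sub C (sq_ob X)\<^esub> pow_sub C 2 A)" "Dom C s = Dom C p" "y \<cdot> p = pow_arr C 2 q \<cdot> s"
    obtain p' u v where p': "epic C p'" "Cod C p' = Dom C s" and uv: "mem u ?G" "Dom C u = Dom C p'"
        "mem v (pow_sub C 2 A)" "Dom C v = Dom C p'" "s \<cdot> p' = u \<boxplus> v" and sa: "arrow C s" "Cod C s = sq_ob X"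
      using s(1) unfolding mem_join[OF G(1) A2] by blast
    have u: "arrow C u" "Cod C u = sq_ob X" "snd_arr X \<cdot> u = a \<cdot> fst_arr X \<cdot> u"
      using uv(1) unfolding G(2) by auto
    have v: "arrow C v" "Cod C v = sq_ob X" "q \<cdot> fst_arr X \<cdot> v = hzero (Dom C v) ?Q" "q \<cdot> snd_arr X \<cdot> v = hzero (Dom C v) ?Q"
      using uv(3) X unfolding mem_pow_sub_2[OF A] mem_iff_quot_map[OF A] q_def by auto
    have "y \<cdot> p \<cdot> p' = (pow_arr C 2 q \<cdot> s) \<cdot> p'"
      by (rule cmp_eq_cmp[OF s(3)]) (use y p p' s(2) in simp_all)
    also have "\<dots> = pow_arr C 2 q \<cdot> (u \<boxplus> v)"
      using uv(5) pa qD sa p' by simp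
    also have "\<dots> = pair ?Q (q \<cdot> fst_arr X \<cdot> (u \<boxplus> v)) (q \<cdot> snd_arr X \<cdot> (u \<boxplus> v))"
      using u(1,2) v(1,2) uv(2,4) by (intro pc) simp_all
    also have "\<dots> = pair ?Q (q \<cdot> fst_arr X \<cdot> u) (q \<cdot> a \<cdot> fst_arr X \<cdot> u)"
      using u v uv(2,4) qD X a by (simp add: cmp_hadd)
    finally show "arrow C y \<and> Cod C y = sq_ob ?Q \<and> (\<exists>p x. epic C p \<and> Cod C p = Dom C y \<and> arrow C x \<and>
        Dom C x = Dom C p \<and> Cod C x = X \<and> y \<cdot> p = pair ?Q (q \<cdot> x) (q \<cdot> a \<cdot> x))"
      using y p p' s(2) u(1,2) uv(2) X
      by (intro conjI exI[of _ "p \<cdot> p'"] exI[of _ "fst_arr X \<cdot> u"]) simp_all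
  next
    fix p x assume y: "arrow C y" "Cod C y = sq_ob ?Q" and p: "epic C p" "Cod C p = Dom C y"
      and x: "arrow C x" "Dom C x = Dom C p" "Cod C x = X" "y \<cdot> p = pair ?Q (q \<cdot> x) (q \<cdot> a \<cdot> x)"
    have pr: "arrow C (pair X x (a \<cdot> x))" "Dom C (pair X x (a \<cdot> x)) = Dom C p" "Cod C (pair X x (a \<cdot> x)) = sq_ob X"
      using x(1-3) a by simp_all
    have "mem (pair X x (a \<cdot> x)) ?G"
      unfolding G(2) using x(1-3) a pr by simp
    then have "mem (pair X x (a \<cdot> x)) (?G \<squnion>\<^bsub>Sub C (sq_ob X)\<^esub> pow_sub C 2 A)"
      using Sub_le_iff[OF G(1) J] join_left[OF G(1) A2] by blast
    moreover have "y \<cdot> p = pow_arr C 2 q \<cdot> pair X x (a \<cdot> x)"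
      unfolding x(4) using pc[OF pr(1,3)] x(1-3) a by simp
    ultimately show "arrow C y \<and> Cod C y = sq_ob ?Q \<and> (\<exists>p s. epic C p \<and> Cod C p = Dom C y \<and>
        mem s (?G \<squnion>\<^bsub>Sub C (sq_ob X)\<^esub> pow_sub C 2 A) \<and> Dom C s = Dom C p \<and> y \<cdot> p = pow_arr C 2 q \<cdot> s)"
      using y p pr by blast
  qed
qed

end

section \<open>Complements of the second factor\<close>

context abelian_category
begin

lemma endo_graph_zero:
  assumes X: "X \<in> Ob C"
  shows "endo_graph C X (hzero X X) = fst_sub X"
  by (rule Sub_eqI[OF mem_endo_graph(1)[OF X] fst_sub_closed[OF X]])
    (use X in \<open>simp_all add: mem_endo_graph(2)[OF X] mem_fst_sub[OF X]\<close>)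

lemma endo_graph_meet_snd_sub:
  assumes X: "X \<in> Ob C" and a: "arrow C a" "Dom C a = X" "Cod C a = X"
  shows "endo_graph C X a \<sqinter>\<^bsub>Sub C (sq_ob X)\<^esub> snd_sub X = \<bottom>\<^bsub>Sub C (sq_ob X)\<^esub>"
proof -
  interpret bounded_modular_lattice "Sub C (sq_ob X)" by (rule Sub_bounded_modular_lattice) (use X in simp)
  note G = mem_endo_graph[OF X a] and H = snd_sub_closed[OF X]
  have "y = hzero (Dom C y) (sq_ob X)"
    if "mem y (endo_graph C X a)" "mem y (snd_sub X)" for y
  proof -
    have y: "arrow C y" "Cod C y = sq_ob X" "snd_arr X \<cdot> y = a \<cdot> fst_arr X \<cdot> y" "fst_arr X \<cdot> y = hzero (Dom C y) X"
      using that unfolding G(2) mem_snd_sub[OF X] by auto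
    then have "snd_arr X \<cdot> y = hzero (Dom C y) X" using a X by simp
    then show ?thesis
      using pair_eq_iff[OF X y(1,2), of "hzero (Dom C y) (sq_ob X)"] y X by simp
  qed
  then have "endo_graph C X a \<sqinter>\<^bsub>Sub C (sq_ob X)\<^esub> snd_sub X \<sqsubseteq>\<^bsub>Sub C (sq_ob X)\<^esub> \<bottom>\<^bsub>Sub C (sq_ob X)\<^esub>"
    using G(1) H mem_arrow[OF _ H] X
    by (simp add: Sub_le_iff mem_meet mem_bottom)
  then show ?thesis using le_bottom_iff G(1) H by simp
qed

text \<open>The first projection restricted to \<open>P\<close> is monic because \<open>P\<close>
  meets \<open>0 \<oplus> X\<close> trivially, and epic because the two span the square. Its inverse
  followed by the second coordinate is the endomorphism.\<close>

lemma complement_of_snd_sub_is_graph: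
  assumes X: "X \<in> Ob C" and P: "P \<in> Subs (sq_ob X)"
    and meet: "P \<sqinter>\<^bsub>Sub C (sq_ob X)\<^esub> snd_sub X = \<bottom>\<^bsub>Sub C (sq_ob X)\<^esub>"
    and join: "P \<squnion>\<^bsub>Sub C (sq_ob X)\<^esub> snd_sub X = \<top>\<^bsub>Sub C (sq_ob X)\<^esub>"
  obtains a where "arrow C a" "Dom C a = X" "Cod C a = X" "P = endo_graph C X a"
proof -
  obtain m where m: "m \<in> P" "monic C m" "Cod C m = sq_ob X" using Subs_rep[OF P] by metis
  note H = snd_sub_closed[OF X]
  define g where "g = fst_arr X \<cdot> m"
  have g: "arrow C g" "Dom C g = Dom C m" "Cod C g = X" using m X by (auto simp: g_def)
  have "monic C g"
  proof (rule monicI[OF g(1)])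
    fix u assume u: "arrow C u" "Cod C u = Dom C g" "g \<cdot> u = hzero (Dom C u) (Cod C g)"
    have "mem (m \<cdot> u) P" using mem_cmp[OF P mem_self[OF P m(1)] u(1)] u g by simp
    moreover have "mem (m \<cdot> u) (snd_sub X)"
      unfolding mem_snd_sub[OF X] using u m X g by (simp add: g_def)
    ultimately have "mem (m \<cdot> u) \<bottom>\<^bsub>Sub C (sq_ob X)\<^esub>"
      using mem_meet[OF P H] meet by simp
    then show "u = hzero (Dom C u) (Dom C g)"
      using mem_bottom[of "sq_ob X"] monic_zero[OF m(2) u(1)] u m X g by simp
  qed
  moreover have "epic C g"
  proof (rule epicI[OF g(1)])
    fix w assume w: "arrow C w" "Dom C w = Cod C g" "w \<cdot> g = hzero (Dom C g) (Cod C w)"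
    \<comment> \<open>The generic element of \<open>X \<oplus> 0\<close>; splitting it along
      \<open>P\<close> and \<open>0 \<oplus> X\<close> shows that the epimorphism \<open>p\<close>
      factors through \<open>g\<close>.\<close>
    define y where "y = pair X (Idn C X) (hzero X X)"
    have y: "arrow C y" "Dom C y = X" "Cod C y = sq_ob X" using X by (auto simp: y_def)
    have "mem y (P \<squnion>\<^bsub>Sub C (sq_ob X)\<^esub> snd_sub X)"
      using y X by (simp add: join mem_top)
    then obtain p s t where p: "epic C p" "Cod C p = X" and st: "mem s P" "Dom C s = Dom C p"
        "mem t (snd_sub X)" "Dom C t = Dom C p" "y \<cdot> p = s \<boxplus> t"
      unfolding mem_join[OF P H] y by blast
    obtain u where u: "arrow C u" "Dom C u = Dom C p" "Cod C u = Dom C m" "s = m \<cdot> u"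
      using st(1,2) unfolding mem_rep[OF P m(1)] by auto
    have s: "arrow C s" "Cod C s = sq_ob X" using mem_arrow[OF st(1) P] by auto
    have t: "arrow C t" "Cod C t = sq_ob X" "fst_arr X \<cdot> t = hzero (Dom C p) X"
      using st(3,4) unfolding mem_snd_sub[OF X] by auto
    have "p = fst_arr X \<cdot> y \<cdot> p"
      using cmp_eq_cmp[of "fst_arr X" y "Idn C X" p] p y X by (simp add: y_def)
    also have "\<dots> = fst_arr X \<cdot> s"
      unfolding st(5) using s t st(2,4) X p by (simp add: cmp_hadd)
    also have "\<dots> = g \<cdot> u" unfolding u(4) g_def using u(1-3) m X by simp
    finally have pe: "p = g \<cdot> u" .
    have "w \<cdot> p = hzero (Dom C g) (Cod C w) \<cdot> u"
      unfolding pe by (rule cmp_eq_cmp[OF w(3) u(1)]) (use w(1,2) g u(1-3) in simp_all)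
    then show "w = hzero (Cod C g) (Cod C w)"
      using epic_zero[OF p(1) w(1)] w(1,2) g u(1-3) p by simp
  qed
  ultimately obtain i where i: "arrow C i" "Dom C i = X" "Cod C i = Dom C m" "g \<cdot> i = Idn C X"
      "i \<cdot> g = Idn C (Dom C m)"
    using monic_epic_inverse[of g] g by metis
  define a where "a = snd_arr X \<cdot> m \<cdot> i"
  have a: "arrow C a" "Dom C a = X" "Cod C a = X" using m X i by (auto simp: a_def)
  have "P = endo_graph C X a"
  proof (rule Sub_eqI[OF P mem_endo_graph(1)[OF X a]])
    fix y assume y: "arrow C y" "Cod C y = sq_ob X"
    show "mem y P \<longleftrightarrow> mem y (endo_graph C X a)"
      unfolding mem_endo_graph(2)[OF X a]
    proof (intro iffI conjI)
      assume "mem y P"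
      then obtain u where u: "arrow C u" "Dom C u = Dom C y" "Cod C u = Dom C m" "y = m \<cdot> u"
        unfolding mem_rep[OF P m(1)] by auto
      have "i \<cdot> fst_arr X \<cdot> y = i \<cdot> g \<cdot> u"
        unfolding u(4) g_def using u(1-3) m X i by simp
      also have "\<dots> = u" using cmp_eq_cmp[OF i(5) u(1)] u(1-3) i g by simp
      finally have iu: "i \<cdot> fst_arr X \<cdot> y = u" .
      have "a \<cdot> fst_arr X \<cdot> y = snd_arr X \<cdot> m \<cdot> i \<cdot> fst_arr X \<cdot> y"
        unfolding a_def using y m X i by simp
      then show "snd_arr X \<cdot> y = a \<cdot> fst_arr X \<cdot> y"
        using iu u(4) by simp
    next
      assume "arrow C y \<and> Cod C y = sq_ob X \<and> snd_arr X \<cdot> y = a \<cdot> fst_arr X \<cdot> y"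
      then have ay: "snd_arr X \<cdot> y = a \<cdot> fst_arr X \<cdot> y" by auto
      define u where "u = i \<cdot> fst_arr X \<cdot> y"
      have u: "arrow C u" "Dom C u = Dom C y" "Cod C u = Dom C m" using i y X by (auto simp: u_def)
      have "fst_arr X \<cdot> m \<cdot> u = g \<cdot> i \<cdot> fst_arr X \<cdot> y"
        unfolding g_def u_def using m X i y by simp
      also have "\<dots> = fst_arr X \<cdot> y" using cmp_eq_cmp[OF i(4), of "fst_arr X \<cdot> y"] y X i g by simp
      finally have 1: "fst_arr X \<cdot> m \<cdot> u = fst_arr X \<cdot> y" .
      have 2: "snd_arr X \<cdot> m \<cdot> u = snd_arr X \<cdot> y"
        unfolding ay unfolding a_def u_def using m X i y by simp
      have "m \<cdot> u = y"
        using pair_eq_iff[OF X _ _ y, of "m \<cdot> u"] 1 2 u m by simp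
      then show "mem y P" unfolding mem_rep[OF P m(1)] using y u by auto
    qed (use y in auto)
  qed
  then show thesis using that a by blast
qed

text \<open>The generic element \<open>(id, 0)\<close> of \<open>X \<oplus> 0\<close> lies on the
  graph, and the equation of the graph then reads \<open>0 = a\<close>.\<close>

lemma endo_zero_if_fst_sub_le_graph:
  assumes X: "X \<in> Ob C" and a: "arrow C a" "Dom C a = X" "Cod C a = X"
    and le: "fst_sub X \<sqsubseteq>\<^bsub>Sub C (sq_ob X)\<^esub> endo_graph C X a"
  shows "a = hzero X X"
proof -
  have "mem (pair X (Idn C X) (hzero X X)) (fst_sub X)"
    unfolding mem_fst_sub[OF X] using X by simp
  then have "mem (pair X (Idn C X) (hzero X X)) (endo_graph C X a)"
    using le Sub_le_iff[OF fst_sub_closed[OF X] mem_endo_graph(1)[OF X a]] by blast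
  then show ?thesis
    unfolding mem_endo_graph(2)[OF X a] using X a by simp
qed

end

section \<open>The graph of an endomorphism modulo a subobject\<close>

locale quotient_graph = abelian_category +
  fixes X :: 'b and A :: "'c set" and a :: 'c
  assumes A: "A \<in> Subs X" and a: "arrow C a" "Dom C a = X" "Cod C a = X"
begin

definition "Q = quot_ob C A"
definition "q = quot_map C A"
definition "G = quot_sub C X A 2 (endo_graph C X a)"

lemma X: "X \<in> Ob C"
  using Subs_Ob[OF A] .

lemma q: "epic C q" "arrow C q" "Dom C q = X" "Cod C q = Q" "Q \<in> Ob C"
  unfolding q_def Q_def by (rule quot_map_arrow[OF A])+

lemma mem_A: "mem x A \<longleftrightarrow> arrow C x \<and> Cod C x = X \<and> q \<cdot> x = hzero (Dom C x) Q"
  unfolding q_def Q_def by (rule mem_iff_quot_map[OF A])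

lemma G_closed: "G \<in> Subs (sq_ob Q)"
  unfolding G_def Q_def by (rule quot_graph_closed[OF A a])

lemma mem_G: "mem y G \<longleftrightarrow> arrow C y \<and> Cod C y = sq_ob Q \<and> (\<exists>p x. epic C p \<and> Cod C p = Dom C y \<and>
    arrow C x \<and> Dom C x = Dom C p \<and> Cod C x = X \<and> y \<cdot> p = pair Q (q \<cdot> x) (q \<cdot> a \<cdot> x))"
  unfolding G_def Q_def q_def by (rule mem_quot_graph[OF A a])

lemma mem_G_pair:
  assumes "arrow C x" "Cod C x = X"
  shows "mem (pair Q (q \<cdot> x) (q \<cdot> a \<cdot> x)) G"
proof -
  have y: "arrow C (pair Q (q \<cdot> x) (q \<cdot> a \<cdot> x))" "Cod C (pair Q (q \<cdot> x) (q \<cdot> a \<cdot> x)) = sq_ob Q"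
    "Dom C (pair Q (q \<cdot> x) (q \<cdot> a \<cdot> x)) = Dom C x"
    using assms q a by simp_all
  then have "pair Q (q \<cdot> x) (q \<cdot> a \<cdot> x) \<cdot> Idn C (Dom C x) = pair Q (q \<cdot> x) (q \<cdot> a \<cdot> x)" by simp
  moreover have "epic C (Idn C (Dom C x))" "Cod C (Idn C (Dom C x)) = Dom C x" "Dom C x = Dom C (Idn C (Dom C x))"
    using assms by simp_all
  ultimately show ?thesis unfolding mem_G using y assms by metis
qed

lemma lift_to_X:
  assumes "arrow C z" "Cod C z = Q"
  obtains p x where "epic C p" "Cod C p = Dom C z" "arrow C x" "Dom C x = Dom C p" "Cod C x = X" "q \<cdot> x = z \<cdot> p"
  using pullback_epic[OF q(1) assms(1)] assms(2) q by metis

lemma fst_sub_lift: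
  assumes y: "arrow C y" "Cod C y = sq_ob Q" "snd_arr Q \<cdot> y = hzero (Dom C y) Q"
  obtains p x where "epic C p" "Cod C p = Dom C y" "arrow C x" "Dom C x = Dom C p" "Cod C x = X"
    "y \<cdot> p = pair Q (q \<cdot> x) (hzero (Dom C p) Q)"
proof -
  obtain p x where p: "epic C p" "Cod C p = Dom C (fst_arr Q \<cdot> y)" "arrow C x" "Dom C x = Dom C p" "Cod C x = X"
      "q \<cdot> x = (fst_arr Q \<cdot> y) \<cdot> p"
    using lift_to_X[of "fst_arr Q \<cdot> y"] y q by auto
  have py: "Cod C p = Dom C y" using p(2) q y by simp
  have "snd_arr Q \<cdot> y \<cdot> p = hzero (Dom C p) Q"
    using cmp_eq_cmp[OF y(3), of p] p(1) py y q by simp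
  moreover have "fst_arr Q \<cdot> y \<cdot> p = q \<cdot> x" unfolding p(6) using y p(1) py q by simp
  moreover have "y \<cdot> p = pair Q (fst_arr Q \<cdot> y \<cdot> p) (snd_arr Q \<cdot> y \<cdot> p)"
    using pair_prj[OF q(5), of "y \<cdot> p"] y p(1) py by simp
  ultimately show thesis using that[OF p(1) py p(3-5)] by simp
qed

lemma snd_sub_lift:
  assumes y: "arrow C y" "Cod C y = sq_ob Q" "fst_arr Q \<cdot> y = hzero (Dom C y) Q"
  obtains p x where "epic C p" "Cod C p = Dom C y" "arrow C x" "Dom C x = Dom C p" "Cod C x = X"
    "y \<cdot> p = pair Q (hzero (Dom C p) Q) (q \<cdot> x)"
proof -
  obtain p x where p: "epic C p" "Cod C p = Dom C (snd_arr Q \<cdot> y)" "arrow C x" "Dom C x = Dom C p" "Cod C x = X"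
      "q \<cdot> x = (snd_arr Q \<cdot> y) \<cdot> p"
    using lift_to_X[of "snd_arr Q \<cdot> y"] y q by auto
  have py: "Cod C p = Dom C y" using p(2) q y by simp
  have "fst_arr Q \<cdot> y \<cdot> p = hzero (Dom C p) Q"
    using cmp_eq_cmp[OF y(3), of p] p(1) py y q by simp
  moreover have "snd_arr Q \<cdot> y \<cdot> p = q \<cdot> x" unfolding p(6) using y p(1) py q by simp
  moreover have "y \<cdot> p = pair Q (fst_arr Q \<cdot> y \<cdot> p) (snd_arr Q \<cdot> y \<cdot> p)"
    using pair_prj[OF q(5), of "y \<cdot> p"] y p(1) py by simp
  ultimately show thesis using that[OF p(1) py p(3-5)] by simp
qed

sublocale sq: bounded_modular_lattice "Sub C (sq_ob Q)"
  by (rule Sub_bounded_modular_lattice) (use q in simp)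

abbreviation "image_A \<equiv> direct_im C a A"

lemma image_A_closed: "image_A \<in> Subs X"
  using direct_im_closed[OF a(1), of A] A a by simp

lemma mem_image_A: "mem x image_A \<longleftrightarrow> arrow C x \<and> Cod C x = X \<and>
    (\<exists>p s. epic C p \<and> Cod C p = Dom C x \<and> mem s A \<and> Dom C s = Dom C p \<and> x \<cdot> p = a \<cdot> s)"
  using mem_direct_im[OF a(1), of A x] A a by simp

lemma mem_image_AI: "mem x A \<Longrightarrow> mem (a \<cdot> x) image_A"
  unfolding mem_image_A using a mem_A[of x]
  by (intro conjI exI[of _ "Idn C (Dom C x)"] exI[of _ x]) simp_all

lemma image_A_le_iff: "image_A \<sqsubseteq>\<^bsub>Sub C X\<^esub> A \<longleftrightarrow> (\<forall>x. mem x A \<longrightarrow> mem (a \<cdot> x) A)"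
  using direct_im_le_iff[OF a(1), of A A] Sub_le_iff[OF A preim_closed[of a A, unfolded a]]
    mem_preim[OF a(1), of A] mem_arrow[OF _ A] A a by simp

lemma G_meet_snd_sub_iff:
  "G \<sqinter>\<^bsub>Sub C (sq_ob Q)\<^esub> snd_sub Q = \<bottom>\<^bsub>Sub C (sq_ob Q)\<^esub> \<longleftrightarrow> image_A \<sqsubseteq>\<^bsub>Sub C X\<^esub> A"
proof
  note H = snd_sub_closed[OF q(5)]
  assume 0: "G \<sqinter>\<^bsub>Sub C (sq_ob Q)\<^esub> snd_sub Q = \<bottom>\<^bsub>Sub C (sq_ob Q)\<^esub>"
  show "image_A \<sqsubseteq>\<^bsub>Sub C X\<^esub> A"
    unfolding image_A_le_iff
  proof (intro allI impI)
    fix x assume xA: "mem x A"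
    then have x: "arrow C x" "Cod C x = X" "q \<cdot> x = hzero (Dom C x) Q" by (auto simp: mem_A)
    \<comment> \<open>As \<open>x\<close> lies in \<open>A\<close>, the first coordinate vanishes,
      so this pair lies in both \<open>G\<close> and \<open>0 \<oplus> Q\<close>.\<close>
    define y where "y = pair Q (q \<cdot> x) (q \<cdot> a \<cdot> x)"
    have y: "arrow C y" "Cod C y = sq_ob Q" "Dom C y = Dom C x" "fst_arr Q \<cdot> y = q \<cdot> x" "snd_arr Q \<cdot> y = q \<cdot> a \<cdot> x"
      using x(1,2) q a by (simp_all add: y_def)
    have "mem y G" unfolding y_def by (rule mem_G_pair[OF x(1,2)])
    moreover have "mem y (snd_sub Q)"
      unfolding mem_snd_sub[OF q(5)] using y x by simp
    ultimately have "mem y \<bottom>\<^bsub>Sub C (sq_ob Q)\<^esub>"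
      using mem_meet[OF G_closed H] 0 by simp
    then have "y = hzero (Dom C y) (sq_ob Q)" using mem_bottom[of "sq_ob Q"] q by simp
    then have "q \<cdot> a \<cdot> x = snd_arr Q \<cdot> hzero (Dom C x) (sq_ob Q)" using y(3,5) by metis
    then show "mem (a \<cdot> x) A"
      unfolding mem_A using x(1,2) q a by simp
  qed
next
  note H = snd_sub_closed[OF q(5)]
  assume "image_A \<sqsubseteq>\<^bsub>Sub C X\<^esub> A"
  then have stab: "\<And>x. mem x A \<Longrightarrow> mem (a \<cdot> x) A" unfolding image_A_le_iff by blast
  have "mem y \<bottom>\<^bsub>Sub C (sq_ob Q)\<^esub>" if yGH: "mem y (G \<sqinter>\<^bsub>Sub C (sq_ob Q)\<^esub> snd_sub Q)" for y
  proof -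
    obtain p x where y: "arrow C y" "Cod C y = sq_ob Q" "fst_arr Q \<cdot> y = hzero (Dom C y) Q"
      and p: "epic C p" "Cod C p = Dom C y" and x: "arrow C x" "Dom C x = Dom C p" "Cod C x = X"
      and eq: "y \<cdot> p = pair Q (q \<cdot> x) (q \<cdot> a \<cdot> x)"
      using yGH unfolding mem_meet[OF G_closed H] mem_G mem_snd_sub[OF q(5)] by blast
    \<comment> \<open>The vanishing first coordinate puts \<open>x\<close> into \<open>A\<close>,
      and stability then kills the second coordinate.\<close>
    have "q \<cdot> x = fst_arr Q \<cdot> y \<cdot> p" unfolding eq using x q a by simp
    also have "\<dots> = hzero (Dom C y) Q \<cdot> p"
      by (rule cmp_eq_cmp[OF y(3)]) (use y p q in simp_all)
    finally have "mem x A" unfolding mem_A using x p q by simp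
    then have "q \<cdot> a \<cdot> x = hzero (Dom C x) Q" using stab mem_A x a by simp
    moreover have "q \<cdot> x = hzero (Dom C x) Q" using \<open>mem x A\<close> mem_A by simp
    ultimately have "y \<cdot> p = pair Q (hzero (Dom C p) Q) (hzero (Dom C p) Q)"
      unfolding eq using x(2) by simp
    also have "\<dots> = hzero (Dom C p) (sq_ob Q)"
      by (subst pair_eq_iff[OF q(5)]) (use p q in simp_all)
    finally have "y = hzero (Dom C y) (sq_ob Q)"
      using epic_zero[OF p(1) y(1)] p y by simp
    then show ?thesis using mem_bottom[of "sq_ob Q"] y(1,2) q by simp
  qed
  then have "G \<sqinter>\<^bsub>Sub C (sq_ob Q)\<^esub> snd_sub Q \<sqsubseteq>\<^bsub>Sub C (sq_ob Q)\<^esub> \<bottom>\<^bsub>Sub C (sq_ob Q)\<^esub>"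
    using Sub_le_iff G_closed H by simp
  then show "G \<sqinter>\<^bsub>Sub C (sq_ob Q)\<^esub> snd_sub Q = \<bottom>\<^bsub>Sub C (sq_ob Q)\<^esub>"
    using sq.le_bottom_iff G_closed H by simp
qed

text \<open>Since \<open>q\<close> is epic, some member of \<open>G\<close> has the same first
  coordinate as a given element, up to an epimorphism; the difference lies in
  \<open>0 \<oplus> Q\<close>.\<close>

lemma G_join_snd_sub: "G \<squnion>\<^bsub>Sub C (sq_ob Q)\<^esub> snd_sub Q = \<top>\<^bsub>Sub C (sq_ob Q)\<^esub>"
proof (rule Sub_eqI[where X = "sq_ob Q"])
  note H = snd_sub_closed[OF q(5)]
  show "G \<squnion>\<^bsub>Sub C (sq_ob Q)\<^esub> snd_sub Q \<in> Subs (sq_ob Q)" using G_closed H by simp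
  fix y assume y: "arrow C y" "Cod C y = sq_ob Q"
  obtain p x where p: "epic C p" "Cod C p = Dom C (fst_arr Q \<cdot> y)" "arrow C x" "Dom C x = Dom C p" "Cod C x = X"
      "q \<cdot> x = (fst_arr Q \<cdot> y) \<cdot> p"
    using lift_to_X[of "fst_arr Q \<cdot> y"] y q by auto
  have x: "arrow C x" "Dom C x = Dom C p" "Cod C x = X" "Cod C p = Dom C y" using p q y by simp_all
  define s where "s = pair Q (q \<cdot> x) (q \<cdot> a \<cdot> x)"
  have s: "arrow C s" "Cod C s = sq_ob Q" "Dom C s = Dom C p" "fst_arr Q \<cdot> s = q \<cdot> x"
    using x q a by (simp_all add: s_def)
  have sG: "mem s G" unfolding s_def by (rule mem_G_pair[OF x(1,3)])
  define t where "t = hneg s \<boxplus> y \<cdot> p"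
  have yp: "arrow C (y \<cdot> p)" "Cod C (y \<cdot> p) = sq_ob Q" "Dom C (y \<cdot> p) = Dom C p" using y p(1) x by simp_all
  have t: "arrow C t" "Cod C t = sq_ob Q" "Dom C t = Dom C p" using s yp by (simp_all add: t_def)
  have "fst_arr Q \<cdot> t = hneg (q \<cdot> x) \<boxplus> fst_arr Q \<cdot> (y \<cdot> p)"
    unfolding t_def using s yp q by (simp add: cmp_hadd cmp_hneg)
  also have "fst_arr Q \<cdot> (y \<cdot> p) = q \<cdot> x"
    unfolding p(6) using y p(1) x(4) q by simp
  finally have tH: "mem t (snd_sub Q)"
    unfolding mem_snd_sub[OF q(5)] using t x q by simp
  have "s \<boxplus> t = (s \<boxplus> hneg s) \<boxplus> y \<cdot> p"
    unfolding t_def using s yp by (intro hadd_assoc[symmetric]) simp_all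
  then have "y \<cdot> p = s \<boxplus> t" using s yp by simp
  then have "mem y (G \<squnion>\<^bsub>Sub C (sq_ob Q)\<^esub> snd_sub Q)"
    unfolding mem_join[OF G_closed H] using y p(1) x(4) sG tH s t by blast
  then show "mem y (G \<squnion>\<^bsub>Sub C (sq_ob Q)\<^esub> snd_sub Q) \<longleftrightarrow> mem y \<top>\<^bsub>Sub C (sq_ob Q)\<^esub>"
    using y q by (simp add: mem_top)
qed simp

text \<open>Here the members of \<open>G\<close> are the pairs \<open>(q x, 0)\<close>, and these
  fill \<open>Q \<oplus> 0\<close> because \<open>q\<close> is epic. This settles the scalar 0,
  which has no inverse to transport \<open>A / a A\<close> with.\<close>

lemma G_zero:
  assumes "a = hzero X X"
  shows "G = fst_sub Q"
proof (rule Sub_eqI[OF G_closed fst_sub_closed[OF q(5)]])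
  fix y assume y: "arrow C y" "Cod C y = sq_ob Q"
  show "mem y G \<longleftrightarrow> mem y (fst_sub Q)"
    unfolding mem_fst_sub[OF q(5)] mem_G
  proof (intro iffI; elim conjE exE)
    fix p x assume p: "epic C p" "Cod C p = Dom C y" and x: "arrow C x" "Dom C x = Dom C p" "Cod C x = X"
      and eq: "y \<cdot> p = pair Q (q \<cdot> x) (q \<cdot> a \<cdot> x)"
    have "q \<cdot> a \<cdot> x = hzero (Dom C p) Q" unfolding assms using x q X p(1) by simp
    moreover have "snd_arr Q \<cdot> (y \<cdot> p) = q \<cdot> a \<cdot> x" unfolding eq using x q a by simp
    ultimately have "(snd_arr Q \<cdot> y) \<cdot> p = hzero (Dom C p) Q" using y p q by simp
    then show "arrow C y \<and> Cod C y = sq_ob Q \<and> snd_arr Q \<cdot> y = hzero (Dom C y) Q"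
      using epic_zero[OF p(1), of "snd_arr Q \<cdot> y"] y p q by simp
  next
    assume 0: "snd_arr Q \<cdot> y = hzero (Dom C y) Q"
    obtain p x where p: "epic C p" "Cod C p = Dom C y" and x: "arrow C x" "Dom C x = Dom C p" "Cod C x = X"
        and eq: "y \<cdot> p = pair Q (q \<cdot> x) (hzero (Dom C p) Q)"
      using fst_sub_lift[OF y 0] .
    have "q \<cdot> a \<cdot> x = hzero (Dom C p) Q"
      unfolding assms using x p(1) q X by simp
    then have "y \<cdot> p = pair Q (q \<cdot> x) (q \<cdot> a \<cdot> x)" using eq by simp
    then show "arrow C y \<and> Cod C y = sq_ob Q \<and> (\<exists>p x. epic C p \<and> Cod C p = Dom C y \<and> arrow C x \<and>
        Dom C x = Dom C p \<and> Cod C x = X \<and> y \<cdot> p = pair Q (q \<cdot> x) (q \<cdot> a \<cdot> x))"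
      using y p x by blast
  qed
qed

text \<open>Seen from \<open>X\<close>, this is the quotient by \<open>A\<close> of the sum of
  \<open>A\<close> and its inverse image under \<open>a\<close>, placed in the first
  summand.\<close>

definition "N = G \<sqinter>\<^bsub>Sub C (sq_ob Q)\<^esub> fst_sub Q"

lemma N_closed: "N \<in> Subs (sq_ob Q)"
  unfolding N_def using G_closed fst_sub_closed[OF q(5)] by simp

lemma mem_N: "mem y N \<longleftrightarrow> arrow C y \<and> Cod C y = sq_ob Q \<and> (\<exists>p x. epic C p \<and> Cod C p = Dom C y \<and>
    arrow C x \<and> Dom C x = Dom C p \<and> Cod C x = X \<and> mem (a \<cdot> x) A \<and> y \<cdot> p = pair Q (q \<cdot> x) (hzero (Dom C p) Q))"
  (is "?L \<longleftrightarrow> ?R")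
proof
  assume ?L
  then obtain p x where y: "arrow C y" "Cod C y = sq_ob Q" "snd_arr Q \<cdot> y = hzero (Dom C y) Q"
      and p: "epic C p" "Cod C p = Dom C y" and x: "arrow C x" "Dom C x = Dom C p" "Cod C x = X"
      and eq: "y \<cdot> p = pair Q (q \<cdot> x) (q \<cdot> a \<cdot> x)"
    unfolding N_def mem_meet[OF G_closed fst_sub_closed[OF q(5)]] mem_G mem_fst_sub[OF q(5)] by blast
  have "q \<cdot> a \<cdot> x = snd_arr Q \<cdot> y \<cdot> p" unfolding eq using x q a by simp
  also have "\<dots> = hzero (Dom C p) Q" using cmp_eq_cmp[OF y(3), of p] y(1,2) p q by simp
  finally have 0: "q \<cdot> a \<cdot> x = hzero (Dom C p) Q" .
  then have "mem (a \<cdot> x) A" unfolding mem_A using x a by simp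
  then show ?R using y p x eq 0 by metis
next
  assume ?R
  then obtain p x where y: "arrow C y" "Cod C y = sq_ob Q" and p: "epic C p" "Cod C p = Dom C y"
    and x: "arrow C x" "Dom C x = Dom C p" "Cod C x = X" "mem (a \<cdot> x) A"
    and eq: "y \<cdot> p = pair Q (q \<cdot> x) (hzero (Dom C p) Q)"
    by blast
  have "q \<cdot> a \<cdot> x = hzero (Dom C p) Q" using x(4) unfolding mem_A using x(1-3) a by simp
  then have "mem y G" unfolding mem_G using y p x(1-3) eq by metis
  moreover have "snd_arr Q \<cdot> (y \<cdot> p) = hzero (Dom C p) Q" unfolding eq using x q p(1) by simp
  then have "snd_arr Q \<cdot> y = hzero (Dom C y) Q"
    using epic_zero[OF p(1), of "snd_arr Q \<cdot> y"] y p q by simp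
  ultimately show ?L
    unfolding N_def mem_meet[OF G_closed fst_sub_closed[OF q(5)]] mem_fst_sub[OF q(5)] using y by blast
qed

text \<open>For an automorphism \<open>a\<close> with inverse \<open>b\<close>, the map \<open>x \<mapsto> (b x + A, 0)\<close> identifies the subquotient
  \<open>A / a A\<close> with \<open>N\<close>, the kernel of the endomorphism induced by \<open>a\<close> on the quotient.\<close>

lemma subquot_embedding:
  assumes b: "arrow C b" "Dom C b = X" "Cod C b = X" and ab: "a \<cdot> b = Idn C X" and ba: "b \<cdot> a = Idn C X"
    and stab: "image_A \<sqsubseteq>\<^bsub>Sub C X\<^esub> A"
  obtains f where "monic C f" "Dom C f = subquot_ob C A image_A" "Cod C f = sq_ob Q" "im_sub C f = N"
proof -
  \<comment> \<open>\<open>subquot_ob\<close> is a chosen object. The choice is opened once, and all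
    later arrows refer to the representatives obtained from it.\<close>
  have "\<exists>m\<in>A. \<exists>n\<in>image_A. \<exists>j\<in>carrier (Hom C (Dom C n) (Dom C m)). \<exists>e.
     n = m \<cdot> j \<and> is_cokernel C e j \<and> subquot_ob C A image_A = Cod C e"
    unfolding subquot_ob_def
  proof (rule someI_ex)
    obtain m where m: "m \<in> A" "monic C m" "Cod C m = X" using Subs_rep[OF A] by metis
    obtain n where n: "n \<in> image_A" "monic C n" "Cod C n = X" using Subs_rep[OF image_A_closed] by metis
    have "mem n A" using stab mem_self[OF image_A_closed n(1)] Sub_le_iff[OF image_A_closed A] by blast
    then obtain j where j: "arrow C j" "Dom C j = Dom C n" "Cod C j = Dom C m" "n = m \<cdot> j"
      unfolding mem_rep[OF A m(1)] by auto
    obtain e where "is_cokernel C e j" using cokernel_exists[OF j(1)] by blast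
    moreover have "j \<in> carrier (Hom C (Dom C n) (Dom C m))" using arrow_hom[OF j(1)] j by simp
    ultimately show "\<exists>Z. \<exists>m\<in>A. \<exists>n\<in>image_A. \<exists>j\<in>carrier (Hom C (Dom C n) (Dom C m)). \<exists>e.
        n = m \<cdot> j \<and> is_cokernel C e j \<and> Z = Cod C e"
      using m(1) n(1) j(4) by blast
  qed
  then obtain m n j e where mn: "m \<in> A" "n \<in> image_A" and j: "j \<in> carrier (Hom C (Dom C n) (Dom C m))" "n = m \<cdot> j"
      and e: "is_cokernel C e j" "subquot_ob C A image_A = Cod C e"
    by blast
  have m: "monic C m" "Cod C m = X" using Subs_monic[OF A mn(1)] by auto
  have n: "monic C n" "Cod C n = X" using Subs_monic[OF image_A_closed mn(2)] by auto
  have ja: "arrow C j" "Dom C j = Dom C n" "Cod C j = Dom C m" using j(1) m n by (auto simp: hom_iff)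
  note eD = is_cokernelD[OF e(1)] and ee = cokernel_epic[OF e(1)]
  \<comment> \<open>The projection \<open>e\<close> onto the subquotient kills every element coming
    from \<open>image_A\<close>; the injectivity of \<open>f\<close> rests on this.\<close>
  have ezero: "e \<cdot> u = hzero (Dom C u) (Cod C e)" if u: "arrow C u" "Cod C u = Dom C m" "mem (m \<cdot> u) image_A" for u
  proof -
    obtain w where w: "arrow C w" "Dom C w = Dom C u" "Cod C w = Dom C n" "m \<cdot> u = n \<cdot> w"
      using u m unfolding mem_rep[OF image_A_closed mn(2)] by auto
    have "n \<cdot> w = m \<cdot> (j \<cdot> w)" using cmp_eq_cmp[OF j(2)[symmetric] w(1)] w(3) m ja by simp
    then have "u = j \<cdot> w"
      using monicD[OF m(1) u(1), of "j \<cdot> w"] u(2) w(1-3) ja cmp_arrow[OF w(1) ja(1)] w(4) by simp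
    then have "e \<cdot> u = e \<cdot> j \<cdot> w" by simp
    also have "\<dots> = hzero (Dom C j) (Cod C e) \<cdot> w"
      by (rule cmp_eq_cmp[OF eD(4) w(1)]) (use eD(1-3) w(3) ja in simp_all)
    finally have "e \<cdot> u = hzero (Dom C j) (Cod C e) \<cdot> w" .
    then show ?thesis using w(1,2,3) ja eD by simp
  qed
  define g where "g = pair Q (q \<cdot> b \<cdot> m) (hzero (Dom C m) Q)"
  have g: "arrow C g" "Dom C g = Dom C m" "Cod C g = sq_ob Q" using q b m by (simp_all add: g_def)
  have gu: "g \<cdot> u = pair Q (q \<cdot> b \<cdot> m \<cdot> u) (hzero (Dom C u) Q)" if "arrow C u" "Cod C u = Dom C m" for u
    unfolding g_def using q b m that by (simp add: pair_cmp)
  \<comment> \<open>On an element \<open>a s\<close> with \<open>s\<close> in \<open>A\<close> the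
    arrow \<open>q \<cdot> b\<close> vanishes, since \<open>b a s = s\<close>. So \<open>g\<close>
    factors through the subquotient.\<close>
  have "q \<cdot> b \<cdot> n = hzero (Dom C n) Q"
  proof -
    obtain p s where p: "epic C p" "Cod C p = Dom C n" "mem s A" "Dom C s = Dom C p" "n \<cdot> p = a \<cdot> s"
      using mem_self[OF image_A_closed mn(2)] unfolding mem_image_A by blast
    have s: "arrow C s" "Cod C s = X" "q \<cdot> s = hzero (Dom C s) Q" using p(3) unfolding mem_A by auto
    have "(q \<cdot> b \<cdot> n) \<cdot> p = q \<cdot> b \<cdot> (n \<cdot> p)" using q b n p(1,2) by simp
    also have "\<dots> = q \<cdot> s" unfolding p(5) using cmp_eq_cmp[OF ba s(1)] a b s by simp
    finally show ?thesis
      using epic_zero[OF p(1), of "q \<cdot> b \<cdot> n"] s(3) p(2,4) q b n by simp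
  qed
  then have "g \<cdot> j = pair Q (hzero (Dom C j) Q) (hzero (Dom C j) Q)"
    using gu[OF ja(1)] ja j(2) by simp
  also have "\<dots> = hzero (Dom C j) (sq_ob Q)"
    by (subst pair_eq_iff[OF q(5)]) (use ja q n in simp_all)
  finally obtain f where f: "arrow C f" "Dom C f = Cod C e" "Cod C f = sq_ob Q" "f \<cdot> e = g"
    using cokernel_factor[OF e(1) g(1)] g ja by auto
  have fe: "f \<cdot> e \<cdot> u = pair Q (q \<cdot> b \<cdot> m \<cdot> u) (hzero (Dom C u) Q)" if "arrow C u" "Cod C u = Dom C m" for u
    using cmp_eq_cmp[OF f(4) that(1)] gu[OF that] that eD ja f by simp
  have abm: "a \<cdot> b \<cdot> m \<cdot> u = m \<cdot> u" if "arrow C u" "Cod C u = Dom C m" for u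
    using cmp_eq_cmp[OF ab, of "m \<cdot> u"] that a b m by simp
  have "monic C f"
  proof (rule monicI[OF f(1)])
    fix z assume z: "arrow C z" "Cod C z = Dom C f" "f \<cdot> z = hzero (Dom C z) (Cod C f)"
    obtain p u where p: "epic C p" "Cod C p = Dom C z" "arrow C u" "Dom C u = Dom C p" "Cod C u = Dom C e" "e \<cdot> u = z \<cdot> p"
      using pullback_epic[OF ee z(1)] z f by auto
    have um: "Cod C u = Dom C m" using p eD ja by simp
    have "pair Q (q \<cdot> b \<cdot> m \<cdot> u) (hzero (Dom C u) Q) = f \<cdot> z \<cdot> p"
      using fe[OF p(3) um] p(6) by simp
    also have "\<dots> = hzero (Dom C p) (sq_ob Q)"
      using cmp_eq_cmp[OF z(3), of p] z p(1,2) f q by simp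
    finally have "fst_arr Q \<cdot> pair Q (q \<cdot> b \<cdot> m \<cdot> u) (hzero (Dom C u) Q) = hzero (Dom C p) Q"
      using p(1) q by simp
    \<comment> \<open>From \<open>b m u\<close> in \<open>A\<close> it follows that
      \<open>m u = a b m u\<close> lies in \<open>image_A\<close>, so that \<open>e\<close> kills
      \<open>u\<close>.\<close>
    then have "mem (b \<cdot> m \<cdot> u) A"
      unfolding mem_A using p(1,3,4) um q b m by simp
    then have "mem (m \<cdot> u) image_A"
      using mem_image_AI[of "b \<cdot> m \<cdot> u"] abm[OF p(3) um] by simp
    then have "z \<cdot> p = hzero (Dom C p) (Cod C e)"
      using ezero[OF p(3) um] p(4,6) by simp
    then show "z = hzero (Dom C z) (Dom C f)"
      using epic_zero[OF p(1) z(1)] p(2) z(2) f(2) by simp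
  qed
  moreover have "im_sub C f = N"
  proof (rule Sub_eqI[where X = "sq_ob Q"])
    show "im_sub C f \<in> Subs (sq_ob Q)" using im_sub_closed[OF f(1)] f(3) by simp
    show "N \<in> Subs (sq_ob Q)" by (rule N_closed)
    fix y assume y: "arrow C y" "Cod C y = sq_ob Q"
    show "mem y (im_sub C f) \<longleftrightarrow> mem y N"
    proof
      assume "mem y (im_sub C f)"
      then obtain p z where p: "epic C p" "Cod C p = Dom C y" and z: "arrow C z" "Dom C z = Dom C p" "Cod C z = Cod C e"
          "y \<cdot> p = f \<cdot> z"
        unfolding mem_im_sub[OF f(1)] f(2) by blast
      obtain p' u where p': "epic C p'" "Cod C p' = Dom C z" "arrow C u" "Dom C u = Dom C p'" "Cod C u = Dom C e"
          "e \<cdot> u = z \<cdot> p'"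
        using pullback_epic[OF ee z(1) z(3)] .
      have um: "Cod C u = Dom C m" using p' eD ja by simp
      have "y \<cdot> p \<cdot> p' = (f \<cdot> z) \<cdot> p'"
        by (rule cmp_eq_cmp[OF z(4)]) (use y p p'(1,2) z in simp_all)
      also have "\<dots> = f \<cdot> e \<cdot> u" unfolding p'(6) using f z p'(1,2) by simp
      also have "\<dots> = pair Q (q \<cdot> b \<cdot> m \<cdot> u) (hzero (Dom C u) Q)" by (rule fe[OF p'(3) um])
      finally have "y \<cdot> (p \<cdot> p') = pair Q (q \<cdot> b \<cdot> m \<cdot> u) (hzero (Dom C (p \<cdot> p')) Q)"
        using p p'(1,2,4) z(2) by simp
      moreover have "mem (m \<cdot> u) A"
        using mem_cmp[OF A mem_self[OF A mn(1)] p'(3)] um by simp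
      then have "mem (a \<cdot> b \<cdot> m \<cdot> u) A" using abm[OF p'(3) um] by simp
      moreover have "epic C (p \<cdot> p')" "Cod C (p \<cdot> p') = Dom C y" "arrow C (b \<cdot> m \<cdot> u)"
          "Dom C (b \<cdot> m \<cdot> u) = Dom C (p \<cdot> p')" "Cod C (b \<cdot> m \<cdot> u) = X"
        using p p'(1-4) z(2) um b m by simp_all
      ultimately show "mem y N" unfolding mem_N using y by blast
    next
      assume "mem y N"
      then obtain p x where p: "epic C p" "Cod C p = Dom C y" and x: "arrow C x" "Dom C x = Dom C p" "Cod C x = X"
          "mem (a \<cdot> x) A" and eq: "y \<cdot> p = pair Q (q \<cdot> x) (hzero (Dom C p) Q)"
        unfolding mem_N by blast
      \<comment> \<open>The preimage of \<open>(q x, 0)\<close> is the class of \<open>a x\<close>,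
        because \<open>b a x = x\<close>.\<close>
      obtain u where u: "arrow C u" "Dom C u = Dom C (a \<cdot> x)" "Cod C u = Dom C m" "a \<cdot> x = m \<cdot> u"
        using x(4) unfolding mem_rep[OF A mn(1)] by auto
      have "b \<cdot> m \<cdot> u = x"
        unfolding u(4)[symmetric] using cmp_eq_cmp[OF ba x(1)] a b x(1,3) by simp
      then have "y \<cdot> p = f \<cdot> (e \<cdot> u)"
        unfolding eq using fe[OF u(1,3)] u(2) a x(1-3) by simp
      moreover have "arrow C (e \<cdot> u)" "Dom C (e \<cdot> u) = Dom C p" "Cod C (e \<cdot> u) = Dom C f"
        using u(1-3) eD ja a x f(2) by simp_all
      ultimately show "mem y (im_sub C f)"
        unfolding mem_im_sub[OF f(1)] f(3) using y p by blast
    qed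
  qed
  ultimately show thesis using that f(2,3) e(2) by simp
qed

end

section \<open>Specialization to an endomorphism of the flattening\<close>

locale pedestal_flattening = quotient_graph C X A a + D: abelian_category D
  for C :: "('k::field, 'o, 'm) lincat" (structure) and X A a and D :: "('k, 'p, 'n) lincat" +
  fixes B :: 'p and \<phi> :: "nat \<Rightarrow> 'm set \<Rightarrow> 'n set" and d :: nat
  assumes B: "B \<in> Ob D"
    and flattening: "dir_flattening (Dir C (quot_ob C A)) (Dir D B) \<phi>"
    and rk0: "rk0 (Sub C X) = enat d"
    and rk_bot: "rk_bot (Sub C (quot_ob C A)) = enat d"
begin

section \<open>The flattening on the two summands, and bounds on cubes below them\<close>

lemma flattening_n: "n \<ge> 1 \<Longrightarrow> flattening_map (Sub C (pow_ob C Q n)) (Sub D (pow_ob D B n)) (\<phi> n)"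
  using flattening by (simp add: dir_flattening_def Dir_def Q_def)

sublocale sqD: bounded_modular_lattice "Sub D (D.sq_ob B)"
  by (rule D.Sub_bounded_modular_lattice) (use B in simp)

sublocale flat2: flattening "Sub C (sq_ob Q)" "Sub D (D.sq_ob B)" "\<phi> 2"
  by unfold_locales (rule flattening_n, simp)

lemma flat1: "flattening (Sub C (pow_ob C Q 1)) (Sub D (pow_ob D B 1)) (\<phi> 1)"
proof -
  interpret L1: bounded_modular_lattice "Sub C (pow_ob C Q 1)"
    by (rule Sub_bounded_modular_lattice) (rule pow1D[OF q(5)])
  interpret M1: bounded_modular_lattice "Sub D (pow_ob D B 1)"
    by (rule D.Sub_bounded_modular_lattice) (rule D.pow1D[OF B])
  show ?thesis by unfold_locales (rule flattening_n, simp)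
qed

lemma map_oplus:
  assumes "S \<in> Subs (pow_ob C Q 1)" "T \<in> Subs (pow_ob C Q 1)"
  shows "\<phi> 2 (sub_oplus C Q 1 1 S T) = sub_oplus D B 1 1 (\<phi> 1 S) (\<phi> 1 T)"
proof -
  have "\<forall>n\<ge>1. \<forall>m\<ge>1. \<forall>S\<in>Subs (pow_ob C Q n). \<forall>T\<in>Subs (pow_ob C Q m).
      \<phi> (n + m) (sub_oplus C Q n m S T) = sub_oplus D B n m (\<phi> n S) (\<phi> m T)"
    using flattening by (simp add: dir_flattening_def dir_morphism_def Dir_def Q_def)
  from this[rule_format, OF order_refl order_refl assms] show ?thesis by (simp only: one_add_one)
qed

text \<open>Both summands come from the top and bottom of sort 1, and these are preserved by the
  flattening of that sort.\<close>

lemma map_fst_sub: "\<phi> 2 (fst_sub Q) = D.fst_sub B"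
  and map_snd_sub: "\<phi> 2 (snd_sub Q) = D.snd_sub B"
proof -
  interpret flattening "Sub C (pow_ob C Q 1)" "Sub D (pow_ob D B 1)" "\<phi> 1" by (rule flat1)
  show "\<phi> 2 (fst_sub Q) = D.fst_sub B" "\<phi> 2 (snd_sub Q) = D.snd_sub B"
    unfolding fst_sub_def snd_sub_def D.fst_sub_def D.snd_sub_def
      map_oplus[OF L.top_closed L.bottom_closed] map_oplus[OF L.bottom_closed L.top_closed]
      map_top map_bottom by (rule refl)+
qed

text \<open>Taking preimages under \<open>g\<close> is injective on subobjects of its image, so the
  cube reappears in \<open>Sub C X\<close>, where \<open>rk0\<close> bounds it whatever its
  base.\<close>

lemma cube_below_image:
  assumes g: "arrow C g" "Dom C g = X" "Cod C g = sq_ob Q" and U: "U \<in> Subs (sq_ob Q)"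
    and im: "\<And>y. mem y U \<Longrightarrow> mem y (im_sub C g)"
    and c: "strict_cube (Sub C (sq_ob Q)) n c" "\<forall>S\<subseteq>{1..n}. c S \<sqsubseteq>\<^bsub>Sub C (sq_ob Q)\<^esub> U"
  shows "n \<le> d"
proof -
  have "strict_cube (Sub C (Dom C g)) n (preim g \<circ> c)"
  proof (rule strict_cube_preim[OF g(1)])
    show "mem y (im_sub C g)" if S: "S \<subseteq> {1..n}" and y: "mem y (c S)" for y S
      using im c(2) S y Sub_le_iff[OF sq.strict_cube_closed[OF c(1) S] U] by blast
  qed (use c(1) g in simp)
  then show ?thesis using enat_le_rk0 rk0 g by fastforce
qed

lemma cube_below_fst_sub:
  assumes "strict_cube (Sub C (sq_ob Q)) n c" "\<forall>S\<subseteq>{1..n}. c S \<sqsubseteq>\<^bsub>Sub C (sq_ob Q)\<^esub> fst_sub Q"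
  shows "n \<le> d"
proof (rule cube_below_image[OF _ _ _ fst_sub_closed[OF q(5)] _ assms])
  \<comment> \<open>The quotient map followed by the inclusion of the first summand; its image is
    all of \<open>Q \<oplus> 0\<close> because \<open>q\<close> is epic.\<close>
  define g where "g = pair Q q (hzero X Q)"
  show g: "arrow C g" "Dom C g = X" "Cod C g = sq_ob Q" using q X by (simp_all add: g_def)
  fix y assume "mem y (fst_sub Q)"
  then have y: "arrow C y" "Cod C y = sq_ob Q" "snd_arr Q \<cdot> y = hzero (Dom C y) Q"
    unfolding mem_fst_sub[OF q(5)] by auto
  obtain p x where p: "epic C p" "Cod C p = Dom C y" "arrow C x" "Dom C x = Dom C p" "Cod C x = X"
      "y \<cdot> p = pair Q (q \<cdot> x) (hzero (Dom C p) Q)"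
    using fst_sub_lift[OF y] .
  have "y \<cdot> p = g \<cdot> x" unfolding p(6) g_def using p(1,3-5) q X by (simp add: pair_cmp)
  then show "mem y (im_sub C g)"
    unfolding mem_im_sub[OF g(1)] g using y(1,2) p(1-5) by blast
qed

lemma cube_below_snd_sub:
  assumes "strict_cube (Sub C (sq_ob Q)) n c" "\<forall>S\<subseteq>{1..n}. c S \<sqsubseteq>\<^bsub>Sub C (sq_ob Q)\<^esub> snd_sub Q"
  shows "n \<le> d"
proof (rule cube_below_image[OF _ _ _ snd_sub_closed[OF q(5)] _ assms])
  define g where "g = pair Q (hzero X Q) q"
  show g: "arrow C g" "Dom C g = X" "Cod C g = sq_ob Q" using q X by (simp_all add: g_def)
  fix y assume "mem y (snd_sub Q)"
  then have y: "arrow C y" "Cod C y = sq_ob Q" "fst_arr Q \<cdot> y = hzero (Dom C y) Q"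
    unfolding mem_snd_sub[OF q(5)] by auto
  obtain p x where p: "epic C p" "Cod C p = Dom C y" "arrow C x" "Dom C x = Dom C p" "Cod C x = X"
      "y \<cdot> p = pair Q (hzero (Dom C p) Q) (q \<cdot> x)"
    using snd_sub_lift[OF y] .
  have "y \<cdot> p = g \<cdot> x" unfolding p(6) g_def using p(1,3-5) q X by (simp add: pair_cmp)
  then show "mem y (im_sub C g)"
    unfolding mem_im_sub[OF g(1)] g using y(1,2) p(1-5) by blast
qed

lemma specializes_iff_stable:
  "(\<exists>\<psi>\<in>carrier (Hom D B B). \<phi> 2 G = endo_graph D B \<psi>) \<longleftrightarrow> image_A \<sqsubseteq>\<^bsub>Sub C X\<^esub> A"
proof
  note H = snd_sub_closed[OF q(5)]
  assume "\<exists>\<psi>\<in>carrier (Hom D B B). \<phi> 2 G = endo_graph D B \<psi>"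
  then obtain \<psi> where psi: "arrow D \<psi>" "Dom D \<psi> = B" "Cod D \<psi> = B" "\<phi> 2 G = endo_graph D B \<psi>"
    using B by (auto simp: D.hom_iff)
  define W where "W = G \<sqinter>\<^bsub>Sub C (sq_ob Q)\<^esub> snd_sub Q"
  have W: "W \<in> Subs (sq_ob Q)" "W \<sqsubseteq>\<^bsub>Sub C (sq_ob Q)\<^esub> G" "W \<sqsubseteq>\<^bsub>Sub C (sq_ob Q)\<^esub> snd_sub Q"
    using G_closed H by (auto simp: W_def sq.meet_left sq.meet_right)
  \<comment> \<open>Monotonicity yields just this inclusion, which suffices because a graph is
    disjoint from \<open>0 \<oplus> B\<close>.\<close>
  have "\<phi> 2 W \<sqsubseteq>\<^bsub>Sub D (D.sq_ob B)\<^esub> \<phi> 2 G \<sqinter>\<^bsub>Sub D (D.sq_ob B)\<^esub> \<phi> 2 (snd_sub Q)"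
    by (intro sqD.le_meetI flat2.map_closed flat2.map_mono W G_closed H)
  also have "\<phi> 2 G \<sqinter>\<^bsub>Sub D (D.sq_ob B)\<^esub> \<phi> 2 (snd_sub Q) = \<bottom>\<^bsub>Sub D (D.sq_ob B)\<^esub>"
    unfolding psi(4) map_snd_sub by (rule D.endo_graph_meet_snd_sub[OF B psi(1-3)])
  finally have "\<phi> 2 W = \<phi> 2 \<bottom>\<^bsub>Sub C (sq_ob Q)\<^esub>"
    unfolding flat2.map_bottom using sqD.le_bottom_iff flat2.map_closed[OF W(1)] by blast
  then have "flat_of (Sub C (sq_ob Q)) W = {}"
    using flat2.map_eq_iff[OF W(1) sq.bottom_closed] sq.flat_of_bottom by simp
  \<comment> \<open>A cube below \<open>W\<close> lies in \<open>0 \<oplus> Q\<close>, where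
    dimension \<open>Suc d\<close> is excluded.\<close>
  moreover have "\<not> (\<exists>c. strict_cube (Sub C (sq_ob Q)) (Suc d) c \<and> (\<forall>S\<subseteq>{1..Suc d}. c S \<sqsubseteq>\<^bsub>Sub C (sq_ob Q)\<^esub> W))"
  proof
    assume "\<exists>c. strict_cube (Sub C (sq_ob Q)) (Suc d) c \<and> (\<forall>S\<subseteq>{1..Suc d}. c S \<sqsubseteq>\<^bsub>Sub C (sq_ob Q)\<^esub> W)"
    then obtain c where c: "strict_cube (Sub C (sq_ob Q)) (Suc d) c" "\<forall>S\<subseteq>{1..Suc d}. c S \<sqsubseteq>\<^bsub>Sub C (sq_ob Q)\<^esub> W"
      by blast
    have "\<forall>S\<subseteq>{1..Suc d}. c S \<sqsubseteq>\<^bsub>Sub C (sq_ob Q)\<^esub> snd_sub Q"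
      using c(2) sq.strict_cube_closed[OF c(1)] sq.le_trans[OF _ W(3)] W(1) H by blast
    then show False using cube_below_snd_sub[OF c(1)] by simp
  qed
  ultimately have "W = \<bottom>\<^bsub>Sub C (sq_ob Q)\<^esub>" by (rule sq.bottom_if_flat_of_empty[OF W(1)])
  then show "image_A \<sqsubseteq>\<^bsub>Sub C X\<^esub> A" unfolding W_def G_meet_snd_sub_iff .
next
  assume "image_A \<sqsubseteq>\<^bsub>Sub C X\<^esub> A"
  then have "G \<sqinter>\<^bsub>Sub C (sq_ob Q)\<^esub> snd_sub Q = \<bottom>\<^bsub>Sub C (sq_ob Q)\<^esub>"
    unfolding G_meet_snd_sub_iff .
  note compl = flat2.map_complement[OF G_closed snd_sub_closed[OF q(5)] this G_join_snd_sub, unfolded map_snd_sub]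
  obtain \<psi> where "arrow D \<psi>" "Dom D \<psi> = B" "Cod D \<psi> = B" "\<phi> 2 G = endo_graph D B \<psi>"
    using D.complement_of_snd_sub_is_graph[OF B flat2.map_closed[OF G_closed] compl] .
  then show "\<exists>\<psi>\<in>carrier (Hom D B B). \<phi> 2 G = endo_graph D B \<psi>"
    using B by (auto simp: D.hom_iff)
qed

lemma specializes_zero_if_zero:
  assumes "a = hzero X X"
  shows "\<phi> 2 G = endo_graph D B \<zero>\<^bsub>Hom D B B\<^esub>"
  unfolding G_zero[OF assms] map_fst_sub D.endo_graph_zero[OF B] ..

lemma N_le: "N \<sqsubseteq>\<^bsub>Sub C (sq_ob Q)\<^esub> G" "N \<sqsubseteq>\<^bsub>Sub C (sq_ob Q)\<^esub> fst_sub Q"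
  unfolding N_def using G_closed fst_sub_closed[OF q(5)] by (auto simp: sq.meet_left sq.meet_right)

lemma no_large_cube_below_fst_sub:
  "\<not> (\<exists>c. strict_cube (Sub C (sq_ob Q)) (Suc d) c \<and>
     (\<forall>S\<subseteq>{1..Suc d}. c S \<sqsubseteq>\<^bsub>Sub C (sq_ob Q)\<^esub> fst_sub Q))"
  using cube_below_fst_sub Suc_n_not_le_n by blast

text \<open>Specializing to 0 means that \<open>G\<close> and \<open>Q \<oplus> 0\<close> have the
  same flat, and then so does their meet \<open>N\<close>. For nested elements with bounded cubes,
  equal flats amount to an essential inclusion.\<close>

lemma specializes_zero_iff_essential:
  assumes stab: "image_A \<sqsubseteq>\<^bsub>Sub C X\<^esub> A"
  shows "\<phi> 2 G = endo_graph D B \<zero>\<^bsub>Hom D B B\<^esub> \<longleftrightarrow> sq.essential N (fst_sub Q)"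
proof
  note E = fst_sub_closed[OF q(5)]
  assume "\<phi> 2 G = endo_graph D B \<zero>\<^bsub>Hom D B B\<^esub>"
  then have "\<phi> 2 G = \<phi> 2 (fst_sub Q)" unfolding map_fst_sub D.endo_graph_zero[OF B] .
  then have "flat_of (Sub C (sq_ob Q)) (fst_sub Q) \<subseteq> flat_of (Sub C (sq_ob Q)) N"
    unfolding flat2.map_eq_iff[OF G_closed E] N_def sq.flat_of_meet[OF G_closed E] by simp
  then show "sq.essential N (fst_sub Q)"
    using sq.essential_if_flat_of_subset[OF N_closed E N_le(2)] no_large_cube_below_fst_sub by blast
next
  note E = fst_sub_closed[OF q(5)]
  assume "sq.essential N (fst_sub Q)"
  then have "\<phi> 2 N = D.fst_sub B"
    using flat2.map_eq_iff[OF N_closed E] sq.flat_of_essential[OF N_closed E] map_fst_sub by simp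
  \<comment> \<open>This one inclusion is enough: stability makes \<open>\<phi> 2 G\<close> a graph,
    and a graph containing \<open>B \<oplus> 0\<close> is that of zero.\<close>
  then have le: "D.fst_sub B \<sqsubseteq>\<^bsub>Sub D (D.sq_ob B)\<^esub> \<phi> 2 G"
    using flat2.map_mono[OF N_closed G_closed N_le(1)] by simp
  obtain \<psi> where psi: "\<psi> \<in> carrier (Hom D B B)" "\<phi> 2 G = endo_graph D B \<psi>"
    using iffD2[OF specializes_iff_stable stab] by blast
  then have "\<psi> = \<zero>\<^bsub>Hom D B B\<^esub>"
    using D.endo_zero_if_fst_sub_le_graph[OF B, of \<psi>] le psi D.hom_iff[OF B B] by metis
  then show "\<phi> 2 G = endo_graph D B \<zero>\<^bsub>Hom D B B\<^esub>" using psi by simp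
qed

text \<open>Cubes pass along \<open>f\<close> between the subquotient and the subobjects below
  \<open>N\<close>. They have dimension at most \<open>d\<close> because \<open>N\<close> lies in
  \<open>Q \<oplus> 0\<close>. If \<open>N\<close> is essential, the rank of \<open>Q\<close> at the
  bottom shows that \<open>d\<close> is reached; if \<open>d\<close> is reached, the cube is of
  maximal dimension and \<open>N\<close> is essential.\<close>

lemma rk0_subquot_iff_essential:
  assumes b: "arrow C b" "Dom C b = X" "Cod C b = X" and ab: "a \<cdot> b = Idn C X" and ba: "b \<cdot> a = Idn C X"
    and stab: "image_A \<sqsubseteq>\<^bsub>Sub C X\<^esub> A"
  shows "rk0 (Sub C (subquot_ob C A image_A)) = enat d \<longleftrightarrow> sq.essential N (fst_sub Q)"
proof -
  note E = fst_sub_closed[OF q(5)]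
  obtain f where f: "monic C f" "Dom C f = subquot_ob C A image_A" "Cod C f = sq_ob Q" "im_sub C f = N"
    using subquot_embedding[OF b ab ba stab] .
  have fa: "arrow C f" and Z: "subquot_ob C A image_A \<in> Ob C" using f(1,2) by (simp, metis arrow_Ob(1) monic_arrow)
  interpret Z: bounded_modular_lattice "Sub C (subquot_ob C A image_A)" by (rule Sub_bounded_modular_lattice[OF Z])
  have up: "\<exists>c'. strict_cube (Sub C (sq_ob Q)) n c' \<and> (\<forall>S\<subseteq>{1..n}. c' S \<sqsubseteq>\<^bsub>Sub C (sq_ob Q)\<^esub> N)"
    if c: "strict_cube (Sub C (subquot_ob C A image_A)) n c" for n c
  proof (intro exI conjI allI impI)
    show cube: "strict_cube (Sub C (sq_ob Q)) n (direct_im C f \<circ> c)"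
      unfolding f(3)[symmetric]
    proof (rule strict_cube_direct_im[OF fa])
      fix x S assume S: "S \<subseteq> {1..n}" and x: "arrow C x" "Cod C x = Dom C f" "f \<cdot> x = hzero (Dom C x) (Cod C f)"
      show "mem x (c S)"
        by (rule mem_if_zero[OF Z.strict_cube_closed[OF c S] x(1)]) (use monic_zero[OF f(1) x] f(2) in simp)
    qed (use c f(2) in simp)
    fix S assume S: "S \<subseteq> {1..n}"
    have cS: "c S \<in> Subs (Dom C f)" using Z.strict_cube_closed[OF c S] f(2) by simp
    have "mem y (im_sub C f)" if "mem y (direct_im C f (c S))" for y
      using that mem_arrow[OF _ cS] unfolding mem_direct_im[OF fa cS] mem_im_sub[OF fa] by blast
    then show "(direct_im C f \<circ> c) S \<sqsubseteq>\<^bsub>Sub C (sq_ob Q)\<^esub> N"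
      using Sub_le_iff[OF sq.strict_cube_closed[OF cube S] N_closed] f(4) by simp
  qed
  have N_E: "\<forall>S\<subseteq>{1..n}. c S \<sqsubseteq>\<^bsub>Sub C (sq_ob Q)\<^esub> fst_sub Q"
    if "strict_cube (Sub C (sq_ob Q)) n c" "\<forall>S\<subseteq>{1..n}. c S \<sqsubseteq>\<^bsub>Sub C (sq_ob Q)\<^esub> N" for n c
    using that sq.strict_cube_closed sq.le_trans[OF _ N_le(2)] N_closed E by blast
  have "rk0 (Sub C (subquot_ob C A image_A)) \<le> enat d"
    using up N_E cube_below_fst_sub by (intro rk0_le) fastforce
  moreover have "enat d \<le> rk0 (Sub C (subquot_ob C A image_A))" if ess: "sq.essential N (fst_sub Q)"
    \<comment> \<open>Reading \<open>d\<close> as the rank of \<open>Q\<close> at the bottom reduces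
      the claim to cubes based there, and those can be shrunk into an essential subobject.\<close>
    unfolding rk_bot[symmetric]
  proof (rule rk_bot_le)
    fix n c assume c: "strict_cube (Sub C (quot_ob C A)) n c" "c {} = \<bottom>\<^bsub>Sub C (quot_ob C A)\<^esub>"
    interpret Q: bounded_modular_lattice "Sub C Q" by (rule Sub_bounded_modular_lattice[OF q(5)])
    define i where "i = pair Q (Idn C Q) (hzero Q Q)"
    have i: "arrow C i" "Dom C i = Q" "Cod C i = sq_ob Q" using q by (simp_all add: i_def)
    have cube: "strict_cube (Sub C (Dom C i)) n c" using c(1) i by (simp add: Q_def)
    note cl = Q.strict_cube_closed[OF cube[unfolded i]]
    have fst_i: "fst_arr Q \<cdot> i \<cdot> x = x" and snd_i: "snd_arr Q \<cdot> i \<cdot> x = hzero (Dom C x) Q"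
      if "arrow C x" "Cod C x = Q" for x
      using cmp_eq_cmp[of "fst_arr Q" i "Idn C Q" x] cmp_eq_cmp[of "snd_arr Q" i "hzero Q Q" x] that i q
      by (simp_all add: i_def)
    have cube': "strict_cube (Sub C (sq_ob Q)) n (direct_im C i \<circ> c)"
      unfolding i(3)[symmetric]
    proof (rule strict_cube_direct_im[OF i(1) cube])
      fix x S assume S: "S \<subseteq> {1..n}" and x: "arrow C x" "Cod C x = Dom C i" "i \<cdot> x = hzero (Dom C x) (Cod C i)"
      have "x = hzero (Dom C x) Q" using fst_i[of x] x i q by simp
      then show "mem x (c S)" using mem_if_zero[OF cl[OF S] x(1)] by simp
    qed
    have below: "(direct_im C i \<circ> c) S \<sqsubseteq>\<^bsub>Sub C (sq_ob Q)\<^esub> fst_sub Q" if S: "S \<subseteq> {1..n}" for S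
      unfolding Sub_le_iff[OF sq.strict_cube_closed[OF cube' S] E]
    proof (intro allI impI)
      have cS: "c S \<in> Subs (Dom C i)" using cl[OF S] i by simp
      fix y assume "mem y ((direct_im C i \<circ> c) S)"
      then obtain p s where y: "arrow C y" "Cod C y = sq_ob Q" and p: "epic C p" "Cod C p = Dom C y"
          "mem s (c S)" "Dom C s = Dom C p" "y \<cdot> p = i \<cdot> s"
        using mem_direct_im[OF i(1) cS] i by auto
      have s: "arrow C s" "Cod C s = Q" using mem_arrow[OF p(3) cS] i by auto
      have "(snd_arr Q \<cdot> y) \<cdot> p = snd_arr Q \<cdot> (y \<cdot> p)" using y p(1,2) q by simp
      also have "\<dots> = hzero (Dom C p) Q" unfolding p(5) using snd_i[OF s] p(4) by simp
      finally show "mem y (fst_sub Q)"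
        unfolding mem_fst_sub[OF q(5)] using epic_zero[OF p(1), of "snd_arr Q \<cdot> y"] y p(2) q by simp
    qed
    \<comment> \<open>The base must remain the bottom after the move to \<open>Q \<oplus> 0\<close>,
      since \<open>essential_cube\<close> starts from there.\<close>
    have "(direct_im C i \<circ> c) {} \<sqsubseteq>\<^bsub>Sub C (sq_ob Q)\<^esub> \<bottom>\<^bsub>Sub C (sq_ob Q)\<^esub>"
    proof -
      have c0: "c {} \<in> Subs (Dom C i)" and bot: "\<bottom>\<^bsub>Sub C (sq_ob Q)\<^esub> \<in> Subs (Cod C i)" using cl i by simp_all
      have "c {} \<sqsubseteq>\<^bsub>Sub C (Dom C i)\<^esub> preim i \<bottom>\<^bsub>Sub C (sq_ob Q)\<^esub>"
        using Q.bottom_lower[of "preim i \<bottom>\<^bsub>Sub C (sq_ob Q)\<^esub>"] preim_closed[OF i(1) bot] c(2) i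
        by (simp add: Q_def)
      then show ?thesis using direct_im_le_iff[OF i(1) c0 bot] i by simp
    qed
    then have "(direct_im C i \<circ> c) {} = \<bottom>\<^bsub>Sub C (sq_ob Q)\<^esub>"
      using sq.le_bottom_iff sq.strict_cube_closed[OF cube', of "{}"] by simp
    then obtain c' where c': "strict_cube (Sub C (sq_ob Q)) n c'" "\<forall>S\<subseteq>{1..n}. c' S \<sqsubseteq>\<^bsub>Sub C (sq_ob Q)\<^esub> N"
      using sq.essential_cube[OF ess N_closed E cube' _ below] by blast
    have "mem y (im_sub C f)" if "S \<subseteq> {1..n}" "mem y (c' S)" for y S
      using that(2) c'(2)[rule_format, OF that(1)] f(4)
      unfolding Sub_le_iff[OF sq.strict_cube_closed[OF c'(1) that(1)] N_closed] by metis
    then have "strict_cube (Sub C (Dom C f)) n (preim f \<circ> c')"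
      by (intro strict_cube_preim[OF fa]) (use c'(1) f(3) in simp_all)
    then show "enat n \<le> rk0 (Sub C (subquot_ob C A image_A))"
      using enat_le_rk0 f(2) by simp
  qed
  moreover have "sq.essential N (fst_sub Q)" if rk: "rk0 (Sub C (subquot_ob C A image_A)) = enat d"
  proof -
    \<comment> \<open>The reduced rank provides a cube with unspecified base, which
      \<open>essential_if_maximal_cube\<close> permits.\<close>
    obtain c where "strict_cube (Sub C (subquot_ob C A image_A)) d c" using Z.rk0_attained[OF rk] by blast
    then obtain c' where "strict_cube (Sub C (sq_ob Q)) d c'" "\<forall>S\<subseteq>{1..d}. c' S \<sqsubseteq>\<^bsub>Sub C (sq_ob Q)\<^esub> N"
      using up by blast
    then show ?thesis
      using sq.essential_if_maximal_cube[OF N_closed E N_le(2)] no_large_cube_below_fst_sub by blast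
  qed
  ultimately show ?thesis by (meson antisym)
qed

end

section \<open>Linear functors on finite-dimensional vector spaces\<close>

lemma Kn_Ob: "Kn n \<in> Ob (KVect h)"
  by (simp add: KVect_def vec_vs vec_space.fin_dim)

lemma vec_of_list_2:
  "vec_of_list [x, y] \<in> carrier_vec 2" "vec_of_list [x, y] $ 0 = x" "vec_of_list [x, y] $ 1 = y"
  using carrier_vecI[OF dim_vec_of_list, of "[x, y]"] vec_of_list_index[of "[x, y]" 0] vec_of_list_index[of "[x, y]" 1]
  by (simp_all only: list.size nth_Cons_0 nth_Cons_Suc One_nat_def numeral_2_eq_2 add_Suc_right add_0_right)

lemma scalar_graph_eq: "scalar_graph \<alpha> = {v \<in> carrier_vec 2. v $ 1 = \<alpha> * v $ 0}"
proof (intro Set.set_eqI iffI)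
  fix v assume "v \<in> scalar_graph \<alpha>"
  then obtain x where "v = vec_of_list [x, \<alpha> * x]" by (auto simp: scalar_graph_def)
  then show "v \<in> {v \<in> carrier_vec 2. v $ 1 = \<alpha> * v $ 0}"
    by (simp only: vec_of_list_2 mem_Collect_eq simp_thms)
next
  fix v assume v: "v \<in> {v \<in> carrier_vec 2. v $ 1 = \<alpha> * v $ 0}"
  have "v = vec_of_list [v $ 0, \<alpha> * v $ 0]"
    by (rule eq_vecI) (use v in \<open>auto simp: less_Suc_eq numeral_2_eq_2\<close>)
  then show "v \<in> scalar_graph \<alpha>" unfolding scalar_graph_def by blast
qed

text \<open>To apply \<open>F\<close>, the graph must be an object, that is, a finite-dimensional
  space. It is the line spanned by \<open>(1, \<alpha>)\<close>.\<close>

lemma scalar_graph_Ob: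
  fixes \<alpha> :: "'k::field"
  shows "(Kn 2)\<lparr>carrier := scalar_graph \<alpha>\<rparr> \<in> Ob (KVect h)"
proof -
  let ?W = "(Kn 2)\<lparr>carrier := scalar_graph \<alpha>\<rparr>"
  have "submodule class_ring (scalar_graph \<alpha>) (Kn 2)"
    by (intro LinearCombinations.submodule.intro vec_module)
      (auto simp: scalar_graph_eq module_vec_simps class_ring_simps algebra_simps)
  then have "subspace class_ring (scalar_graph \<alpha>) (Kn 2)"
    by (intro VectorSpace.subspace.intro vec_vs)
  then have W: "vectorspace class_ring ?W" by (rule vectorspace.subspace_is_vs[OF vec_vs])
  interpret W: vectorspace class_ring ?W by (rule W)
  define w where "w = vec_of_list [1, \<alpha>]"
  have w: "w \<in> scalar_graph \<alpha>"
    by (simp only: w_def scalar_graph_eq vec_of_list_2 mem_Collect_eq simp_thms mult_1_right)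
  \<comment> \<open>The coefficient of \<open>w\<close> is the first coordinate of
    \<open>v\<close>.\<close>
  have "v \<in> W.span {w}" if v: "v \<in> scalar_graph \<alpha>" for v
  proof -
    interpret S: submodule class_ring "W.span {w}" ?W
      by (rule W.span_is_submodule) (use w in simp)
    have "w \<in> W.span {w}" using W.in_own_span[of "{w}"] w by simp
    then have "v $ 0 \<cdot>\<^sub>v w \<in> W.span {w}"
      using S.smult_closed[of "v $ 0" w] by (simp add: module_vec_simps class_ring_simps)
    moreover have "v $ 0 \<cdot>\<^sub>v w = v"
      by (rule eq_vecI)
        (use v in \<open>auto simp: w_def scalar_graph_eq less_Suc_eq numeral_2_eq_2\<close>)
    ultimately show ?thesis by simp
  qed
  then have "W.gen_set {w}"
    using W.span_is_subset2[of "{w}"] w by auto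
  then have "W.fin_dim"
    unfolding W.fin_dim_def using w by (intro exI[of _ "{w}"]) simp
  then show ?thesis using W by (simp add: KVect_def)
qed

section \<open>Arrows between coordinate spaces and their values under the functor\<close>

lemma lin_arr_cong: "(\<And>v. v \<in> carrier V \<Longrightarrow> f v = g v) \<Longrightarrow> lin_arr V W f = lin_arr V W g"
  by (auto simp: lin_arr_def restrict_def)

lemma lin_arr_hom: "f \<in> module_hom class_ring V W \<Longrightarrow> lin_arr V W f \<in> carrier (Hom (KVect h) V W)"
  by (auto simp: KVect_def)

lemma lin_arr_cmp:
  "f \<in> carrier V \<rightarrow> carrier W \<Longrightarrow>
    lin_arr W U g \<cdot>\<^bsub>KVect h\<^esub> lin_arr V W f = lin_arr V U (g \<circ> f)"
  by (auto simp: KVect_def lin_arr_def restrict_def fun_eq_iff)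

lemma coordinate_hom: "i < n \<Longrightarrow> (\<lambda>v. vec 1 (\<lambda>_. v $ i)) \<in> module_hom class_ring (Kn n) (Kn 1)"
  by (auto simp: module_hom_def module_vec_simps class_ring_simps)

lemma scalar_hom: "(\<lambda>v. x \<cdot>\<^sub>v v) \<in> module_hom class_ring (Kn n) (Kn n)"
  by (auto simp: module_hom_def module_vec_simps class_ring_simps smult_add_distrib_vec smult_smult_assoc
      mult.commute)

context abelian_category
begin

context
  fixes h :: "'a \<Rightarrow> 'k::field" and F :: "('k vsp, 'k vsp_arr, 'b, 'c) cfunctor"
  assumes F: "linear_functor (KVect h) C F"
begin

lemma fob_closed: "V \<in> Ob (KVect h) \<Longrightarrow> fob F V \<in> Ob C"
  using F by (simp add: linear_functor_def)

lemma FK_Ob: "FK F \<in> Ob C"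
  unfolding FK_def by (rule fob_closed[OF Kn_Ob])

lemma farr_arrow:
  assumes "V \<in> Ob (KVect h)" "W \<in> Ob (KVect h)" "f \<in> module_hom class_ring V W"
  shows "arrow C (farr F (lin_arr V W f))" "Dom C (farr F (lin_arr V W f)) = fob F V"
    "Cod C (farr F (lin_arr V W f)) = fob F W"
proof -
  have "farr F \<in> module_hom class_ring (Hom (KVect h) V W) (Hom C (fob F V) (fob F W))"
    using F assms by (simp add: linear_functor_def)
  then have "farr F (lin_arr V W f) \<in> carrier (Hom C (fob F V) (fob F W))"
    using module_hom_closed lin_arr_hom[OF assms(3), of h] by blast
  then show "arrow C (farr F (lin_arr V W f))" "Dom C (farr F (lin_arr V W f)) = fob F V"
    "Cod C (farr F (lin_arr V W f)) = fob F W"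
    using hom_iff fob_closed assms by auto
qed

lemma farr_cmp:
  assumes "V \<in> Ob (KVect h)" "W \<in> Ob (KVect h)" "U \<in> Ob (KVect h)"
    "f \<in> module_hom class_ring V W" "g \<in> module_hom class_ring W U"
  shows "farr F (lin_arr W U g) \<cdot> farr F (lin_arr V W f) = farr F (lin_arr V U (g \<circ> f))"
proof -
  have "farr F (lin_arr W U g \<cdot>\<^bsub>KVect h\<^esub> lin_arr V W f) = farr F (lin_arr W U g) \<cdot> farr F (lin_arr V W f)"
    using F assms lin_arr_hom[of f V W h] lin_arr_hom[of g W U h] unfolding linear_functor_def by blast
  then show ?thesis
    using lin_arr_cmp[of f V W h U g] module_hom_closed[OF assms(4)] by simp
qed

lemma farr_Idn: "V \<in> Ob (KVect h) \<Longrightarrow> farr F (lin_arr V V (\<lambda>v. v)) = Idn C (fob F V)"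
  using F unfolding linear_functor_def by (auto simp: KVect_def)

lemma F_scalar_arrow:
  "arrow C (F_scalar F x)" "Dom C (F_scalar F x) = FK F" "Cod C (F_scalar F x) = FK F"
  unfolding F_scalar_def FK_def by (rule farr_arrow[OF Kn_Ob Kn_Ob scalar_hom])+

lemma F_scalar_mult: "F_scalar F x \<cdot> F_scalar F y = F_scalar F (x * y)"
proof -
  have "lin_arr (Kn 1) (Kn 1) ((\<lambda>v. x \<cdot>\<^sub>v v) \<circ> (\<lambda>v. y \<cdot>\<^sub>v v)) = lin_arr (Kn 1) (Kn 1) (\<lambda>v. (x * y) \<cdot>\<^sub>v v)"
    by (rule lin_arr_cong) (simp add: smult_smult_assoc)
  then show ?thesis
    unfolding F_scalar_def farr_cmp[OF Kn_Ob Kn_Ob Kn_Ob scalar_hom scalar_hom] by simp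
qed

lemma F_scalar_1: "F_scalar F 1 = Idn C (FK F)"
proof -
  have eq: "lin_arr (Kn 1) (Kn 1) (\<lambda>v. 1 \<cdot>\<^sub>v v) = lin_arr (Kn 1) (Kn 1) (\<lambda>v :: 'k vec. v)"
    by (rule lin_arr_cong) simp
  show ?thesis unfolding F_scalar_def FK_def eq by (rule farr_Idn[OF Kn_Ob])
qed

text \<open>The zero map is its own double in the hom-set and \<open>F\<close> is additive, so
  cancellation gives zero.\<close>

lemma F_scalar_0: "F_scalar F 0 = hzero (FK F) (FK F)"
proof -
  let ?z = "lin_arr (Kn 1) (Kn 1) (\<lambda>v. 0 \<cdot>\<^sub>v v) :: 'k vsp_arr"
  have "farr F \<in> module_hom class_ring (Hom (KVect h) (Kn 1) (Kn 1)) (Hom C (FK F) (FK F))"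
    using F Kn_Ob[of 1 h] by (simp add: linear_functor_def FK_def)
  then have "farr F (?z \<oplus>\<^bsub>Hom (KVect h) (Kn 1) (Kn 1)\<^esub> ?z) = farr F ?z \<oplus>\<^bsub>Hom C (FK F) (FK F)\<^esub> farr F ?z"
    by (rule module_hom_add) (rule lin_arr_hom[OF scalar_hom])+
  moreover have "?z \<oplus>\<^bsub>Hom (KVect h) (Kn 1) (Kn 1)\<^esub> ?z = ?z"
    by (auto simp: KVect_def lin_arr_def module_vec_simps restrict_def fun_eq_iff)
  ultimately have "F_scalar F 0 = F_scalar F 0 \<boxplus> F_scalar F 0"
    using F_scalar_arrow[of 0] by (simp add: F_scalar_def hadd_def)
  then show ?thesis
    using hadd_cancel[of "F_scalar F 0" "F_scalar F 0"] F_scalar_arrow[of 0] by simp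
qed

text \<open>The parametrization \<open>t\<close> of the graph by its first coordinate is an
  isomorphism from \<open>K\<close>. Hence the inclusion of the graph and its composite with
  \<open>t\<close> have the same image under \<open>F\<close>, and the composite has the coordinates
  \<open>1\<close> and \<open>\<alpha>\<close>.\<close>

lemma F_sub_scalar_graph: "F_sub C F 2 (scalar_graph \<alpha>) = endo_graph C (FK F) (F_scalar F \<alpha>)"
proof -
  let ?X = "FK F" and ?V = "(Kn 2)\<lparr>carrier := scalar_graph \<alpha>\<rparr> :: 'k vsp"
  define t where "t v = vec 2 (\<lambda>i. if i = 0 then v $ 0 else \<alpha> * v $ 0)" for v :: "'k vec"
  define c where "c i v = vec 1 (\<lambda>_. v $ i)" for i :: nat and v :: "'k vec"
  note X = FK_Ob and V = scalar_graph_Ob[of \<alpha> h] and K1 = Kn_Ob[of 1 h] and K2 = Kn_Ob[of 2 h]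
  have ch: "c i \<in> module_hom class_ring (Kn 2) (Kn 1)" if "i < 2" for i
    unfolding c_def using coordinate_hom[OF that] .
  have ih: "(\<lambda>v. v) \<in> module_hom class_ring ?V (Kn 2)"
    by (auto simp: module_hom_def module_vec_simps scalar_graph_eq)
  have sh: "c 0 \<in> module_hom class_ring ?V (Kn 1)"
    using ch[of 0] by (auto simp: module_hom_def module_vec_simps scalar_graph_eq)
  have th: "t \<in> module_hom class_ring (Kn 1) ?V"
    by (auto simp: module_hom_def module_vec_simps scalar_graph_eq t_def class_ring_simps algebra_simps
        intro!: eq_vecI)
  let ?t = "farr F (lin_arr (Kn 1) ?V t)" and ?s = "farr F (lin_arr ?V (Kn 1) (c 0))"
    and ?i = "farr F (lin_arr ?V (Kn 2) (\<lambda>v. v))" and ?c = "\<lambda>i. farr F (lin_arr (Kn 2) (Kn 1) (c i))"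
  note ta = farr_arrow[OF K1 V th, folded FK_def] and sa = farr_arrow[OF V K1 sh, folded FK_def]
    and ia = farr_arrow[OF V K2 ih] and ca = farr_arrow[OF K2 K1 ch, folded FK_def]
  \<comment> \<open>This side of the inverse relation rewrites elements of \<open>F\<close> of the
    graph as elements coming from \<open>F(K)\<close>.\<close>
  have ts: "?t \<cdot> ?s = Idn C (fob F ?V)"
  proof -
    have "lin_arr ?V ?V (t \<circ> c 0) = lin_arr ?V ?V (\<lambda>v. v)"
      by (rule lin_arr_cong) (auto simp: t_def c_def scalar_graph_eq less_2_cases_iff intro!: eq_vecI)
    then show ?thesis unfolding farr_cmp[OF V K1 V sh th] using farr_Idn[OF V] by simp
  qed
  \<comment> \<open>The coordinates of the parametrized line are multiplication by 1 and by
    \<open>\<alpha>\<close>.\<close>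
  have ci: "?c i \<cdot> ?i \<cdot> ?t = F_scalar F (if i = 0 then 1 else \<alpha>)" if i: "i < 2" for i
  proof -
    have it: "?i \<cdot> ?t = farr F (lin_arr (Kn 1) (Kn 2) ((\<lambda>v. v) \<circ> t))" by (rule farr_cmp[OF K1 V K2 th ih])
    have t2: "(\<lambda>v. v) \<circ> t \<in> module_hom class_ring (Kn 1) (Kn 2)"
      using th by (auto simp: module_hom_def module_vec_simps scalar_graph_eq)
    have "lin_arr (Kn 1) (Kn 1) (c i \<circ> ((\<lambda>v. v) \<circ> t)) =
        lin_arr (Kn 1) (Kn 1) (\<lambda>v. (if i = 0 then 1 else \<alpha>) \<cdot>\<^sub>v v)"
      using i by (intro lin_arr_cong) (auto simp: t_def c_def module_vec_simps intro!: eq_vecI)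
    then show ?thesis
      unfolding it farr_cmp[OF K1 K2 K1 t2 ch[OF i]] F_scalar_def by simp
  qed
  have cF: "(\<lambda>v. vec 1 (\<lambda>_. v $ i)) = c i" for i by (simp add: c_def fun_eq_iff)
  have Fp: "F_pow C F 2 = pair ?X (?c 0) (?c 1)"
    unfolding F_pow_def cF pair_def
    using finsum_2[of "fob F (Kn 2)" "sq_ob ?X" "\<lambda>i. pow_inj C ?X 2 i \<cdot> ?c i"] pow2D(1-15)[OF X] ca[of 0] ca[of 1]
      fob_closed[OF K2] by (simp add: hom_iff)
  define k where "k = F_pow C F 2 \<cdot> ?i"
  have k: "arrow C k" "Dom C k = fob F ?V" "Cod C k = sq_ob ?X"
    unfolding k_def Fp using ca[of 0] ca[of 1] ia by simp_all
  have kt: "k \<cdot> ?t = pair ?X (Idn C ?X) (F_scalar F \<alpha>)"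
    unfolding k_def Fp using ca[of 0] ca[of 1] ia ta ci[of 0] ci[of 1] F_scalar_1 by (simp add: pair_cmp)
  note g = mem_endo_graph[OF X F_scalar_arrow]
  \<comment> \<open>As \<open>?t\<close> has the right inverse \<open>?s\<close>, composing with it
    leaves the image unchanged.\<close>
  have "im_sub C k = im_sub C (k \<cdot> ?t)"
  proof (rule Sub_eqI[where X = "sq_ob ?X"])
    show "im_sub C k \<in> Subs (sq_ob ?X)" using im_sub_closed[OF k(1)] k by simp
    have kta: "arrow C (k \<cdot> ?t)" "Dom C (k \<cdot> ?t) = ?X" "Cod C (k \<cdot> ?t) = sq_ob ?X" using k ta by simp_all
    show "im_sub C (k \<cdot> ?t) \<in> Subs (sq_ob ?X)" using im_sub_closed[OF kta(1)] kta by simp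
    fix y assume y: "arrow C y" "Cod C y = sq_ob ?X"
    show "mem y (im_sub C k) \<longleftrightarrow> mem y (im_sub C (k \<cdot> ?t))"
      unfolding mem_im_sub[OF k(1)] mem_im_sub[OF kta(1)] k kta
    proof (intro iffI; elim conjE exE)
      fix p u assume p: "epic C p" "Cod C p = Dom C y" and u: "arrow C u" "Dom C u = Dom C p" "Cod C u = fob F ?V"
        "y \<cdot> p = k \<cdot> u"
      have "?t \<cdot> ?s \<cdot> u = u"
        using cmp_eq_cmp[OF ts u(1)] u(1,3) sa ta by simp
      then have "y \<cdot> p = (k \<cdot> ?t) \<cdot> ?s \<cdot> u"
        using u k sa ta by simp
      moreover have "arrow C (?s \<cdot> u)" "Dom C (?s \<cdot> u) = Dom C p" "Cod C (?s \<cdot> u) = ?X"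
        using u(1-3) sa by simp_all
      ultimately show "arrow C y \<and> Cod C y = sq_ob ?X \<and> (\<exists>p u. epic C p \<and> Cod C p = Dom C y \<and>
          arrow C u \<and> Dom C u = Dom C p \<and> Cod C u = ?X \<and> y \<cdot> p = (k \<cdot> ?t) \<cdot> u)"
        using y p by blast
    next
      fix p u assume p: "epic C p" "Cod C p = Dom C y" and u: "arrow C u" "Dom C u = Dom C p" "Cod C u = ?X"
        "y \<cdot> p = (k \<cdot> ?t) \<cdot> u"
      have "y \<cdot> p = k \<cdot> ?t \<cdot> u" unfolding u(4) using u(1-3) k ta by simp
      moreover have "arrow C (?t \<cdot> u)" "Dom C (?t \<cdot> u) = Dom C p" "Cod C (?t \<cdot> u) = fob F ?V"
        using u(1-3) ta by simp_all
      ultimately show "arrow C y \<and> Cod C y = sq_ob ?X \<and> (\<exists>p u. epic C p \<and> Cod C p = Dom C y \<and>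
          arrow C u \<and> Dom C u = Dom C p \<and> Cod C u = fob F ?V \<and> y \<cdot> p = k \<cdot> u)"
        using y p by blast
    qed
  qed
  moreover have "endo_graph C ?X (F_scalar F \<alpha>) = im_sub C (pair ?X (Idn C ?X) (F_scalar F \<alpha>))"
    using pow2D[OF X] F_scalar_arrow[of \<alpha>] X by (simp add: endo_graph_def pair_def hadd_def)
  ultimately show ?thesis
    unfolding F_sub_def k_def[symmetric] kt by simp
qed

end

end

theorem proposition8p10:
  fixes h :: "'k0::field \<Rightarrow> 'k::field"
    and C :: "('k0, 'o, 'a) lincat"
    and F :: "('k vsp, 'k vsp_arr, 'o, 'a) cfunctor"
    and A :: "'a set"
    and d :: enat
    and D :: "('k0, 'p, 'b) lincat"
    and B :: 'p
    and \<phi> :: "nat \<Rightarrow> 'a set \<Rightarrow> 'b set"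
    and \<sigma> :: "nat \<Rightarrow> 'k vec set \<Rightarrow> 'b set"
  assumes "infinite (UNIV :: 'k0 set)"
    and "field_hom h"
    and "abelian_category C"
    and "linear_functor (KVect h) C F"
    and "\<not> zero_object C (FK F)"
    and "cube_bounded C (FK F)"
    and "d = rk0 (Sub C (FK F))"
    and "pedestal C (FK F) A"
    and "abelian_category D"
    and "B \<in> Ob D"
    and "dir_flattening (Dir C (quot_ob C A)) (Dir D B) \<phi>"
    and "\<sigma> = pedestal_inflator C F A \<phi>"
  shows "fundamental_ring D B \<sigma> = stabilizer C F A \<and>
         fundamental_ideal D B \<sigma> =
           {0} \<union> {x \<in> stabilizer C F A. rk0 (Sub C (subquot_ob C A (scale_sub C F x A))) = d}"
proof -
  interpret C: abelian_category C by fact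
  interpret D: abelian_category D by fact
  note F = assms(4)
  let ?X = "FK F"
  have A: "A \<in> C.Subs ?X" and rk: "rk_bot (Sub C (quot_ob C A)) = rk0 (Sub C ?X)"
    using assms(8) by (auto simp: pedestal_def)
  \<comment> \<open>Cube-boundedness makes the common rank a natural number.\<close>
  obtain n where n: "d = enat n"
    using assms(6,7) by (cases d) (auto simp: cube_bounded_def)
  \<comment> \<open>Each scalar gives its own instance of the locale; only the endomorphism
    varies.\<close>
  have loc: "pedestal_flattening C ?X A (F_scalar F \<alpha>) D B \<phi> n" for \<alpha>
    by unfold_locales (use A rk n assms(7,10,11) C.F_scalar_arrow[OF F] in simp_all)
  have sigma: "\<sigma> 2 (scalar_graph \<alpha>) = \<phi> 2 (quotient_graph.G C ?X A (F_scalar F \<alpha>))" for \<alpha>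
  proof -
    interpret pedestal_flattening C ?X A "F_scalar F \<alpha>" D B \<phi> n by (rule loc)
    show ?thesis
      unfolding assms(12) pedestal_inflator_def C.F_sub_scalar_graph[OF F] G_def ..
  qed
  have stab: "\<alpha> \<in> stabilizer C F A \<longleftrightarrow> direct_im C (F_scalar F \<alpha>) A \<sqsubseteq>\<^bsub>Sub C ?X\<^esub> A" for \<alpha>
    by (simp add: stabilizer_def scale_sub_def)
  have ring: "\<alpha> \<in> fundamental_ring D B \<sigma> \<longleftrightarrow> \<alpha> \<in> stabilizer C F A" for \<alpha>
    using pedestal_flattening.specializes_iff_stable[OF loc, of \<alpha>]
    by (simp add: fundamental_ring_def specializes_def sigma stab)
  have ideal0: "0 \<in> fundamental_ideal D B \<sigma>"
    using pedestal_flattening.specializes_zero_if_zero[OF loc C.F_scalar_0[OF F]]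
    by (simp add: fundamental_ideal_def specializes_def sigma)
  have ideal: "\<alpha> \<in> fundamental_ideal D B \<sigma> \<longleftrightarrow>
      \<alpha> \<in> stabilizer C F A \<and> rk0 (Sub C (subquot_ob C A (scale_sub C F \<alpha> A))) = d"
    if nz: "\<alpha> \<noteq> 0" for \<alpha>
  proof -
    interpret pedestal_flattening C ?X A "F_scalar F \<alpha>" D B \<phi> n by (rule loc)
    \<comment> \<open>This is where \<open>\<alpha> \<noteq> 0\<close> enters: the scalar acts on
      \<open>F(K)\<close> as an automorphism.\<close>
    have inv: "F_scalar F \<alpha> \<cdot>\<^bsub>C\<^esub> F_scalar F (inverse \<alpha>) = Idn C ?X"
      "F_scalar F (inverse \<alpha>) \<cdot>\<^bsub>C\<^esub> F_scalar F \<alpha> = Idn C ?X"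
      using nz by (simp_all add: C.F_scalar_mult[OF F] C.F_scalar_1[OF F])
    have mem: "\<alpha> \<in> fundamental_ideal D B \<sigma> \<longleftrightarrow> \<phi> 2 G = endo_graph D B \<zero>\<^bsub>Hom D B B\<^esub>"
      by (simp add: fundamental_ideal_def specializes_def sigma)
    have e1: "\<phi> 2 G = endo_graph D B \<zero>\<^bsub>Hom D B B\<^esub> \<longleftrightarrow>
        rk0 (Sub C (subquot_ob C A (direct_im C (F_scalar F \<alpha>) A))) = d"
      if "direct_im C (F_scalar F \<alpha>) A \<sqsubseteq>\<^bsub>Sub C ?X\<^esub> A"
      using specializes_zero_iff_essential[OF that]
        rk0_subquot_iff_essential[OF C.F_scalar_arrow[OF F] inv that] n by simp
    \<comment> \<open>The criterion through \<open>N\<close> presupposes stability. Specializing to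
      0 is specializing to some endomorphism, so it already puts the scalar into the
      stabilizer.\<close>
    have e2: "direct_im C (F_scalar F \<alpha>) A \<sqsubseteq>\<^bsub>Sub C ?X\<^esub> A"
      if "\<phi> 2 G = endo_graph D B \<zero>\<^bsub>Hom D B B\<^esub>"
    proof (rule iffD1[OF specializes_iff_stable])
      have "\<zero>\<^bsub>Hom D B B\<^esub> \<in> carrier (Hom D B B)"
        using D.hom_iff[OF B B] D.hzero_arrow[OF B B] by simp
      then show "\<exists>\<psi>\<in>carrier (Hom D B B). \<phi> 2 G = endo_graph D B \<psi>" using that by blast
    qed
    show ?thesis
      unfolding mem stab scale_sub_def using e1 e2 by iprover
  qed
  show ?thesis
  proof (intro conjI Set.set_eqI)
    show "x \<in> fundamental_ring D B \<sigma> \<longleftrightarrow> x \<in> stabilizer C F A" for x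
      by (rule ring)
    show "x \<in> fundamental_ideal D B \<sigma> \<longleftrightarrow>
        x \<in> {0} \<union> {x \<in> stabilizer C F A. rk0 (Sub C (subquot_ob C A (scale_sub C F x A))) = d}" for x
      by (cases "x = 0") (use ideal0 ideal[of x] in \<open>simp_all only: Un_iff mem_Collect_eq singleton_iff simp_thms\<close>)
  qed
qed

end
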